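(* Fix a pair $$(t_1,t_2)\in\left\{\left(\tfrac13,\tfrac13\right),\left(\tfrac13,\tfrac14\right),\left(\tfrac13,\tfrac15\right),\left(\tfrac13,\tfrac25\right),\left(\tfrac15,\tfrac25\right)\right\}$$ and consider the exchange matrix $$B=\begin{pmatrix}0&2\cos(\pi t_1)&0\\-2\cos(\pi t_1)&0&2\cos(\pi t_2)\\0&-2\cos(\pi t_2)&0\end{pmatrix}.$$ 1. There are geometric realisations $(\mathbf v,B)$ (on the sphere $\mathbb S^2$) with the reference point in a compatible position. 2. All such realisations result in the same exchange graph (up to graph isomorphism). 3. In all such realisations, the compatible reference point belongs to some acute-angled domain (i.e. a domain associated to an acyclic seed of the exchange graph). 4. Every choice of a reference point in an acute-angled domain (i.e. a domain associated to an acyclic seed of the exchange graph) gives such a realisation.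
   Context: **Exchange matrices.** An exchange matrix is a real skew-symmetric $3\times3$ matrix $B=(b_{ij})$, identified with the quiver on $\{1,2,3\}$ having an arrow $i\to j$ of weight $b_{ij}$ whenever $b_{ij}>0$; $B$ is acyclic if this quiver has no oriented cycle, and cyclic otherwise. The mutation $\mu_k(B)=(b'_{ij})$ is given by $b'_{ij}=-b_{ij}$ if $k\in\{i,j\}$ and $b'_{ij}=b_{ij}+(b_{ik}|b_{kj}|+|b_{ik}|b_{kj})/2$ otherwise. **Seeds on $\mathbb S^2$.** Let $V=\mathbb R^3$ with the standard inner product $(\cdot,\cdot)$. A geometric realisation of $B$ is a basis $\mathbf v=(v_1,v_2,v_3)$ of $V$ with $(v_i,v_i)=2$, $|(v_i,v_j)|=|b_{ij}|$ for $i\ne j$, and such that, if all $(v_i,v_j)\neq0$, the number of pairs $i<j$ with $(v_i,v_j)>0$ is even if $B$ is acyclic and odd otherwise. A seed is a pair $(\mathbf v,B)$, up to simultaneous permutation of indices; it is acyclic if $B$ is. Put $\Pi_v=\{w\in\mathbb S^2:(v,w)<0\}$, $l_v=\{w\in\mathbb S^2:(v,w)=0\}$. The domain of the seed is the spherical triangle $\Pi_{v_1}\cap\Pi_{v_2}\cap\Pi_{v_3}$. **Positivity and mutation.** Fix a reference point $u\in\mathbb S^2$ (not lying on any of the great circles $l_v$ for the vectors $v$ occurring in the seeds considered). A vector $v$ is positive if $u\in\Pi_v$, and negative if $-v$ is positive. The mutation is $\mu_k(\mathbf v,B)=(\mathbf v',\mu_k(B))$ with $v_k'=-v_k$ and,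 for $i\ne k$: if $v_k$ is positive, $v_i'=v_i$ when $b_{ik}>0$ and $v_i'=v_i-(v_i,v_k)v_k$ when $b_{ik}<0$; if $v_k$ is negative, $v_i'=v_i$ when $b_{ik}<0$ and $v_i'=v_i-(v_i,v_k)v_k$ when $b_{ik}>0$ (if $b_{ik}=0$ then $v'_i=v_i$). The exchange graph has as vertices all seeds obtained from $(\mathbf v,B)$ by sequences of mutations; edges join seeds related by one mutation. **Compatibility.** For $i\ne j$, regard $(v_i,v_j)$ with the corresponding $2\times2$ submatrix as a rank $2$ seed (mutated by the same rules), ordered so that $b_{ij}\ge0$, and write $b_{ij}=2\cos(\pi p/q)$ with $p,q\ge1$ coprime, $2p\le q$. Let $\tau$ be the operation swapping the two indices and $\mu_2$ the mutation at the second vector. The reference point $u$ is compatible with this rank $2$ subseed if the period of $(\tau\circ\mu_2)^m$, $m\ge0$, on the ordered rank $2$ seed equals $q+2p$ (short period). The reference point is in a compatible position if it is compatible with all rank $2$ subseeds of every seed in the exchange graph.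
   Formalization: Item 4 fails for the pairs with 2/5 on right-angled acyclic domains with the realisation fixed; there it is proved for strictly acute domains only. For any acyclic domain, each admissible point has some compatible realisation of B from the same vectors. Acute means angles at most a right angle. *)

theory Defs
  imports "HOL-Analysis.Analysis"
begin

text \<open>
  Seeds are labelled by a finite index type: \<open>'n = 3\<close> for the seeds proper and \<open>'n = 2\<close> for
  their rank two subseeds, so that both are mutated by one and the same rule.  In either case the
  vectors lie in \<open>real^3\<close>.  Forgetting the labelling is done by \<open>seed_class\<close> below.
\<close>

type_synonym 'n seed = "('n \<Rightarrow> real^3) \<times> (real^'n^'n)"

definition mutate_matrix :: "'n \<Rightarrow> real^'n^'n \<Rightarrow> real^'n^'n" where
  "mutate_matrix k B = (\<chi> i j. if i = k \<or> j = k then - B$i$j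
     else B$i$j + (B$i$k * \<bar>B$k$j\<bar> + \<bar>B$i$k\<bar> * B$k$j) / 2)"

definition acyclic_matrix :: "real^'n^'n \<Rightarrow> bool" where
  "acyclic_matrix B \<longleftrightarrow> acyclic {(i, j). B$i$j > 0}"

definition hemisphere :: "real^3 \<Rightarrow> (real^3) set" where
  "hemisphere v = {w \<in> sphere 0 1. v \<bullet> w < 0}"

definition great_circle :: "real^3 \<Rightarrow> (real^3) set" where
  "great_circle v = {w \<in> sphere 0 1. v \<bullet> w = 0}"

definition seed_domain :: "('n::finite) seed \<Rightarrow> (real^3) set" where
  "seed_domain s = (\<Inter>i. hemisphere (fst s i))"

definition positive_vector :: "real^3 \<Rightarrow> real^3 \<Rightarrow> bool" where
  "positive_vector u v \<longleftrightarrow> u \<in> hemisphere v"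

definition negative_vector :: "real^3 \<Rightarrow> real^3 \<Rightarrow> bool" where
  "negative_vector u v \<longleftrightarrow> positive_vector u (- v)"

definition mutate_vectors :: "real^3 \<Rightarrow> 'n \<Rightarrow> ('n::finite) seed \<Rightarrow> 'n \<Rightarrow> real^3" where
  "mutate_vectors u k s =
     (let v = fst s; B = snd s in
      (\<lambda>i. if i = k then - v k
          else if (positive_vector u (v k) \<and> B$i$k < 0) \<or> (negative_vector u (v k) \<and> B$i$k > 0)
            then v i - (v i \<bullet> v k) *\<^sub>R v k
          else v i))"

definition mutate :: "real^3 \<Rightarrow> 'n \<Rightarrow> ('n::finite) seed \<Rightarrow> ('n::finite) seed" where
  "mutate u k s = (mutate_vectors u k s, mutate_matrix k (snd s))"

text \<open>For bijective \<open>f\<close> this permutes the indices; for injective \<open>f\<close> it extracts a subseed.\<close>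

definition reindex :: "(('m::finite) \<Rightarrow> 'n) \<Rightarrow> ('n::finite) seed \<Rightarrow> ('m::finite) seed" where
  "reindex f s = (fst s \<circ> f, \<chi> i j. snd s $ f i $ f j)"

definition seed_class :: "('n::finite) seed \<Rightarrow> ('n::finite) seed set" where
  "seed_class s = {reindex \<pi> s | \<pi>. bij \<pi>}"

inductive_set mutation_class :: "real^3 \<Rightarrow> ('n::finite) seed \<Rightarrow> ('n::finite) seed set"
  for u :: "real^3" and s :: "('n::finite) seed" where
  start: "s \<in> mutation_class u s"
| step: "t \<in> mutation_class u s \<Longrightarrow> mutate u k t \<in> mutation_class u s"

definition occurring_vectors :: "real^3 \<Rightarrow> ('n::finite) seed \<Rightarrow> (real^3) set" where
  "occurring_vectors u s = (\<Union>t \<in> mutation_class u s. range (fst t))"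

text \<open>Outside of this predicate \<open>mutate u\<close> is meaningless, as vectors may be neither positive
  nor negative.\<close>

definition reference_point :: "real^3 \<Rightarrow> ('n::finite) seed \<Rightarrow> bool" where
  "reference_point u s \<longleftrightarrow>
     u \<in> sphere 0 1 \<and> (\<forall>w \<in> occurring_vectors u s. u \<notin> great_circle w)"

text \<open>Undirected graphs: a set of vertices and a set of unordered pairs of vertices.\<close>

definition exchange_graph :: "real^3 \<Rightarrow> ('n::finite) seed \<Rightarrow> ('n::finite) seed set set \<times> ('n::finite) seed set set set" where
  "exchange_graph u s =
     (seed_class ` mutation_class u s,
      {{seed_class t, seed_class (mutate u k t)} | t k. t \<in> mutation_class u s})"

definition graph_isomorphic :: "'a set \<times> 'a set set \<Rightarrow> 'b set \<times> 'b set set \<Rightarrow> bool" where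
  "graph_isomorphic G H \<longleftrightarrow> (\<exists>f. bij_betw f (fst G) (fst H) \<and>
     (\<forall>x \<in> fst G. \<forall>y \<in> fst G. {x, y} \<in> snd G \<longleftrightarrow> {f x, f y} \<in> snd H))"

text \<open>The order on the type \<open>3\<close> is only used to list each pair of indices once (in this type
  \<open>3 = 0\<close>, so \<open>3 < 1 < 2\<close>).\<close>

definition geometric_realisation :: "(3 \<Rightarrow> real^3) \<Rightarrow> real^3^3 \<Rightarrow> bool" where
  "geometric_realisation v B \<longleftrightarrow>
     inj v \<and> independent (range v) \<and> span (range v) = UNIV \<and>
     (\<forall>i. v i \<bullet> v i = 2) \<and>
     (\<forall>i j. i \<noteq> j \<longrightarrow> \<bar>v i \<bullet> v j\<bar> = \<bar>B$i$j\<bar>) \<and>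
     ((\<forall>i j. i \<noteq> j \<longrightarrow> v i \<bullet> v j \<noteq> 0) \<longrightarrow>
        (even (card {(i, j). i < j \<and> v i \<bullet> v j > 0}) \<longleftrightarrow> acyclic_matrix B))"

definition tau_mu2 :: "real^3 \<Rightarrow> 2 seed \<Rightarrow> 2 seed" where
  "tau_mu2 u r = reindex (\<lambda>a. if a = 1 then 2 else 1) (mutate u 2 r)"

definition has_period :: "('a \<Rightarrow> 'a) \<Rightarrow> 'a \<Rightarrow> nat \<Rightarrow> bool" where
  "has_period f x n \<longleftrightarrow> n > 0 \<and> (f ^^ n) x = x \<and> (\<forall>m. 0 < m \<and> m < n \<longrightarrow> (f ^^ m) x \<noteq> x)"

definition compatible_rank2 :: "real^3 \<Rightarrow> 2 seed \<Rightarrow> bool" where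
  "compatible_rank2 u r \<longleftrightarrow>
     (\<exists>p q :: nat. p \<ge> 1 \<and> q \<ge> 1 \<and> coprime p q \<and> 2 * p \<le> q \<and>
        snd r $ 1 $ 2 = 2 * cos (pi * real p / real q) \<and>
        has_period (tau_mu2 u) r (q + 2 * p))"

definition compatible_position :: "real^3 \<Rightarrow> ('n::finite) seed \<Rightarrow> bool" where
  "compatible_position u s \<longleftrightarrow> reference_point u s \<and>
     (\<forall>t \<in> mutation_class u s. \<forall>i j. i \<noteq> j \<and> snd t $ i $ j \<ge> 0 \<longrightarrow>
        compatible_rank2 u (reindex (\<lambda>a. if a = 1 then i else j) t))"

text \<open>
  The vectors of a seed are outward normals of its domain, whose angle at the vertex on
  \<open>great_circle (v i)\<close> and \<open>great_circle (v j)\<close> is therefore \<open>pi\<close> minus the angle between \<open>v i\<close>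
  and \<open>v j\<close>.  Right angles have to be admitted in the first notion, since in some of the mutation
  classes considered every acyclic matrix has a zero entry off the diagonal.
\<close>

definition acute_angled :: "('n::finite) seed \<Rightarrow> bool" where
  "acute_angled s \<longleftrightarrow> (\<forall>i j. i \<noteq> j \<longrightarrow> fst s i \<bullet> fst s j \<le> 0)"

definition strictly_acute_angled :: "('n::finite) seed \<Rightarrow> bool" where
  "strictly_acute_angled s \<longleftrightarrow> (\<forall>i j. i \<noteq> j \<longrightarrow> fst s i \<bullet> fst s j < 0)"

end

theory Submission
  imports Defs
begin

text \<open>
  All vectors that occur lie in a finite set: the root system \<open>A3\<close>, \<open>B3\<close> or \<open>H3\<close>, scaled so that
  every root has square norm two. A realisation of the matrix consists of three roots
  (\<open>system_of_simple_path\<close>, \<open>system_of_third_two_fifths\<close>, \<open>system_of_fifth_two_fifths\<close>), and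
  mutation only negates roots or reflects them in roots. So everything the theorem speaks about
  depends on the reference point through the signs of its products with finitely many roots, and
  the whole question is finite.

  To make it a computation, the point \<open>u\<close> is first moved off all mirrors without changing its
  side with respect to the vectors that occur (\<open>generic_reference_point\<close>,
  \<open>same_side_compatible\<close>). The moved point lies in the chamber of some simple system
  (\<open>chamber_exists\<close>): minimise over the finitely many simple systems the product of \<open>u\<close> with the
  vector that has inner product one with every simple root; reflecting in a simple root with
  positive product would lower this value. Relative to that system a root is a sign and an
  index, it is positive for \<open>u\<close> exactly if its sign is, its coordinates are elements \<open>a + b * \<theta>\<close>
  of a quadratic ring (\<open>\<theta>\<close> the golden ratio, or the square root of two), and one table of
  reflections describes mutation for all reference points at once. This is the locale
  \<open>root_chamber\<close>.

  What remains is a statement about seeds written as three signed indices and three matrix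
  entries, and it is checked by evaluation (\<open>classification\<close>). From a few starting frames the
  mutation class is listed by breadth first search; it has 14, 20, 32, 48 and 40 seeds in the
  five cases. In each class all rank two subseeds have the short period, every root occurs, and
  some acyclic seed has pairwise nonpositive inner products and only positive vectors, so that
  its domain is acute and contains \<open>u\<close>. Every other frame with the prescribed matrix is refuted
  by a short, possibly empty, walk in its mutation class that meets a rank two subseed with the
  wrong period (\<open>refuted_not_compatible\<close>). Hence the compatible realisations are, up to the
  choice of simple system, exactly the frames that lie in the listed classes
  (\<open>compatible_normal_form\<close>), which gives the existence of realisations, the acute domain around
  \<open>u\<close>, and for every point off the mirrors of a compatible realisation a realisation with that
  reference point.

  For the isomorphism of exchange graphs two compatible frames are mutated side by side. The
  search runs over pairs of seeds from the outset, and \<open>component_isomorphic\<close> shows that the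
  pairing respects equality up to relabelling in both directions, as soon as no seed occurs in
  two different listed pairs.

  For the last assertion, an acute seed in the class of some realisation need not come with a
  known mutation sequence. Two invariants of mutation make the candidates finite in number: the
  absolute values of the Gram matrix and of the exchange matrix agree, with a sign rule for the
  product of the three inner products (\<open>balanced_class\<close>), and the determinant of the Gram matrix
  is constant. Every acyclic acute seed of positive roots satisfying both, in the last two cases
  every strictly acute one, is found in one of the listed classes, so its class is compatible.
\<close>

section \<open>Relabelling and mutation\<close>

lemma reindex_comp: "reindex f (reindex g s) = reindex (g \<circ> f) s"
  by (simp add: reindex_def fun_eq_iff vec_eq_iff)

lemma reindex_id: "reindex id s = s"
  by (simp add: reindex_def vec_eq_iff prod_eq_iff)

lemma mutate_reindex:
  assumes "inj f"
  shows "mutate u k (reindex f s) = reindex f (mutate u (f k) s)"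
proof -
  have f: "f i = f j \<longleftrightarrow> i = j" for i j using assms by (auto dest: injD)
  show ?thesis
    by (auto simp: mutate_def mutate_vectors_def mutate_matrix_def reindex_def Let_def fun_eq_iff vec_eq_iff f)
qed

text \<open>
  Two seeds have the same vertex in the exchange graph exactly if they are related in this way;
  the relation is easier to handle than equality of the sets \<open>seed_class\<close>.
\<close>

definition same_class :: "('n::finite) seed \<Rightarrow> 'n seed \<Rightarrow> bool" where
  "same_class s t \<longleftrightarrow> (\<exists>\<pi>. bij \<pi> \<and> t = reindex \<pi> s)"

lemma same_class_refl: "same_class s s"
  unfolding same_class_def using reindex_id[of s] by (metis bij_id)

lemma same_class_sym: assumes "same_class s t" shows "same_class t s"
proof -
  from assms obtain \<pi> where p: "bij \<pi>" "t = reindex \<pi> s" by (auto simp: same_class_def)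
  have "\<pi> \<circ> inv \<pi> = id" using p(1) by (simp add: bij_is_surj surj_iff[symmetric])
  then have "s = reindex (inv \<pi>) t"
    using reindex_id[of s] p(2) by (simp add: reindex_comp)
  then show ?thesis using p bij_imp_bij_inv same_class_def by blast
qed

lemma same_class_trans: assumes "same_class s t" "same_class t r" shows "same_class s r"
proof -
  from assms obtain \<pi> \<sigma> where "bij \<pi>" "t = reindex \<pi> s" "bij \<sigma>" "r = reindex \<sigma> t"
    by (auto simp: same_class_def)
  then have "bij (\<pi> \<circ> \<sigma>)" "r = reindex (\<pi> \<circ> \<sigma>) s" by (auto simp: reindex_comp intro: bij_comp)
  then show ?thesis unfolding same_class_def by blast
qed

lemma seed_class_eq_iff: "seed_class s = seed_class t \<longleftrightarrow> same_class s t"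
proof
  assume "seed_class s = seed_class t"
  moreover have "t \<in> seed_class t" using same_class_refl[of t] by (auto simp: seed_class_def same_class_def)
  ultimately show "same_class s t" by (auto simp: seed_class_def same_class_def)
next
  have *: "x \<in> seed_class s \<longleftrightarrow> same_class s x" for s x :: "'a seed" by (auto simp: seed_class_def same_class_def)
  assume st: "same_class s t"
  show "seed_class s = seed_class t"
  proof (rule set_eqI)
    fix x show "x \<in> seed_class s \<longleftrightarrow> x \<in> seed_class t"
      unfolding * using same_class_trans[OF st] same_class_trans[OF same_class_sym[OF st]] by blast
  qed
qed

section \<open>Mutation classes\<close>

lemma mutation_class_trans:
  assumes "t \<in> mutation_class u s" "r \<in> mutation_class u t"
  shows "r \<in> mutation_class u s"
  using assms(2) by induction (auto intro: assms(1) mutation_class.step)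

lemma mutate_matrix_involution: "mutate_matrix k (mutate_matrix k B) = B"
  by (auto simp: mutate_matrix_def vec_eq_iff field_simps)

text \<open>
  Mutating at \<open>k\<close> turns both the sign of the \<open>k\<close>-th vector and the signs of the \<open>k\<close>-th column of
  the matrix, so the second mutation reflects exactly the vectors that the first one did.
\<close>

lemma mutate_involution:
  assumes "\<And>i. fst s i \<bullet> fst s i = 2"
    and "snd s $ k $ k = 0"
    and "positive_vector u (fst s k) \<or> negative_vector u (fst s k)"
  shows "mutate u k (mutate u k s) = s"
proof -
  have ex: "\<not> (positive_vector u (fst s k) \<and> negative_vector u (fst s k))"
    by (auto simp: positive_vector_def negative_vector_def hemisphere_def)
  have "mutate_vectors u k (mutate u k s) i = fst s i" for i
    using assms ex
    by (auto simp: mutate_def mutate_vectors_def Let_def mutate_matrix_def negative_vector_def inner_diff_left algebra_simps)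
  then show ?thesis
    by (auto simp: mutate_def prod_eq_iff fun_eq_iff mutate_matrix_involution)
qed

text \<open>
  The part of the definition of a realisation that mutation preserves for trivial reasons.
\<close>

definition normalised :: "('n::finite) seed \<Rightarrow> bool" where
  "normalised s \<longleftrightarrow> (\<forall>i. fst s i \<bullet> fst s i = 2) \<and> (\<forall>i j. snd s $ i $ j + snd s $ j $ i = 0)"

lemma normalised_mutate: assumes "normalised s" shows "normalised (mutate u k s)"
proof -
  have B: "snd s $ j $ i = - snd s $ i $ j" for i j
    using assms by (simp add: normalised_def eq_neg_iff_add_eq_0)
  have v: "fst s i \<bullet> fst s i = 2" for i using assms by (simp add: normalised_def)
  have "mutate_vectors u k s i \<bullet> mutate_vectors u k s i = 2" for i
    by (auto simp: mutate_vectors_def Let_def inner_diff_left inner_diff_right v inner_commute)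
  moreover have "mutate_matrix k (snd s) $ i $ j + mutate_matrix k (snd s) $ j $ i = 0" for i j
  proof (cases "i = k \<or> j = k")
    case True then show ?thesis using B[of j i] by (auto simp: mutate_matrix_def)
  next
    case False
    then show ?thesis by (simp add: mutate_matrix_def B[of i j] B[of k j] B[of i k] field_simps)
  qed
  ultimately show ?thesis by (simp add: normalised_def mutate_def)
qed

lemma normalised_class: assumes "normalised s" "t \<in> mutation_class u s" shows "normalised t"
  using assms(2) by induction (auto intro: assms normalised_mutate)

lemma reference_sign:
  assumes "reference_point u s" "t \<in> mutation_class u s"
  shows "positive_vector u (fst t k) \<or> negative_vector u (fst t k)"
proof -
  have "u \<in> sphere 0 1" "fst t k \<bullet> u \<noteq> 0"
    using assms by (auto simp: reference_point_def occurring_vectors_def great_circle_def)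
  then show ?thesis by (auto simp: positive_vector_def negative_vector_def hemisphere_def)
qed

text \<open>
  Because single mutations are involutions, being reachable by mutations is symmetric. A
  property of a mutation class may therefore be proved from any of its seeds.
\<close>

lemma mutation_class_sym:
  assumes "reference_point u s" "normalised s" "t \<in> mutation_class u s"
  shows "s \<in> mutation_class u t"
  using assms(3)
proof induction
  case start show ?case by (rule mutation_class.start)
next
  case (step t k)
  have n: "normalised t" using normalised_class[OF assms(2) step.hyps] .
  have "snd t $ k $ k = 0" using n unfolding normalised_def by (metis double_zero)
  then have "mutate u k (mutate u k t) = t"
    using n reference_sign[OF assms(1) step.hyps] by (intro mutate_involution) (auto simp: normalised_def)
  then have "t \<in> mutation_class u (mutate u k t)"
    by (metis mutation_class.start mutation_class.step)
  then show ?case using step.IH mutation_class_trans by blast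
qed

lemma mutation_class_eq:
  assumes "reference_point u s" "normalised s" "t \<in> mutation_class u s"
  shows "mutation_class u t = mutation_class u s"
  using mutation_class_sym[OF assms] assms(3) mutation_class_trans by blast

lemma compatible_position_cong_class:
  assumes "mutation_class u t = mutation_class u s"
  shows "compatible_position u t \<longleftrightarrow> compatible_position u s"
    and "exchange_graph u t = exchange_graph u s"
    and "occurring_vectors u t = occurring_vectors u s"
    and "reference_point u t \<longleftrightarrow> reference_point u s"
  by (auto simp: compatible_position_def reference_point_def occurring_vectors_def exchange_graph_def assms)

lemma mutation_class_reindex:
  assumes "bij \<pi>"
  shows "mutation_class u (reindex \<pi> s) = reindex \<pi> ` mutation_class u s"
proof
  show "mutation_class u (reindex \<pi> s) \<subseteq> reindex \<pi> ` mutation_class u s"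
  proof
    fix t assume "t \<in> mutation_class u (reindex \<pi> s)"
    then show "t \<in> reindex \<pi> ` mutation_class u s"
      by induction (auto intro: mutation_class.intros simp: mutate_reindex bij_is_inj assms)
  qed
next
  have "reindex \<pi> t \<in> mutation_class u (reindex \<pi> s)" if "t \<in> mutation_class u s" for t
    using that
  proof induction
    case start show ?case by (rule mutation_class.start)
  next
    case (step t k)
    have "reindex \<pi> (mutate u k t) = mutate u (inv \<pi> k) (reindex \<pi> t)"
      using assms by (simp add: mutate_reindex bij_is_inj bij_is_surj surj_f_inv_f)
    then show ?case using step mutation_class.step by metis
  qed
  then show "reindex \<pi> ` mutation_class u s \<subseteq> mutation_class u (reindex \<pi> s)" by auto
qed

text \<open>
  Relabelling a seed only relabels its rank two subseeds.
\<close>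

lemma reindex_2_comp:
  "reindex (\<lambda>a::2. if a = 1 then i else j) (reindex \<pi> t) = reindex (\<lambda>a::2. if a = 1 then \<pi> i else \<pi> j) t"
  by (simp add: reindex_comp comp_def if_distrib)

lemma seed_class_reindex: "bij \<pi> \<Longrightarrow> seed_class (reindex \<pi> s) = seed_class s"
  by (metis same_class_def same_class_sym seed_class_eq_iff)

text \<open>
  The notions that concern a whole mutation class do not see the labelling, because relabelling
  commutes with mutation.
\<close>

lemma reindex_invariance:
  fixes s :: "('n::finite) seed"
  assumes "bij \<pi>"
  shows "compatible_position u (reindex \<pi> s) \<longleftrightarrow> compatible_position u s"
    and "occurring_vectors u (reindex \<pi> s) = occurring_vectors u s"
    and "exchange_graph u (reindex \<pi> s) = exchange_graph u s"
proof -
  have surj: "\<exists>i. \<pi> i = j" for j using assms by (metis bij_pointE)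
  have inj: "\<pi> i = \<pi> j \<longleftrightarrow> i = j" for i j using assms by (metis bij_pointE)
  show occ: "occurring_vectors u (reindex \<pi> s) = occurring_vectors u s"
  proof -
    have "range (fst (reindex \<pi> t)) = range (fst t)" for t :: "'n seed"
      using image_comp[of "fst t" \<pi> UNIV] bij_is_surj[OF assms] by (simp add: reindex_def)
    then show ?thesis by (simp add: occurring_vectors_def mutation_class_reindex[OF assms])
  qed
  have ex: "(\<forall>i j. i \<noteq> j \<and> snd (reindex \<pi> t) $ i $ j \<ge> 0 \<longrightarrow>
        compatible_rank2 u (reindex (\<lambda>a. if a = 1 then i else j) (reindex \<pi> t))) \<longleftrightarrow>
      (\<forall>i j. i \<noteq> j \<and> snd t $ i $ j \<ge> 0 \<longrightarrow>
        compatible_rank2 u (reindex (\<lambda>a. if a = 1 then i else j) t))" for t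
    unfolding reindex_2_comp using surj inj
    by (simp add: reindex_def) (metis surj inj)
  show "compatible_position u (reindex \<pi> s) \<longleftrightarrow> compatible_position u s"
    unfolding compatible_position_def reference_point_def occ
    by (simp add: mutation_class_reindex[OF assms] ex)
  have "{{seed_class t, seed_class (mutate u k t)} | t k. t \<in> reindex \<pi> ` mutation_class u s} =
    {{seed_class t, seed_class (mutate u k t)} | t k. t \<in> mutation_class u s}" (is "?A = ?B")
  proof
    show "?A \<subseteq> ?B"
    proof
      fix e assume "e \<in> ?A"
      then obtain t k where t: "t \<in> mutation_class u s"
        and e: "e = {seed_class (reindex \<pi> t), seed_class (mutate u k (reindex \<pi> t))}" by auto
      have "e = {seed_class t, seed_class (mutate u (\<pi> k) t)}"
        unfolding e by (simp add: seed_class_reindex[OF assms] mutate_reindex[OF bij_is_inj[OF assms]])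
      then show "e \<in> ?B" using t by blast
    qed
    show "?B \<subseteq> ?A"
    proof
      fix e assume "e \<in> ?B"
      then obtain t k where t: "t \<in> mutation_class u s"
        and e: "e = {seed_class t, seed_class (mutate u k t)}" by auto
      obtain k' where k': "\<pi> k' = k" using surj by blast
      have "e = {seed_class (reindex \<pi> t), seed_class (mutate u k' (reindex \<pi> t))}"
        unfolding e by (simp add: seed_class_reindex[OF assms] mutate_reindex[OF bij_is_inj[OF assms]] k')
      then show "e \<in> ?A" using t by blast
    qed
  qed
  then show "exchange_graph u (reindex \<pi> s) = exchange_graph u s"
    by (auto simp: exchange_graph_def mutation_class_reindex[OF assms] seed_class_reindex[OF assms] image_image)
qed

section \<open>Changing the reference point\<close>

text \<open>
  Mutation consults the reference point only through the signs of its inner products.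
\<close>

definition same_side :: "real^3 \<Rightarrow> real^3 \<Rightarrow> (real^3) set \<Rightarrow> bool" where
  "same_side u u' W \<longleftrightarrow> u \<in> sphere 0 1 \<and> u' \<in> sphere 0 1 \<and>
     (\<forall>w\<in>W. (w \<bullet> u < 0 \<longleftrightarrow> w \<bullet> u' < 0) \<and> (w \<bullet> u = 0 \<longleftrightarrow> w \<bullet> u' = 0))"

lemma same_side_sign:
  assumes "same_side u u' W" "w \<in> W"
  shows "positive_vector u' w \<longleftrightarrow> positive_vector u w"
    and "negative_vector u' w \<longleftrightarrow> negative_vector u w"
    and "u' \<in> hemisphere w \<longleftrightarrow> u \<in> hemisphere w"
    and "u' \<in> great_circle w \<longleftrightarrow> u \<in> great_circle w"
proof -
  have "w \<bullet> u < 0 \<longleftrightarrow> w \<bullet> u' < 0" "w \<bullet> u = 0 \<longleftrightarrow> w \<bullet> u' = 0" "norm u = 1" "norm u' = 1"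
    using assms by (auto simp: same_side_def)
  then show "positive_vector u' w \<longleftrightarrow> positive_vector u w"
    and "negative_vector u' w \<longleftrightarrow> negative_vector u w"
    and "u' \<in> hemisphere w \<longleftrightarrow> u \<in> hemisphere w"
    and "u' \<in> great_circle w \<longleftrightarrow> u \<in> great_circle w"
    unfolding positive_vector_def negative_vector_def hemisphere_def great_circle_def by auto
qed

lemma same_side_mutate:
  assumes "same_side u u' W" "fst s k \<in> W"
  shows "mutate u' k s = mutate u k s"
  using same_side_sign[OF assms] by (auto simp: mutate_def mutate_vectors_def Let_def fun_eq_iff)

lemma occurring_mem: "t \<in> mutation_class u s \<Longrightarrow> fst t k \<in> occurring_vectors u s"
  by (auto simp: occurring_vectors_def)

text \<open>
  By induction along the mutations: every vector whose sign is consulted occurs in the class,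
  where both points agree.
\<close>

lemma same_side_class:
  assumes "same_side u u' (occurring_vectors u s)"
  shows "mutation_class u' s = mutation_class u s"
proof
  show "mutation_class u' s \<subseteq> mutation_class u s"
  proof
    fix t assume "t \<in> mutation_class u' s"
    then show "t \<in> mutation_class u s"
      by induction (auto intro: mutation_class.intros simp: same_side_mutate[OF assms occurring_mem])
  qed
  show "mutation_class u s \<subseteq> mutation_class u' s"
  proof
    fix t assume "t \<in> mutation_class u s"
    then show "t \<in> mutation_class u' s"
    proof induction
      case (step t k)
      then show ?case using same_side_mutate[OF assms occurring_mem[OF step.hyps], of k]
        by (metis mutation_class.step)
    qed (rule mutation_class.start)
  qed
qed

lemma has_period_cong:
  assumes "x \<in> X" "\<And>y. y \<in> X \<Longrightarrow> f y \<in> X \<and> g y = f y"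
  shows "has_period g x n \<longleftrightarrow> has_period f x n"
proof -
  have "(f ^^ m) x \<in> X \<and> (g ^^ m) x = (f ^^ m) x" for m
    by (induction m) (use assms in auto)
  then show ?thesis by (simp add: has_period_def)
qed

text \<open>
  The vectors that the rank two mutations meet are again vectors of seeds in the mutation class,
  because restricting to two indices commutes with mutation at one of them.
\<close>

lemma same_side_rank2:
  fixes f :: "2 \<Rightarrow> ('n::finite)"
  assumes "same_side u u' (occurring_vectors u s)" "t \<in> mutation_class u s" "inj f"
  shows "compatible_rank2 u' (reindex f t) \<longleftrightarrow> compatible_rank2 u (reindex f t)"
proof -
  \<comment> \<open>all rank two subseeds, a set that contains the orbit\<close>
  define X where "X = {reindex g r | (g :: 2 \<Rightarrow> 'n) r. inj g \<and> r \<in> mutation_class u s}"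
  define \<tau> :: "2 \<Rightarrow> 2" where "\<tau> = (\<lambda>a. if a = 1 then 2 else 1)"
  have \<tau>: "inj \<tau>" by (auto simp: \<tau>_def inj_def) (metis exhaust_2)+
  have X: "tau_mu2 u y \<in> X \<and> tau_mu2 u' y = tau_mu2 u y" if y: "y \<in> X" for y
  proof -
    obtain g r where gr: "inj (g :: 2 \<Rightarrow> 'n)" "r \<in> mutation_class u s" "y = reindex g r"
      using y by (auto simp: X_def)
    have "tau_mu2 u y = reindex (g \<circ> \<tau>) (mutate u (g 2) r)"
      using gr by (simp add: tau_mu2_def mutate_reindex reindex_comp \<tau>_def)
    moreover have "mutate u' (g 2) r = mutate u (g 2) r"
      using same_side_mutate[OF assms(1) occurring_mem[OF gr(2)]] .
    moreover have "tau_mu2 u' y = reindex (g \<circ> \<tau>) (mutate u' (g 2) r)"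
      using gr by (simp add: tau_mu2_def mutate_reindex reindex_comp \<tau>_def)
    moreover have "inj (g \<circ> \<tau>)" "mutate u (g 2) r \<in> mutation_class u s"
      using gr inj_compose[OF gr(1) \<tau>] by (auto intro: mutation_class.step)
    ultimately show ?thesis unfolding X_def by (metis (mono_tags, lifting) mem_Collect_eq)
  qed
  have "reindex f t \<in> X" using assms(2,3) unfolding X_def by blast
  from has_period_cong[OF this X] show ?thesis by (simp add: compatible_rank2_def)
qed

lemma inj_pair: "i \<noteq> j \<Longrightarrow> inj (\<lambda>a::2. if a = 1 then i else j)"
  by (auto simp: inj_def) (metis exhaust_2)+

lemma same_side_compatible:
  assumes "same_side u u' (occurring_vectors u s)"
  shows "compatible_position u' s \<longleftrightarrow> compatible_position u s"
    and "exchange_graph u' s = exchange_graph u s"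
    and "occurring_vectors u' s = occurring_vectors u s"
    and "reference_point u' s \<longleftrightarrow> reference_point u s"
    and "t \<in> mutation_class u s \<Longrightarrow> u' \<in> seed_domain t \<longleftrightarrow> u \<in> seed_domain t"
proof -
  note mc = same_side_class[OF assms]
  show occ: "occurring_vectors u' s = occurring_vectors u s" by (simp add: occurring_vectors_def mc)
  show ref: "reference_point u' s \<longleftrightarrow> reference_point u s"
    using assms same_side_sign(4)[OF assms] by (auto simp: reference_point_def occ same_side_def)
  show "compatible_position u' s \<longleftrightarrow> compatible_position u s"
    unfolding compatible_position_def ref mc
    using same_side_rank2[OF assms _ inj_pair] by blast
  have "mutate u' k t = mutate u k t" if "t \<in> mutation_class u s" for t k
    using same_side_mutate[OF assms occurring_mem[OF that]] .
  then show "exchange_graph u' s = exchange_graph u s"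
    unfolding exchange_graph_def mc by (intro arg_cong2[of _ _ _ _ Pair] refl Collect_cong) metis
  show "u' \<in> seed_domain t \<longleftrightarrow> u \<in> seed_domain t" if "t \<in> mutation_class u s"
    using same_side_sign(3)[OF assms occurring_mem[OF that]] by (auto simp: seed_domain_def)
qed

section \<open>Isomorphic exchange graphs\<close>

lemma graph_isomorphic_sym:
  assumes "graph_isomorphic G H" shows "graph_isomorphic H G"
proof -
  obtain f where f: "bij_betw f (fst G) (fst H)"
    "\<And>x y. x \<in> fst G \<Longrightarrow> y \<in> fst G \<Longrightarrow> {x, y} \<in> snd G \<longleftrightarrow> {f x, f y} \<in> snd H"
    using assms by (auto simp: graph_isomorphic_def)
  let ?g = "the_inv_into (fst G) f"
  have "bij_betw ?g (fst H) (fst G)" using f(1) bij_betw_the_inv_into by blast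
  moreover have "{x, y} \<in> snd H \<longleftrightarrow> {?g x, ?g y} \<in> snd G" if "x \<in> fst H" "y \<in> fst H" for x y
  proof -
    have "?g x \<in> fst G" "?g y \<in> fst G" "f (?g x) = x" "f (?g y) = y"
      using that f(1) by (auto simp: bij_betw_def f_the_inv_into_f the_inv_into_into)
    then show ?thesis using f(2)[of "?g x" "?g y"] by simp
  qed
  ultimately show ?thesis unfolding graph_isomorphic_def by blast
qed

lemma graph_isomorphic_trans:
  assumes "graph_isomorphic G H" "graph_isomorphic H K" shows "graph_isomorphic G K"
proof -
  obtain f g where f: "bij_betw f (fst G) (fst H)"
    "\<And>x y. x \<in> fst G \<Longrightarrow> y \<in> fst G \<Longrightarrow> {x, y} \<in> snd G \<longleftrightarrow> {f x, f y} \<in> snd H"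
    and g: "bij_betw g (fst H) (fst K)"
    "\<And>x y. x \<in> fst H \<Longrightarrow> y \<in> fst H \<Longrightarrow> {x, y} \<in> snd H \<longleftrightarrow> {g x, g y} \<in> snd K"
    using assms unfolding graph_isomorphic_def by blast
  have "f x \<in> fst H" if "x \<in> fst G" for x using that f(1) by (auto simp: bij_betw_def)
  then have "\<forall>x\<in>fst G. \<forall>y\<in>fst G. {x, y} \<in> snd G \<longleftrightarrow> {(g \<circ> f) x, (g \<circ> f) y} \<in> snd K"
    using f(2) g(2) by simp
  then show ?thesis using bij_betw_trans[OF f(1) g(1)] unfolding graph_isomorphic_def by blast
qed

text \<open>
  Mutating two seeds in parallel yields the correspondence between their classes from which an
  isomorphism of exchange graphs is built.
\<close>

inductive_set paired_class :: "real^3 \<Rightarrow> real^3 \<Rightarrow> ('n::finite) seed \<Rightarrow> 'n seed \<Rightarrow> ('n seed \<times> 'n seed) set"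
  for u u' :: "real^3" and s s' :: "('n::finite) seed" where
  start: "(s, s') \<in> paired_class u u' s s'"
| step: "(t, t') \<in> paired_class u u' s s' \<Longrightarrow> (mutate u k t, mutate u' k t') \<in> paired_class u u' s s'"

lemma paired_class_fst: "mutation_class u s = fst ` paired_class u u' s s'"
proof
  show "mutation_class u s \<subseteq> fst ` paired_class u u' s s'"
  proof
    fix t assume "t \<in> mutation_class u s"
    then show "t \<in> fst ` paired_class u u' s s'"
    proof induction
      case start show ?case using paired_class.start[of s s' u u'] by force
    next
      case (step t k)
      then show ?case using paired_class.step[of _ _ u u' s s' k] by force
    qed
  qed
  have "t \<in> mutation_class u s" if "(t, t') \<in> paired_class u u' s s'" for t t'
    using that by induction (auto intro: mutation_class.intros)
  then show "fst ` paired_class u u' s s' \<subseteq> mutation_class u s" by auto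
qed

lemma paired_class_snd: "mutation_class u' s' = snd ` paired_class u u' s s'"
proof
  show "mutation_class u' s' \<subseteq> snd ` paired_class u u' s s'"
  proof
    fix t assume "t \<in> mutation_class u' s'"
    then show "t \<in> snd ` paired_class u u' s s'"
    proof induction
      case start show ?case using paired_class.start[of s s' u u'] by force
    next
      case (step t k)
      then show ?case using paired_class.step[of _ _ u u' s s' k] by force
    qed
  qed
  have "t' \<in> mutation_class u' s'" if "(t, t') \<in> paired_class u u' s s'" for t t'
    using that by induction (auto intro: mutation_class.intros)
  then show "snd ` paired_class u u' s s' \<subseteq> mutation_class u' s'" by auto
qed

text \<open>
  The map sending the class of \<open>t\<close> to the class of its partner \<open>t'\<close> is well defined and
  injective by the assumption, and it carries edges to edges in both directions because partners
  are mutated at the same index.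
\<close>

lemma paired_class_isomorphic:
  assumes eq: "\<And>t t' r r'. (t, t') \<in> paired_class u u' s s' \<Longrightarrow> (r, r') \<in> paired_class u u' s s' \<Longrightarrow>
    same_class t r \<longleftrightarrow> same_class t' r'"
  shows "graph_isomorphic (exchange_graph u s) (exchange_graph u' s')"
proof -
  let ?P = "paired_class u u' s s'"
  define f where "f x = (SOME y. \<exists>t t'. (t, t') \<in> ?P \<and> x = seed_class t \<and> y = seed_class t')" for x
  have f: "f (seed_class t) = seed_class t'" if "(t, t') \<in> ?P" for t t'
  proof -
    have "\<exists>y. \<exists>r r'. (r, r') \<in> ?P \<and> seed_class t = seed_class r \<and> y = seed_class r'" using that by blast
    from someI_ex[OF this] obtain r r' where "(r, r') \<in> ?P" "seed_class t = seed_class r" "f (seed_class t) = seed_class r'"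
      unfolding f_def by blast
    then show ?thesis using eq[OF that, of r r'] by (simp add: seed_class_eq_iff same_class_sym)
  qed
  have V: "fst (exchange_graph u s) = (\<lambda>p. seed_class (fst p)) ` ?P"
    "fst (exchange_graph u' s') = (\<lambda>p. seed_class (snd p)) ` ?P"
    by (simp_all add: exchange_graph_def paired_class_fst[of u s u' s'] paired_class_snd[of u' s' u s] image_image)
  have E: "e \<in> snd (exchange_graph u s) \<longleftrightarrow> (\<exists>t t' k. (t, t') \<in> ?P \<and> e = {seed_class t, seed_class (mutate u k t)})" for e
  proof -
    have "e \<in> snd (exchange_graph u s) \<longleftrightarrow> (\<exists>p\<in>?P. \<exists>k. e = {seed_class (fst p), seed_class (mutate u k (fst p))})"
      unfolding exchange_graph_def snd_conv paired_class_fst[of u s u' s'] mem_Collect_eq by blast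
    then show ?thesis by (metis (no_types, lifting) fst_conv prod.collapse)
  qed
  have E': "e \<in> snd (exchange_graph u' s') \<longleftrightarrow> (\<exists>t t' k. (t, t') \<in> ?P \<and> e = {seed_class t', seed_class (mutate u' k t')})" for e
  proof -
    have "e \<in> snd (exchange_graph u' s') \<longleftrightarrow> (\<exists>p\<in>?P. \<exists>k. e = {seed_class (snd p), seed_class (mutate u' k (snd p))})"
      unfolding exchange_graph_def snd_conv paired_class_snd[of u' s' u s] mem_Collect_eq by blast
    then show ?thesis by (metis (no_types, lifting) snd_conv prod.collapse)
  qed
  have inj: "x = y" if xy: "x \<in> fst (exchange_graph u s)" "y \<in> fst (exchange_graph u s)" "f x = f y" for x y
  proof -
    obtain t t' r r' where t: "(t, t') \<in> ?P" "x = seed_class t" and r: "(r, r') \<in> ?P" "y = seed_class r"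
      using xy(1,2) unfolding V by auto
    then have "seed_class t' = seed_class r'" using xy(3) f[OF t(1)] f[OF r(1)] t(2) r(2) by simp
    then show ?thesis using eq[OF t(1) r(1)] t(2) r(2) by (simp add: seed_class_eq_iff)
  qed
  have "bij_betw f (fst (exchange_graph u s)) (fst (exchange_graph u' s'))"
  proof (rule bij_betwI')
    show "(f x = f y) = (x = y)" if "x \<in> fst (exchange_graph u s)" "y \<in> fst (exchange_graph u s)" for x y
      using inj that by blast
    show "f x \<in> fst (exchange_graph u' s')" if "x \<in> fst (exchange_graph u s)" for x
    proof -
      obtain t t' where "(t, t') \<in> ?P" "x = seed_class t" using \<open>x \<in> _\<close> unfolding V by auto
      then show ?thesis using f[of t t'] unfolding V by (metis image_eqI snd_conv)
    qed
    show "\<exists>x\<in>fst (exchange_graph u s). y = f x" if "y \<in> fst (exchange_graph u' s')" for y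
    proof -
      obtain t t' where "(t, t') \<in> ?P" "y = seed_class t'" using \<open>y \<in> _\<close> unfolding V by auto
      then show ?thesis using f[of t t'] unfolding V by (metis image_eqI fst_conv)
    qed
  qed
  moreover have "{x, y} \<in> snd (exchange_graph u s) \<longleftrightarrow> {f x, f y} \<in> snd (exchange_graph u' s')"
    if xy: "x \<in> fst (exchange_graph u s)" "y \<in> fst (exchange_graph u s)" for x y
  proof
    assume "{x, y} \<in> snd (exchange_graph u s)"
    then obtain t t' k where t: "(t, t') \<in> ?P" "{x, y} = {seed_class t, seed_class (mutate u k t)}"
      unfolding E by blast
    have "{f x, f y} = f ` {x, y}" by simp
    also have "\<dots> = {seed_class t', seed_class (mutate u' k t')}"
      unfolding t(2) using f[OF t(1)] f[OF paired_class.step[OF t(1)]] by simp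
    finally show "{f x, f y} \<in> snd (exchange_graph u' s')" unfolding E' using t(1) by blast
  next
    assume "{f x, f y} \<in> snd (exchange_graph u' s')"
    then obtain t t' k where t: "(t, t') \<in> ?P" "{f x, f y} = {seed_class t', seed_class (mutate u' k t')}"
      unfolding E' by blast
    let ?z = "seed_class t" and ?w = "seed_class (mutate u k t)"
    have z: "?z \<in> fst (exchange_graph u s)" "?w \<in> fst (exchange_graph u s)"
      unfolding V using t(1) paired_class.step[OF t(1), of k] by (metis image_eqI fst_conv)+
    have "{f x, f y} = {f ?z, f ?w}"
      unfolding t(2) using f[OF t(1)] f[OF paired_class.step[OF t(1)]] by simp
    then have "{x, y} = {?z, ?w}" using inj xy z by (metis doubleton_eq_iff)
    then show "{x, y} \<in> snd (exchange_graph u s)" unfolding E using t(1) by blast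
  qed
  ultimately show ?thesis unfolding graph_isomorphic_def by blast
qed

section \<open>Quadratic integers\<close>

type_synonym zq = "int \<times> int"

text \<open>
  The pair \<open>(a, b)\<close> stands for the number \<open>a + b * \<theta>\<close>. Working with integer pairs keeps all
  comparisons decidable by integer arithmetic.
\<close>

definition zval :: "real \<Rightarrow> zq \<Rightarrow> real" where
  "zval \<theta> x = real_of_int (fst x) + real_of_int (snd x) * \<theta>"

fun zadd :: "zq \<Rightarrow> zq \<Rightarrow> zq" where
  "zadd (a, b) (c, d) = (a + c, b + d)"

fun zneg :: "zq \<Rightarrow> zq" where
  "zneg (a, b) = (- a, - b)"

text \<open>
  The pair \<open>(p, q)\<close> records the equation \<open>\<theta>\<^sup>2 = p * \<theta> + q\<close>.
\<close>

fun zmul :: "int \<times> int \<Rightarrow> zq \<Rightarrow> zq \<Rightarrow> zq" where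
  "zmul (p, q) (a, b) (c, d) = (a * c + q * (b * d), a * d + b * c + p * (b * d))"

text \<open>
  Whether \<open>a + b * \<theta>\<close> is positive. With \<open>m = 2 * a + p * b\<close> and \<open>\<delta> = 2 * \<theta> - p\<close>, the square root
  of the discriminant, twice the number is \<open>m + b * \<delta>\<close>; if the two summands have different signs
  their squares decide.
\<close>

fun zpos :: "int \<times> int \<Rightarrow> zq \<Rightarrow> bool" where
  "zpos (p, q) (a, b) =
     (if b = 0 then 0 < a
      else if 0 < b then 0 \<le> 2 * a + p * b \<or> (2 * a + p * b)\<^sup>2 < (p\<^sup>2 + 4 * q) * b\<^sup>2
      else 0 < 2 * a + p * b \<and> (p\<^sup>2 + 4 * q) * b\<^sup>2 < (2 * a + p * b)\<^sup>2)"

text \<open>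
  The number \<open>\<theta>\<close> is the larger root of its equation, so the square root of the discriminant is
  \<open>2 * \<theta> - p\<close> and not its negative.
\<close>

definition quadratic_irrational :: "int \<times> int \<Rightarrow> real \<Rightarrow> bool" where
  "quadratic_irrational D \<theta> \<longleftrightarrow> \<theta>\<^sup>2 = of_int (fst D) * \<theta> + of_int (snd D) \<and> of_int (fst D) < 2 * \<theta> \<and> \<theta> \<notin> \<rat>"

lemma zval_simps [simp]:
  "zval \<theta> (0, 0) = 0" "zval \<theta> (1, 0) = 1" "zval \<theta> (a, 0) = of_int a" "zval \<theta> (0, 1) = \<theta>"
  by (simp_all add: zval_def)

lemma zval_zadd [simp]: "zval \<theta> (zadd x y) = zval \<theta> x + zval \<theta> y"
  by (cases x; cases y) (simp add: zval_def algebra_simps)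

lemma zval_zneg [simp]: "zval \<theta> (zneg x) = - zval \<theta> x"
  by (cases x) (simp add: zval_def)

lemma zneg_zneg [simp]: "zneg (zneg x) = x"
  by (cases x) simp

lemma zneg_zero [simp]: "zneg (0, 0) = (0, 0)"
  by simp

lemma zval_zmul:
  assumes "quadratic_irrational D \<theta>"
  shows "zval \<theta> (zmul D x y) = zval \<theta> x * zval \<theta> y"
proof -
  obtain p q a b c d where [simp]: "D = (p, q)" "x = (a, b)" "y = (c, d)" by (metis surj_pair)
  have "\<theta> * \<theta> = of_int p * \<theta> + of_int q" using assms by (simp add: quadratic_irrational_def power2_eq_square)
  moreover have "zval \<theta> x * zval \<theta> y = of_int (a * c) + of_int (a * d + b * c) * \<theta> + of_int (b * d) * (\<theta> * \<theta>)"
    by (simp add: zval_def algebra_simps)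
  ultimately show ?thesis by (simp add: zval_def algebra_simps)
qed

lemma zval_eq_iff:
  assumes "quadratic_irrational D \<theta>"
  shows "zval \<theta> x = zval \<theta> y \<longleftrightarrow> x = y"
proof
  assume eq: "zval \<theta> x = zval \<theta> y"
  obtain a b c d where [simp]: "x = (a, b)" "y = (c, d)" by (metis surj_pair)
  have *: "of_int (b - d) * \<theta> = of_int (c - a)" using eq by (simp add: zval_def algebra_simps)
  have "b = d"
  proof (rule ccontr)
    assume "b \<noteq> d"
    then have "\<theta> = of_int (c - a) / of_int (b - d)" using * by (simp add: field_simps)
    then have "\<theta> \<in> \<rat>" by simp
    then show False using assms by (simp add: quadratic_irrational_def)
  qed
  then show "x = y" using * by simp
qed simp

lemma square_less_iff: "0 \<le> x \<Longrightarrow> 0 \<le> y \<Longrightarrow> x\<^sup>2 < y\<^sup>2 \<longleftrightarrow> x < y" for x y :: real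
  by (metis not_le power_mono_iff zero_less_numeral)

lemma zpos_iff:
  assumes "quadratic_irrational D \<theta>"
  shows "zpos D x \<longleftrightarrow> 0 < zval \<theta> x"
proof -
  obtain p q a b where [simp]: "D = (p, q)" "x = (a, b)" by (metis surj_pair)
  define m \<delta> where "m = 2 * a + p * b" and "\<delta> = 2 * \<theta> - of_int p"
  have \<delta>: "0 < \<delta>" "\<delta>\<^sup>2 = of_int (p\<^sup>2 + 4 * q)"
    using assms by (auto simp: quadratic_irrational_def \<delta>_def power2_eq_square algebra_simps)
  have val: "2 * zval \<theta> x = of_int m + of_int b * \<delta>"
    by (simp add: zval_def m_def \<delta>_def algebra_simps)
  have sq: "(p\<^sup>2 + 4 * q) * b\<^sup>2 < m\<^sup>2 \<longleftrightarrow> (of_int b * \<delta>)\<^sup>2 < (of_int m)\<^sup>2"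
    "m\<^sup>2 < (p\<^sup>2 + 4 * q) * b\<^sup>2 \<longleftrightarrow> (of_int m)\<^sup>2 < (of_int b * \<delta>)\<^sup>2"
    unfolding power_mult_distrib \<delta>(2) by (simp_all only: mult.commute flip: of_int_power of_int_mult of_int_less_iff)
  consider "b = 0" | "0 < b" "0 \<le> m" | "0 < b" "m < 0" | "b < 0" "0 < m" | "b < 0" "m \<le> 0" by linarith
  then show ?thesis
  proof cases
    case 1 then show ?thesis by (simp add: zval_def)
  next
    case 2
    then have "0 < of_int b * \<delta>" "0 \<le> real_of_int m" using \<delta> by auto
    then have "0 < zval \<theta> x" using val by linarith
    then show ?thesis using 2 by (simp add: m_def)
  next
    case 3
    have "(of_int m)\<^sup>2 < (of_int b * \<delta>)\<^sup>2 \<longleftrightarrow> - of_int m < of_int b * \<delta>"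
      using 3 \<delta>(1) square_less_iff[of "- of_int m" "of_int b * \<delta>"] by simp
    moreover have "- of_int m < of_int b * \<delta> \<longleftrightarrow> 0 < zval \<theta> x" using val by linarith
    ultimately show ?thesis using 3 sq by (simp add: m_def)
  next
    case 4
    have "(of_int b * \<delta>)\<^sup>2 < (of_int m)\<^sup>2 \<longleftrightarrow> - (of_int b * \<delta>) < of_int m"
      using 4 \<delta>(1) square_less_iff[of "- (of_int b * \<delta>)" "of_int m"] by (simp add: mult_nonpos_nonneg)
    moreover have "- (of_int b * \<delta>) < of_int m \<longleftrightarrow> 0 < zval \<theta> x" using val by linarith
    ultimately show ?thesis using 4 sq by (simp add: m_def)
  next
    case 5
    then have "of_int b * \<delta> < 0" "real_of_int m \<le> 0" using \<delta> by (auto simp: mult_neg_pos)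
    then show ?thesis using 5 val by (simp add: m_def)
  qed
qed

section \<open>Seeds written with a table of reflections\<close>

text \<open>
  A sign, where \<open>True\<close> is plus, and the index of a positive root.
\<close>

type_synonym root = "bool \<times> nat"

text \<open>
  Everything the computations need to know about a root system: the quadratic ring of its
  coordinates, the inner products and the reflections of the positive roots, and the period that
  a compatible rank two seed of a given weight must have.
\<close>

record root_data =
  ring :: "int \<times> int"
  grams :: "zq list list"
  refls :: "root list list"
  periods :: "(zq \<times> nat) list"

text \<open>
  A conditional that is an ordinary function, so that simplification evaluates both branches.
  The built-in conditional leaves its branches untouched until the test is decided and then
  simplifies the chosen one from scratch, which is costly if a large table is nested inside it.
  For the same reason conjunctions and disjunctions are replaced by \<open>every\<close> and \<open>any\<close>.
\<close>

fun pick :: "bool \<Rightarrow> 'a \<Rightarrow> 'a \<Rightarrow> 'a" where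
  "pick True x y = x"
| "pick False x y = y"

lemma pick_if: "pick b x y = (if b then x else y)"
  by (cases b) auto

fun every :: "bool list \<Rightarrow> bool" where
  "every [] = True"
| "every (b # bs) = pick b (every bs) False"

fun any :: "bool list \<Rightarrow> bool" where
  "any [] = False"
| "any (b # bs) = pick b True (any bs)"

lemma every_Cons [simp]: "every (b # bs) \<longleftrightarrow> b \<and> every bs"
  and any_Cons [simp]: "any (b # bs) \<longleftrightarrow> b \<or> any bs"
  by (simp_all add: pick_if)

declare every.simps(2) [simp del] any.simps(2) [simp del]

lemma every_map [simp]: "every (map f xs) \<longleftrightarrow> list_all f xs"
  and any_map [simp]: "any (map f xs) \<longleftrightarrow> list_ex f xs"
  by (induction xs) simp_all

fun flip :: "root \<Rightarrow> root" where
  "flip (s, i) = (\<not> s, i)"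

fun signed :: "bool \<Rightarrow> root \<Rightarrow> root" where
  "signed s (e, k) = (s = e, k)"

text \<open>
  Reflection of the first root in the second one. The sign of the mirror is immaterial.
\<close>

fun root_refl :: "root_data \<Rightarrow> root \<Rightarrow> root \<Rightarrow> root" where
  "root_refl R (s, i) (t, j) = signed s (refls R ! i ! j)"

fun root_gram :: "root_data \<Rightarrow> root \<Rightarrow> root \<Rightarrow> zq" where
  "root_gram R (s, i) (t, j) = pick (s = t) (grams R ! i ! j) (zneg (grams R ! i ! j))"

text \<open>
  Three roots and the three entries \<open>b12\<close>, \<open>b13\<close>, \<open>b23\<close> of the matrix.
\<close>

type_synonym mseed = "root \<times> root \<times> root \<times> zq \<times> zq \<times> zq"

definition root_at :: "mseed \<Rightarrow> 3 \<Rightarrow> root" where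
  "root_at m i = (case m of (a, b, c, x, y, z) \<Rightarrow> if i = 1 then a else if i = 2 then b else c)"

definition entry_at :: "mseed \<Rightarrow> 3 \<Rightarrow> 3 \<Rightarrow> zq" where
  "entry_at m i j = (case m of (a, b, c, x, y, z) \<Rightarrow>
     if i = 1 then if j = 1 then (0, 0) else if j = 2 then x else y
     else if i = 2 then if j = 1 then zneg x else if j = 2 then (0, 0) else z
     else if j = 1 then zneg y else if j = 2 then zneg z else (0, 0))"

text \<open>
  The root \<open>d\<close> mutated at \<open>c\<close>, where \<open>x\<close> is the matrix entry from \<open>c\<close> to \<open>d\<close>. Reflection takes
  place if \<open>c\<close> is positive and \<open>x > 0\<close>, or \<open>c\<close> is negative and \<open>x < 0\<close>; the rule for mutation
  looks at the transposed entry and hence has the opposite signs.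
\<close>

definition mutate_root :: "root_data \<Rightarrow> root \<Rightarrow> zq \<Rightarrow> root \<Rightarrow> root" where
  "mutate_root R c x d = pick (zpos (ring R) (pick (fst c) x (zneg x))) (root_refl R d c) d"

definition mutate_entry :: "int \<times> int \<Rightarrow> zq \<Rightarrow> zq \<Rightarrow> zq \<Rightarrow> zq" where
  "mutate_entry D x y z =
     (if zpos D x \<and> zpos D (zneg y) then zadd z (zmul D x y)
      else if zpos D (zneg x) \<and> zpos D y then zadd z (zneg (zmul D x y))
      else z)"

text \<open>
  Mutation at the first index. The other two mutations are obtained by rotating the indices.
\<close>

fun mutate_first :: "root_data \<Rightarrow> mseed \<Rightarrow> mseed" where
  "mutate_first R (a, b, c, x, y, z) =
     (flip a, mutate_root R a x b, mutate_root R a y c, zneg x, zneg y, mutate_entry (ring R) x y z)"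

fun rot :: "mseed \<Rightarrow> mseed" where
  "rot (a, b, c, x, y, z) = (b, c, a, z, zneg x, zneg y)"

fun swap :: "mseed \<Rightarrow> mseed" where
  "swap (a, b, c, x, y, z) = (b, a, c, zneg x, z, y)"

fun root_less :: "root \<Rightarrow> root \<Rightarrow> bool" where
  "root_less (s, i) (t, j) \<longleftrightarrow> i < j \<or> i = j \<and> s \<and> \<not> t"

fun unordered :: "mseed \<Rightarrow> bool" where
  "unordered (a, b, c, x, y, z) = root_less b a"

fun ordered :: "mseed \<Rightarrow> bool" where
  "ordered (a, b, c, x, y, z) \<longleftrightarrow> root_less a b \<and> root_less b c"

type_synonym seed_pair = "mseed \<times> mseed"

definition rotp :: "seed_pair \<Rightarrow> seed_pair" where
  "rotp = map_prod rot rot"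

definition arrange :: "seed_pair \<Rightarrow> seed_pair" where
  "arrange p = pick (unordered (fst p)) (map_prod swap swap p) p"

text \<open>
  Sorts the roots of the first seed by compare and exchange of neighbours, and carries the
  second seed along under the same permutation. The net effect of the three rotations is the
  identity.
\<close>

definition sortp :: "seed_pair \<Rightarrow> seed_pair" where
  "sortp p = arrange (rotp (rotp (arrange (rotp (arrange p)))))"

definition sort1 :: "mseed \<Rightarrow> mseed" where
  "sort1 m = fst (sortp (m, m))"

definition mutp :: "root_data \<Rightarrow> seed_pair \<Rightarrow> seed_pair" where
  "mutp R p = sortp (map_prod (mutate_first R) (mutate_first R) p)"

definition nbrs :: "root_data \<Rightarrow> seed_pair \<Rightarrow> seed_pair list" where
  "nbrs R p = [mutp R p, mutp R (rotp p), mutp R (rotp (rotp p))]"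

fun same_seed :: "mseed \<Rightarrow> mseed \<Rightarrow> bool" where
  "same_seed (a, b, c, x, y, z) (a', b', c', x', y', z') =
     (if a = a' then if b = b' then if c = c' then x = x' \<and> y = y' \<and> z = z' else False else False else False)"

fun same_pair :: "seed_pair \<Rightarrow> seed_pair \<Rightarrow> bool" where
  "same_pair (m, n) (m', n') = (if same_seed m m' then same_seed n n' else False)"

text \<open>
  Membership test. The Boolean argument says whether the preceding comparison succeeded;
  matching on it stops the search without a conditional.
\<close>

fun found :: "('a \<Rightarrow> 'a \<Rightarrow> bool) \<Rightarrow> bool \<Rightarrow> 'a list \<Rightarrow> 'a \<Rightarrow> bool" where
  "found eq True ys x = True"
| "found eq False [] x = False"
| "found eq False (y # ys) x = found eq (eq x y) ys x"

text \<open>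
  The two lists are the pairs still to be mutated and all pairs seen.
\<close>

definition extend :: "seed_pair \<Rightarrow> seed_pair list \<times> seed_pair list \<Rightarrow> seed_pair list \<times> seed_pair list" where
  "extend p ts = pick (found same_pair False (snd ts) p) ts (p # fst ts, p # snd ts)"

fun explore :: "root_data \<Rightarrow> nat \<Rightarrow> seed_pair list \<times> seed_pair list \<Rightarrow> seed_pair list option" where
  "explore R 0 ts = None"
| "explore R (Suc n) ([], s) = Some s"
| "explore R (Suc n) (p # t, s) = explore R n (fold extend (nbrs R p) (t, s))"

text \<open>
  All pairs reachable from \<open>(m, n)\<close> by mutating both seeds at the same index. The number 100
  only bounds the search; the classes concerned have at most 48 elements.
\<close>

definition component :: "root_data \<Rightarrow> mseed \<Rightarrow> mseed \<Rightarrow> seed_pair list option" where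
  "component R m n = explore R 100 ([sortp (m, n)], [sortp (m, n)])"

lemma same_seed_iff [simp]: "same_seed m n \<longleftrightarrow> m = n"
  by (cases m; cases n) (auto split: if_splits)

lemma same_pair_iff [simp]: "same_pair p r \<longleftrightarrow> p = r"
  by (cases p; cases r) (auto split: if_splits simp del: same_seed.simps)

lemma found_iff:
  assumes "\<And>x y. eq x y \<longleftrightarrow> x = y"
  shows "found eq b ys x \<longleftrightarrow> b \<or> x \<in> set ys"
proof (induction ys arbitrary: b)
  case Nil then show ?case by (cases b) auto
next
  case (Cons y ys) then show ?case by (cases b) (auto simp: assms)
qed

lemma found_same_pair [simp]: "found same_pair b ps p \<longleftrightarrow> b \<or> p \<in> set ps"
  by (rule found_iff) simp

lemma found_same_seed [simp]: "found same_seed b ms m \<longleftrightarrow> b \<or> m \<in> set ms"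
  by (rule found_iff) simp

fun distinct_seeds :: "mseed list \<Rightarrow> bool" where
  "distinct_seeds [] = True"
| "distinct_seeds (m # ms) = pick (found same_seed False ms m) False (distinct_seeds ms)"

lemma distinct_seeds_iff [simp]: "distinct_seeds ms \<longleftrightarrow> distinct ms"
  by (induction ms) (simp_all add: pick_if del: split_paired_All)

lemma extend_sets:
  "set (fst (fold extend ps (t, s))) = set t \<union> (set ps - set s)"
  "set (snd (fold extend ps (t, s))) = set s \<union> set ps"
  by (induction ps arbitrary: t s) (auto simp: extend_def pick_if)

text \<open>
  Invariant of the search: every pair that has been seen and no longer waits has all its
  neighbours among the pairs seen.
\<close>

lemma explore_closed:
  assumes "explore R n (t, s) = Some P" "set t \<subseteq> set s" "\<And>p. p \<in> set s - set t \<Longrightarrow> set (nbrs R p) \<subseteq> set s"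
  shows "set s \<subseteq> set P \<and> (\<forall>p\<in>set P. set (nbrs R p) \<subseteq> set P)"
  using assms
proof (induction n arbitrary: t s)
  case (Suc n)
  show ?case
  proof (cases t)
    case Nil then show ?thesis using Suc.prems by auto
  next
    case (Cons p t')
    obtain t2 s2 where ts: "fold extend (nbrs R p) (t', s) = (t2, s2)" by fastforce
    have sets: "set t2 = set t' \<union> (set (nbrs R p) - set s)" "set s2 = set s \<union> set (nbrs R p)"
      using extend_sets[of "nbrs R p" t' s] ts by auto
    have "explore R n (t2, s2) = Some P" using Suc.prems(1) Cons ts by simp
    moreover have "set t2 \<subseteq> set s2" using sets Suc.prems(2) Cons by auto
    moreover have "set (nbrs R r) \<subseteq> set s2" if "r \<in> set s2 - set t2" for r
      using that sets Suc.prems(3)[of r] Cons by auto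
    ultimately have "set s2 \<subseteq> set P \<and> (\<forall>p\<in>set P. set (nbrs R p) \<subseteq> set P)" using Suc.IH by blast
    then show ?thesis using sets by auto
  qed
qed simp

lemma explore_sound:
  assumes "explore R n (t, s) = Some P" "set t \<subseteq> set s"
    and "\<And>p. p \<in> set s \<Longrightarrow> Q p" "\<And>p q. Q p \<Longrightarrow> q \<in> set (nbrs R p) \<Longrightarrow> Q q"
  shows "p \<in> set P \<Longrightarrow> Q p"
  using assms(1-3)
proof (induction n arbitrary: t s)
  case (Suc n)
  show ?case
  proof (cases t)
    case Nil then show ?thesis using Suc.prems by auto
  next
    case (Cons r t')
    obtain t2 s2 where ts: "fold extend (nbrs R r) (t', s) = (t2, s2)" by fastforce
    have sets: "set t2 = set t' \<union> (set (nbrs R r) - set s)" "set s2 = set s \<union> set (nbrs R r)"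
      using extend_sets[of "nbrs R r" t' s] ts by auto
    have "explore R n (t2, s2) = Some P" using Suc.prems(2) Cons ts by simp
    moreover have "set t2 \<subseteq> set s2" using sets Suc.prems(3) Cons by auto
    moreover have "Q r" using Suc.prems(3,4) Cons by simp
    then have "Q q" if "q \<in> set s2" for q
      using that sets(2) Suc.prems(4) assms(4) by blast
    ultimately show ?thesis using Suc.IH Suc.prems(1) by blast
  qed
qed simp

lemma component_props:
  assumes "component R m n = Some P"
  shows "sortp (m, n) \<in> set P"
    and "\<And>p. p \<in> set P \<Longrightarrow> set (nbrs R p) \<subseteq> set P"
  using explore_closed[OF assms[unfolded component_def]] by simp_all

lemma component_induct:
  assumes "component R m n = Some P" "p \<in> set P" "Q (sortp (m, n))"
    and "\<And>p q. Q p \<Longrightarrow> q \<in> set (nbrs R p) \<Longrightarrow> Q q"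
  shows "Q p"
  by (rule explore_sound[OF assms(1)[unfolded component_def] _ _ assms(4) assms(2)]) (simp_all add: assms(3))

section \<open>Permuting indices\<close>

text \<open>
  Relabelling on the level of indices; \<open>rot\<close>, \<open>swap\<close> and hence sorting are instances.
\<close>

definition mperm :: "(3 \<Rightarrow> 3) \<Rightarrow> mseed \<Rightarrow> mseed" where
  "mperm \<pi> m = (root_at m (\<pi> 1), root_at m (\<pi> 2), root_at m (\<pi> 3),
     entry_at m (\<pi> 1) (\<pi> 2), entry_at m (\<pi> 1) (\<pi> 3), entry_at m (\<pi> 2) (\<pi> 3))"

lemma entry_at_skew: "entry_at m j i = zneg (entry_at m i j)"
  using exhaust_3[of i] exhaust_3[of j] by (cases m) (auto simp: entry_at_def)

lemma entry_at_diag [simp]: "entry_at m i i = (0, 0)"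
  using exhaust_3[of i] by (cases m) (auto simp: entry_at_def)

lemma entry_at_tuple:
  "entry_at (a, b, c, x, y, z) 1 2 = x" "entry_at (a, b, c, x, y, z) 1 3 = y" "entry_at (a, b, c, x, y, z) 2 3 = z"
  "entry_at (a, b, c, x, y, z) 2 1 = zneg x" "entry_at (a, b, c, x, y, z) 3 1 = zneg y" "entry_at (a, b, c, x, y, z) 3 2 = zneg z"
  by (simp_all add: entry_at_def)

lemma root_at_tuple:
  "root_at (a, b, c, x, y, z) 1 = a" "root_at (a, b, c, x, y, z) 2 = b" "root_at (a, b, c, x, y, z) 3 = c"
  by (simp_all add: root_at_def)

lemma root_at_mperm: "root_at (mperm \<pi> m) i = root_at m (\<pi> i)"
  using exhaust_3[of i] by (auto simp: root_at_def mperm_def)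

lemma entry_at_mperm: "entry_at (mperm \<pi> m) i j = entry_at m (\<pi> i) (\<pi> j)"
  using exhaust_3[of i] exhaust_3[of j]
  by (auto simp: mperm_def entry_at_tuple entry_at_skew[of m "\<pi> 1" "\<pi> 2"]
      entry_at_skew[of m "\<pi> 1" "\<pi> 3"] entry_at_skew[of m "\<pi> 2" "\<pi> 3"])

lemma mseed_eqI:
  assumes "\<And>i. root_at m i = root_at n i" "\<And>i j. entry_at m i j = entry_at n i j"
  shows "m = n"
  using assms(1)[of 1] assms(1)[of 2] assms(1)[of 3] assms(2)[of 1 2] assms(2)[of 1 3] assms(2)[of 2 3]
  by (cases m; cases n) (simp add: root_at_def entry_at_def)

lemma mperm_mperm: "mperm \<pi> (mperm \<sigma> m) = mperm (\<sigma> \<circ> \<pi>) m"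
  by (rule mseed_eqI) (simp_all add: root_at_mperm entry_at_mperm)

lemma mperm_id [simp]: "mperm id m = m" "mperm (\<lambda>i. i) m = m"
  by (rule mseed_eqI; simp add: root_at_mperm entry_at_mperm)+

definition rot3 :: "3 \<Rightarrow> 3" where "rot3 i = (if i = 1 then 2 else if i = 2 then 3 else 1)"
definition swap3 :: "3 \<Rightarrow> 3" where "swap3 i = (if i = 1 then 2 else if i = 2 then 1 else 3)"

lemma bij_rot3: "bij rot3"
  by (rule o_bij[of "rot3 \<circ> rot3"]) (auto simp: fun_eq_iff forall_3 rot3_def)

lemma bij_swap3: "bij swap3"
  by (rule o_bij[of swap3]) (auto simp: fun_eq_iff forall_3 swap3_def)

lemma rot_mperm: "rot m = mperm rot3 m"
  by (cases m) (simp add: mperm_def root_at_def entry_at_def rot3_def)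

lemma swap_mperm: "swap m = mperm swap3 m"
  by (cases m) (simp add: mperm_def root_at_def entry_at_def swap3_def)

lemma arrange_mperm: "\<exists>\<pi>. bij \<pi> \<and> arrange p = map_prod (mperm \<pi>) (mperm \<pi>) p"
  by (cases "unordered (fst p)"; cases p)
    (auto simp: arrange_def swap_mperm intro: bij_swap3 exI[of _ swap3] exI[of _ id])

lemma rotp_mperm: "rotp p = map_prod (mperm rot3) (mperm rot3) p"
  by (cases p) (simp add: rotp_def rot_mperm)

lemma sortp_mperm: "\<exists>\<pi>. bij \<pi> \<and> sortp p = map_prod (mperm \<pi>) (mperm \<pi>) p"
proof -
  define Q where "Q f \<longleftrightarrow> (\<forall>p. \<exists>\<pi>. bij \<pi> \<and> f p = map_prod (mperm \<pi>) (mperm \<pi>) p)" for f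
  have comp: "Q (f \<circ> g)" if "Q f" "Q g" for f g
    unfolding Q_def
  proof
    fix p
    obtain \<pi> where \<pi>: "bij \<pi>" "g p = map_prod (mperm \<pi>) (mperm \<pi>) p" using \<open>Q g\<close> Q_def by blast
    obtain \<sigma> where \<sigma>: "bij \<sigma>" "f (g p) = map_prod (mperm \<sigma>) (mperm \<sigma>) (g p)" using \<open>Q f\<close> Q_def by blast
    have "(f \<circ> g) p = map_prod (mperm (\<pi> \<circ> \<sigma>)) (mperm (\<pi> \<circ> \<sigma>)) p"
      using \<pi>(2) \<sigma>(2) by (cases p) (simp add: mperm_mperm)
    then show "\<exists>\<pi>. bij \<pi> \<and> (f \<circ> g) p = map_prod (mperm \<pi>) (mperm \<pi>) p" using bij_comp[OF \<sigma>(1) \<pi>(1)] by blast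
  qed
  have "Q rotp" unfolding Q_def using rotp_mperm bij_rot3 by blast
  moreover have "Q arrange" unfolding Q_def using arrange_mperm by blast
  ultimately have "Q (arrange \<circ> rotp \<circ> rotp \<circ> arrange \<circ> rotp \<circ> arrange)" by (intro comp)
  moreover have "sortp = arrange \<circ> rotp \<circ> rotp \<circ> arrange \<circ> rotp \<circ> arrange" by (simp add: sortp_def fun_eq_iff)
  ultimately show ?thesis unfolding Q_def by metis
qed

lemma sort1_mperm: "\<exists>\<pi>. bij \<pi> \<and> sort1 m = mperm \<pi> m"
  using sortp_mperm[of "(m, m)"] by (auto simp: sort1_def)

text \<open>
  An ordered seed is a canonical representative of its relabellings: only the identity permutes
  three strictly increasing roots increasingly.
\<close>

lemma ordered_mperm_unique:
  assumes "ordered m" "ordered (mperm \<pi> m)"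
  shows "mperm \<pi> m = m"
proof -
  \<comment> \<open>an order preserving code, which turns the goal into arithmetic\<close>
  define key :: "root \<Rightarrow> nat" where "key r = 2 * snd r + (if fst r then 0 else 1)" for r
  have less: "root_less r s \<longleftrightarrow> key r < key s" for r s
    by (cases r; cases s) (auto simp: key_def)
  have ord: "ordered n \<longleftrightarrow> key (root_at n 1) < key (root_at n 2) \<and> key (root_at n 2) < key (root_at n 3)" for n
    by (cases n) (auto simp: less root_at_def)
  have "\<pi> 1 = 1 \<and> \<pi> 2 = 2 \<and> \<pi> 3 = 3"
    using assms exhaust_3[of "\<pi> 1"] exhaust_3[of "\<pi> 2"] exhaust_3[of "\<pi> 3"]
    unfolding ord root_at_mperm by auto
  then have "\<pi> = id" using exhaust_3 by (metis eq_id_iff)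
  then show ?thesis by simp
qed

section \<open>Rank two subseeds\<close>

text \<open>
  The operation \<open>tau_mu2\<close> on a pair of roots whose matrix entry is nonnegative: mutation at the
  second root followed by exchange. Mutation changes the sign of the entry and the exchange
  restores it, so the weight stays fixed along the orbit, and only the flag whether it is
  nonzero is needed.
\<close>

fun step2 :: "root_data \<Rightarrow> bool \<Rightarrow> root \<times> root \<Rightarrow> root \<times> root" where
  "step2 R w (a, b) = (flip b, pick (fst b) a (pick w (root_refl R a b) a))"

fun orbit :: "root_data \<Rightarrow> bool \<Rightarrow> nat \<Rightarrow> root \<times> root \<Rightarrow> (root \<times> root) list" where
  "orbit R w 0 y = []"
| "orbit R w (Suc n) y = y # orbit R w n (step2 R w y)"

fun first_return :: "'a \<Rightarrow> 'a list \<Rightarrow> bool" where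
  "first_return x [] = False"
| "first_return x [y] = (x = y)"
| "first_return x (y # z # ys) = (if x = y then False else first_return x (z # ys))"

fun some_or_zero :: "nat option \<Rightarrow> nat" where
  "some_or_zero None = 0"
| "some_or_zero (Some n) = n"

definition period :: "root_data \<Rightarrow> zq \<Rightarrow> nat" where
  "period R w = some_or_zero (map_of (periods R) w)"

text \<open>
  Pairs with negative entry are passed over, since compatibility only speaks of the ordering in
  which the entry is nonnegative. A weight missing from the table has period zero and fails the
  test.
\<close>

definition ok2 :: "root_data \<Rightarrow> zq \<Rightarrow> root \<Rightarrow> root \<Rightarrow> bool" where
  "ok2 R w a b = pick (zpos (ring R) (zneg w)) True
     (first_return (a, b) (orbit R (zpos (ring R) w) (period R w) (step2 R (zpos (ring R) w) (a, b))))"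

fun locally_ok :: "root_data \<Rightarrow> mseed \<Rightarrow> bool" where
  "locally_ok R (a, b, c, x, y, z) = every [ok2 R x a b, ok2 R (zneg x) b a, ok2 R y a c,
     ok2 R (zneg y) c a, ok2 R z b c, ok2 R (zneg z) c b]"

lemma locally_ok_iff: "locally_ok R m \<longleftrightarrow> (\<forall>i j. i \<noteq> j \<longrightarrow> ok2 R (entry_at m i j) (root_at m i) (root_at m j))"
  by (cases m) (simp add: forall_3 root_at_tuple entry_at_tuple conj_ac)

lemma all_less_Suc_shift: "(\<forall>m<Suc k. P m) \<longleftrightarrow> P 0 \<and> (\<forall>m<k. P (Suc m))"
  by (metis Suc_less_eq2 less_Suc_eq_0_disj)

lemma has_period_first_return:
  "has_period (step2 R w) x n \<longleftrightarrow> first_return x (orbit R w n (step2 R w x))"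
proof -
  let ?f = "step2 R w"
  have *: "first_return x (orbit R w n y) \<longleftrightarrow> n > 0 \<and> (?f ^^ (n - 1)) y = x \<and> (\<forall>m<n - 1. (?f ^^ m) y \<noteq> x)" for n y
  proof (induction n arbitrary: y)
    case (Suc n)
    show ?case
    proof (cases n)
      case (Suc k)
      have "first_return x (orbit R w (Suc n) y) \<longleftrightarrow> x \<noteq> y \<and> first_return x (orbit R w n (?f y))"
        by (simp add: Suc)
      also have "\<dots> \<longleftrightarrow> y \<noteq> x \<and> (?f ^^ k) (?f y) = x \<and> (\<forall>m<k. (?f ^^ m) (?f y) \<noteq> x)"
        unfolding Suc.IH by (auto simp: Suc)
      also have "\<dots> \<longleftrightarrow> (?f ^^ Suc k) y = x \<and> (\<forall>m<Suc k. (?f ^^ m) y \<noteq> x)"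
        by (simp add: funpow_Suc_right all_less_Suc_shift conj_ac del: funpow.simps(2))
      finally show ?thesis by (simp add: Suc)
    qed auto
  qed simp
  show ?thesis
  proof (cases n)
    case (Suc k)
    have shift: "(?f ^^ Suc m) x = (?f ^^ m) (?f x)" for m by (simp add: funpow_Suc_right del: funpow.simps)
    have "(\<forall>m. 0 < m \<and> m < Suc k \<longrightarrow> (?f ^^ m) x \<noteq> x) \<longleftrightarrow> (\<forall>m<k. (?f ^^ Suc m) x \<noteq> x)"
      by (metis Suc_less_eq Zero_not_Suc gr0_conv_Suc neq0_conv)
    then show ?thesis unfolding * has_period_def Suc shift by simp
  qed (simp add: has_period_def)
qed

text \<open>
  The weight determines the fraction \<open>p / q\<close>, because the cosine is injective on the half
  circle. So there is only one period for a pair to have.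
\<close>

lemma cos_fraction_unique:
  fixes p q p' q' :: nat
  assumes "2 * cos (pi * real p / real q) = 2 * cos (pi * real p' / real q')"
    and "coprime p q" "coprime p' q'" "1 \<le> q" "1 \<le> q'" "2 * p \<le> q" "2 * p' \<le> q'"
  shows "p = p' \<and> q = q'"
proof -
  have bound: "0 \<le> pi * real p / real q \<and> pi * real p / real q \<le> pi" if "1 \<le> q" "2 * p \<le> q" for p q :: nat
  proof -
    have "real p \<le> real q" using that by linarith
    then have "real p / real q \<le> 1" using that by (simp add: divide_le_eq_1)
    then have "pi * (real p / real q) \<le> pi * 1" by (intro mult_left_mono) auto
    then show ?thesis by simp
  qed
  have "cos (pi * real p / real q) = cos (pi * real p' / real q')" using assms(1) by linarith
  then have "pi * real p / real q = pi * real p' / real q'"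
    using bound[OF assms(4,6)] bound[OF assms(5,7)] cos_inj_pi by blast
  then have "real p / real q = real p' / real q'"
    by (metis mult_left_cancel pi_neq_zero times_divide_eq_right)
  then have "real (p * q') = real (p' * q)" using assms(4,5) by (simp add: frac_eq_eq)
  then have "p * q' = p' * q" by (simp only: of_nat_eq_iff)
  then show ?thesis using assms(2,3) coprime_crossproduct_nat[of p q p' q'] by blast
qed

section \<open>The chamber of a generic reference point\<close>

fun rvec :: "(nat \<Rightarrow> real^3) \<Rightarrow> root \<Rightarrow> real^3" where
  "rvec \<rho> (s, i) = (if s then \<rho> i else - \<rho> i)"

definition realise :: "real \<Rightarrow> (nat \<Rightarrow> real^3) \<Rightarrow> mseed \<Rightarrow> 3 seed" where
  "realise \<theta> \<rho> m = (\<lambda>i. rvec \<rho> (root_at m i), \<chi> i j. zval \<theta> (entry_at m i j))"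

definition pair_seed :: "real \<Rightarrow> (nat \<Rightarrow> real^3) \<Rightarrow> zq \<Rightarrow> root \<times> root \<Rightarrow> 2 seed" where
  "pair_seed \<theta> \<rho> w x = (\<lambda>i. rvec \<rho> (if i = 1 then fst x else snd x),
     \<chi> i j. zval \<theta> (if i = j then (0, 0) else if i = 1 then w else zneg w))"

definition valid :: "nat \<Rightarrow> mseed \<Rightarrow> bool" where
  "valid N m \<longleftrightarrow> (\<forall>i. snd (root_at m i) < N)"

lemma realise_mperm: "realise \<theta> \<rho> (mperm \<pi> m) = reindex \<pi> (realise \<theta> \<rho> m)"
  by (simp add: realise_def reindex_def root_at_mperm entry_at_mperm fun_eq_iff)

lemma valid_mperm: "valid N m \<Longrightarrow> valid N (mperm \<pi> m)"
  by (simp add: valid_def root_at_mperm)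

lemma reindex_realise_pair:
  assumes "i \<noteq> j"
  shows "reindex (\<lambda>a::2. if a = 1 then i else j) (realise \<theta> \<rho> m) =
    pair_seed \<theta> \<rho> (entry_at m i j) (root_at m i, root_at m j)"
proof -
  have "(1::2) \<noteq> 2" by simp
  then show ?thesis
    by (auto simp: reindex_def realise_def pair_seed_def fun_eq_iff vec_eq_iff forall_2 entry_at_skew[of m j i])
qed

text \<open>
  A finite set of vectors closed under its reflections, up to sign, with every one of them
  positive for the point \<open>u\<close>. Positivity of a root is then its sign.
\<close>

locale root_chamber =
  fixes R :: root_data and \<theta> :: real and N :: nat and \<rho> :: "nat \<Rightarrow> real^3" and u :: "real^3"
  assumes quad: "quadratic_irrational (ring R) \<theta>"
    and refl: "\<And>i j. i < N \<Longrightarrow> j < N \<Longrightarrow> \<rho> i - (\<rho> i \<bullet> \<rho> j) *\<^sub>R \<rho> j = rvec \<rho> (refls R ! i ! j)"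
    and refl_valid: "\<And>i j. i < N \<Longrightarrow> j < N \<Longrightarrow> snd (refls R ! i ! j) < N"
    and gram: "\<And>i j. i < N \<Longrightarrow> j < N \<Longrightarrow> \<rho> i \<bullet> \<rho> j = zval \<theta> (grams R ! i ! j)"
    and norm2: "\<And>i. i < N \<Longrightarrow> \<rho> i \<bullet> \<rho> i = 2"
    and inj: "\<And>i j. i < N \<Longrightarrow> j < N \<Longrightarrow> \<rho> i = \<rho> j \<Longrightarrow> i = j"
    and unit: "norm u = 1"
    and neg: "\<And>i. i < N \<Longrightarrow> \<rho> i \<bullet> u < 0"
    and per: "\<And>w n. (w, n) \<in> set (periods R) \<Longrightarrow> \<exists>p q :: nat. p \<ge> 1 \<and> q \<ge> 1 \<and> coprime p q \<and> 2 * p \<le> q \<and>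
        zval \<theta> w = 2 * cos (pi * real p / real q) \<and> n = q + 2 * p"
begin

lemma rvec_sign: "snd r < N \<Longrightarrow> (if fst r then rvec \<rho> r \<bullet> u < 0 else 0 < rvec \<rho> r \<bullet> u)"
  using neg[of "snd r"] by (cases r) auto

text \<open>
  Roots of different sign lie on different sides of \<open>u\<close>.
\<close>

lemma rvec_inj: "snd r < N \<Longrightarrow> snd s < N \<Longrightarrow> rvec \<rho> r = rvec \<rho> s \<longleftrightarrow> r = s"
proof (rule iffI)
  assume rs: "snd r < N" "snd s < N" "rvec \<rho> r = rvec \<rho> s"
  then have "fst r = fst s"
    using rvec_sign[of r] rvec_sign[of s] by (metis less_asym)
  then show "r = s" using inj[OF rs(1,2)] rs(3) by (cases r; cases s) (auto split: if_splits)
qed simp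

lemma rvec_norm: "snd r < N \<Longrightarrow> rvec \<rho> r \<bullet> rvec \<rho> r = 2"
  by (cases r) (simp add: norm2)

lemma rvec_gram: "snd r < N \<Longrightarrow> snd s < N \<Longrightarrow> rvec \<rho> r \<bullet> rvec \<rho> s = zval \<theta> (root_gram R r s)"
  by (cases r; cases s) (simp add: gram pick_if)

lemma rvec_flip: "rvec \<rho> (flip r) = - rvec \<rho> r"
  by (cases r) simp

lemma snd_flip [simp]: "snd (flip r) = snd r"
  by (cases r) simp

lemma root_refl_valid: "snd r < N \<Longrightarrow> snd c < N \<Longrightarrow> snd (root_refl R r c) < N"
  using refl_valid[of "snd r" "snd c"]
  by (cases r; cases c; cases "refls R ! snd r ! snd c") auto

lemma rvec_refl:
  assumes "snd r < N" "snd c < N"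
  shows "rvec \<rho> r - (rvec \<rho> r \<bullet> rvec \<rho> c) *\<^sub>R rvec \<rho> c = rvec \<rho> (root_refl R r c)"
proof -
  obtain s i t j where [simp]: "r = (s, i)" "c = (t, j)" by (metis surj_pair)
  obtain e k where ek: "refls R ! i ! j = (e, k)" by fastforce
  have "rvec \<rho> r - (rvec \<rho> r \<bullet> rvec \<rho> c) *\<^sub>R rvec \<rho> c =
      (if s then 1 else -1) *\<^sub>R (\<rho> i - (\<rho> i \<bullet> \<rho> j) *\<^sub>R \<rho> j)"
    by simp
  also have "\<dots> = (if s then 1 else -1) *\<^sub>R rvec \<rho> (e, k)"
    using refl[of i j] assms ek by simp
  finally show ?thesis by (simp add: ek)
qed

lemma positive_rvec: "snd r < N \<Longrightarrow> positive_vector u (rvec \<rho> r) \<longleftrightarrow> fst r"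
  and negative_rvec: "snd r < N \<Longrightarrow> negative_vector u (rvec \<rho> r) \<longleftrightarrow> \<not> fst r"
  using rvec_sign[of r] unit
  by (auto simp: positive_vector_def negative_vector_def hemisphere_def split: if_splits)

lemma zpos [simp]: "zpos (ring R) x \<longleftrightarrow> 0 < zval \<theta> x"
  by (rule zpos_iff[OF quad])

lemma realise_inj:
  assumes "valid N m" "valid N n" "realise \<theta> \<rho> m = realise \<theta> \<rho> n"
  shows "m = n"
proof (rule mseed_eqI)
  show "root_at m i = root_at n i" for i
    using assms rvec_inj by (auto simp: realise_def valid_def fun_eq_iff)
  show "entry_at m i j = entry_at n i j" for i j
    using assms(3) zval_eq_iff[OF quad] by (auto simp: realise_def vec_eq_iff)
qed

lemma mutate_matrix_realise:
  "mutate_matrix 1 (snd (realise \<theta> \<rho> m)) = snd (realise \<theta> \<rho> (mutate_first R m))"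
proof -
  obtain a b c x y z where m: "m = (a, b, c, x, y, z)" by (cases m)
  have mutate_entry: "zval \<theta> (mutate_entry (ring R) x y z) =
      zval \<theta> z + (- zval \<theta> x * \<bar>zval \<theta> y\<bar> + \<bar>zval \<theta> x\<bar> * zval \<theta> y) / 2"
    by (auto simp: mutate_entry_def zval_zmul[OF quad] abs_if)
  show ?thesis
    unfolding m by (simp add: vec_eq_iff forall_3 mutate_matrix_def realise_def entry_at_tuple mutate_entry)
      (simp add: field_simps)
qed

lemma mutate_root_valid: "snd c < N \<Longrightarrow> snd d < N \<Longrightarrow> snd (mutate_root R c x d) < N"
  by (simp add: mutate_root_def pick_if root_refl_valid)

lemma mutate_first_valid: "valid N m \<Longrightarrow> valid N (mutate_first R m)"
  by (cases m) (auto simp: valid_def forall_3 root_at_tuple mutate_root_valid)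

lemma mutate_realise:
  assumes "valid N m"
  shows "mutate u 1 (realise \<theta> \<rho> m) = realise \<theta> \<rho> (mutate_first R m)"
proof -
  obtain a b c x y z where m: "m = (a, b, c, x, y, z)" by (cases m)
  have v: "snd a < N" "snd b < N" "snd c < N"
    using assms by (auto simp: m valid_def forall_3 root_at_tuple)
  have "mutate_vectors u 1 (realise \<theta> \<rho> m) i = fst (realise \<theta> \<rho> (mutate_first R m)) i" for i
    using exhaust_3[of i] v
    by (auto simp: m mutate_vectors_def realise_def Let_def root_at_tuple entry_at_tuple positive_rvec
        negative_rvec rvec_flip mutate_root_def pick_if rvec_refl)
  then show ?thesis
    using mutate_matrix_realise[of m] by (auto simp: mutate_def prod_eq_iff)
qed

lemma mutate_realise_perm:
  assumes "valid N m" "bij \<pi>"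
  shows "realise \<theta> \<rho> (mutate_first R (mperm \<pi> m)) = reindex \<pi> (mutate u (\<pi> 1) (realise \<theta> \<rho> m))"
  using mutate_realise[OF valid_mperm[OF assms(1), of \<pi>]] mutate_reindex[OF bij_is_inj[OF assms(2)]]
  by (simp add: realise_mperm)

lemma tau_mu2_pair:
  assumes "snd a < N" "snd b < N" "0 \<le> zval \<theta> w"
  shows "tau_mu2 u (pair_seed \<theta> \<rho> w (a, b)) = pair_seed \<theta> \<rho> w (step2 R (zpos (ring R) w) (a, b))"
proof -
  have "(1::2) \<noteq> 2" by simp
  then show ?thesis
    using assms
    by (auto simp: tau_mu2_def reindex_def mutate_def mutate_vectors_def mutate_matrix_def pair_seed_def
        Let_def fun_eq_iff vec_eq_iff forall_2 positive_rvec negative_rvec rvec_flip pick_if rvec_refl)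
qed

lemma pair_seed_inj:
  assumes "snd (fst x) < N" "snd (snd x) < N" "snd (fst y) < N" "snd (snd y) < N"
    and "pair_seed \<theta> \<rho> w x = pair_seed \<theta> \<rho> w y"
  shows "x = y"
proof -
  have "(1::2) \<noteq> 2" by simp
  moreover have "rvec \<rho> (if i = 1 then fst x else snd x) = rvec \<rho> (if i = 1 then fst y else snd y)" for i :: 2
    using assms(5) by (auto simp: pair_seed_def fun_eq_iff)
  from this[of 1] this[of 2] show ?thesis using assms by (auto simp: rvec_inj prod_eq_iff)
qed

lemma has_period_pair:
  assumes "snd a < N" "snd b < N" "0 \<le> zval \<theta> w"
  shows "has_period (tau_mu2 u) (pair_seed \<theta> \<rho> w (a, b)) n \<longleftrightarrow>
    has_period (step2 R (zpos (ring R) w)) (a, b) n"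
proof -
  define f where "f = step2 R (zpos (ring R) w)"
  have it: "snd (fst ((f ^^ m) (a, b))) < N \<and> snd (snd ((f ^^ m) (a, b))) < N \<and>
      (tau_mu2 u ^^ m) (pair_seed \<theta> \<rho> w (a, b)) = pair_seed \<theta> \<rho> w ((f ^^ m) (a, b))" for m
  proof (induction m)
    case (Suc m)
    obtain c d where cd: "(f ^^ m) (a, b) = (c, d)" by (metis surj_pair)
    then have v: "snd c < N" "snd d < N" using Suc by auto
    have "snd (fst (f (c, d))) < N \<and> snd (snd (f (c, d))) < N"
      using v by (simp add: f_def pick_if root_refl_valid)
    moreover have "tau_mu2 u (pair_seed \<theta> \<rho> w (c, d)) = pair_seed \<theta> \<rho> w (f (c, d))"
      unfolding f_def by (rule tau_mu2_pair[OF v assms(3)])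
    ultimately show ?case using Suc by (simp add: cd)
  qed (use assms in simp)
  have "(tau_mu2 u ^^ m) (pair_seed \<theta> \<rho> w (a, b)) = pair_seed \<theta> \<rho> w (a, b) \<longleftrightarrow> (f ^^ m) (a, b) = (a, b)" for m
    using it[of m] assms pair_seed_inj[of "(f ^^ m) (a, b)" "(a, b)" w] by auto
  then show ?thesis by (simp add: has_period_def f_def)
qed

text \<open>
  By uniqueness of the fraction, the short period demanded by the definition is the one in the
  table, and it may be read off the orbit of the pair of roots.
\<close>

lemma compatible_pair_iff:
  assumes "snd a < N" "snd b < N" "0 \<le> zval \<theta> w" "0 < period R w"
  shows "compatible_rank2 u (pair_seed \<theta> \<rho> w (a, b)) \<longleftrightarrow> ok2 R w a b"
proof -
  have "map_of (periods R) w = Some (period R w)"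
    using assms(4) by (cases "map_of (periods R) w") (auto simp: period_def)
  from per[OF map_of_SomeD[OF this]] obtain p q :: nat where pq: "p \<ge> 1" "q \<ge> 1" "coprime p q" "2 * p \<le> q"
      "zval \<theta> w = 2 * cos (pi * real p / real q)" "period R w = q + 2 * p" by blast
  have w: "snd (pair_seed \<theta> \<rho> w (a, b)) $ 1 $ 2 = zval \<theta> w" by (simp add: pair_seed_def)
  have "compatible_rank2 u (pair_seed \<theta> \<rho> w (a, b)) \<longleftrightarrow>
      has_period (tau_mu2 u) (pair_seed \<theta> \<rho> w (a, b)) (period R w)"
    unfolding compatible_rank2_def w using pq cos_fraction_unique by metis
  also have "\<dots> \<longleftrightarrow> ok2 R w a b"
    using assms(3) unfolding has_period_pair[OF assms(1-3)] has_period_first_return by (auto simp: ok2_def pick_if)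
  finally show ?thesis .
qed

lemma ok2_compatible:
  assumes "snd a < N" "snd b < N" "0 \<le> zval \<theta> w" "ok2 R w a b"
  shows "compatible_rank2 u (pair_seed \<theta> \<rho> w (a, b))"
proof -
  have "0 < period R w" using assms(3,4) by (cases "period R w") (auto simp: ok2_def pick_if)
  then show ?thesis using compatible_pair_iff assms by blast
qed

end

section \<open>Exploring a mutation class\<close>

text \<open>
  A listed pair stands for a pair of geometric seeds up to one common relabelling. That the
  relabelling is the same for both is what makes the pairing compatible with simultaneous
  mutation.
\<close>

definition tracks :: "real \<Rightarrow> (nat \<Rightarrow> real^3) \<Rightarrow> (nat \<Rightarrow> real^3) \<Rightarrow> seed_pair \<Rightarrow> 3 seed \<Rightarrow> 3 seed \<Rightarrow> bool" where
  "tracks \<theta> \<rho> \<rho>' p s s' \<longleftrightarrow>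
     (\<exists>\<pi>. bij \<pi> \<and> reindex \<pi> s = realise \<theta> \<rho> (fst p) \<and> reindex \<pi> s' = realise \<theta> \<rho>' (snd p))"

lemma tracks_start: "tracks \<theta> \<rho> \<rho>' (sortp (m, n)) (realise \<theta> \<rho> m) (realise \<theta> \<rho>' n)"
  using sortp_mperm[of "(m, n)"] by (auto simp: tracks_def realise_mperm)

lemma tracks_mutate:
  assumes "root_chamber R \<theta> N \<rho> u" "root_chamber R \<theta> N \<rho>' u'"
    and "valid N (fst p)" "valid N (snd p)"
    and "bij \<pi>" "reindex \<pi> s = realise \<theta> \<rho> (fst p)" "reindex \<pi> s' = realise \<theta> \<rho>' (snd p)"
    and "bij \<sigma>"
  shows "tracks \<theta> \<rho> \<rho>' (mutp R (map_prod (mperm \<sigma>) (mperm \<sigma>) p))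
    (mutate u (\<pi> (\<sigma> 1)) s) (mutate u' (\<pi> (\<sigma> 1)) s')"
proof -
  interpret c: root_chamber R \<theta> N \<rho> u by fact
  interpret c': root_chamber R \<theta> N \<rho>' u' by fact
  obtain m n where p: "p = (m, n)" by (cases p)
  obtain \<tau> where \<tau>: "bij \<tau>" "mutp R (map_prod (mperm \<sigma>) (mperm \<sigma>) p) =
      (mperm \<tau> (mutate_first R (mperm \<sigma> m)), mperm \<tau> (mutate_first R (mperm \<sigma> n)))"
    using sortp_mperm[of "(mutate_first R (mperm \<sigma> m), mutate_first R (mperm \<sigma> n))"] unfolding mutp_def p map_prod_simp by blast
  have "realise \<theta> \<rho> (mperm \<tau> (mutate_first R (mperm \<sigma> m))) = reindex (\<pi> \<circ> \<sigma> \<circ> \<tau>) (mutate u (\<pi> (\<sigma> 1)) s)"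
    using assms p mutate_reindex[OF bij_is_inj[OF assms(5)], of u "\<sigma> 1" s]
    by (simp add: realise_mperm c.mutate_realise_perm reindex_comp comp_assoc flip: assms(6))
  moreover have "realise \<theta> \<rho>' (mperm \<tau> (mutate_first R (mperm \<sigma> n))) = reindex (\<pi> \<circ> \<sigma> \<circ> \<tau>) (mutate u' (\<pi> (\<sigma> 1)) s')"
    using assms p mutate_reindex[OF bij_is_inj[OF assms(5)], of u' "\<sigma> 1" s']
    by (simp add: realise_mperm c'.mutate_realise_perm reindex_comp comp_assoc flip: assms(7))
  moreover have "bij (\<pi> \<circ> \<sigma> \<circ> \<tau>)" using assms \<tau> by (intro bij_comp)
  ultimately show ?thesis unfolding tracks_def \<tau>(2) by auto
qed

text \<open>
  The three neighbours of a pair come from the three rotations, which bring every index to the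
  first place.
\<close>

lemma nbrs_perm:
  "q \<in> set (nbrs R p) \<longleftrightarrow>
     (\<exists>\<sigma>\<in>{id, rot3, rot3 \<circ> rot3}. q = mutp R (map_prod (mperm \<sigma>) (mperm \<sigma>) p))"
  by (cases p) (simp add: nbrs_def rotp_mperm mperm_mperm)

lemma bij_rotations: "\<sigma> \<in> {id, rot3, rot3 \<circ> rot3} \<Longrightarrow> bij \<sigma>"
  using bij_rot3 bij_comp[OF bij_rot3 bij_rot3] by auto

lemma rotation_exists: "\<exists>\<sigma>\<in>{id, rot3, rot3 \<circ> rot3}. \<sigma> 1 = j"
  using exhaust_3[of j] by (auto simp: rot3_def)

context root_chamber
begin

lemma mutp_valid:
  assumes "valid N (fst p)" "valid N (snd p)"
  shows "valid N (fst (mutp R p)) \<and> valid N (snd (mutp R p))"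
proof -
  obtain \<tau> where "mutp R p = map_prod (mperm \<tau>) (mperm \<tau>) (map_prod (mutate_first R) (mutate_first R) p)"
    using sortp_mperm unfolding mutp_def by blast
  then have "fst (mutp R p) = mperm \<tau> (mutate_first R (fst p))" "snd (mutp R p) = mperm \<tau> (mutate_first R (snd p))"
    by (simp_all add: fst_map_prod snd_map_prod)
  then show ?thesis using assms mutate_first_valid valid_mperm by metis
qed

lemma nbrs_valid:
  assumes "valid N (fst p)" "valid N (snd p)" "q \<in> set (nbrs R p)"
  shows "valid N (fst q) \<and> valid N (snd q)"
  using assms(3) unfolding nbrs_perm using assms(1,2) by (auto intro!: mutp_valid valid_mperm)

lemma component_valid:
  assumes "component R m n = Some P" "valid N m" "valid N n" "p \<in> set P"
  shows "valid N (fst p) \<and> valid N (snd p)"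
proof (rule component_induct[OF assms(1,4)])
  show "valid N (fst (sortp (m, n))) \<and> valid N (snd (sortp (m, n)))"
    using sortp_mperm[of "(m, n)"] assms(2,3) by (auto simp: valid_mperm)
qed (use nbrs_valid in blast)

end

text \<open>
  Every pair of seeds met by simultaneous mutation appears in the list; the converse is
  \<open>component_reached\<close>.
\<close>

lemma component_tracks:
  assumes "root_chamber R \<theta> N \<rho> u" "root_chamber R \<theta> N \<rho>' u'"
    and "component R m n = Some P" "valid N m" "valid N n"
    and "(t, t') \<in> paired_class u u' (realise \<theta> \<rho> m) (realise \<theta> \<rho>' n)"
  shows "\<exists>p\<in>set P. tracks \<theta> \<rho> \<rho>' p t t'"
  using assms(6)
proof induction
  case start
  show ?case using component_props(1)[OF assms(3)] tracks_start by blast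
next
  case (step t t' k)
  then obtain p where p: "p \<in> set P" "tracks \<theta> \<rho> \<rho>' p t t'" by blast
  have v: "valid N (fst p)" "valid N (snd p)"
    using root_chamber.component_valid[OF assms(1,3-5) p(1)] by auto
  obtain \<pi> where \<pi>: "bij \<pi>" "reindex \<pi> t = realise \<theta> \<rho> (fst p)" "reindex \<pi> t' = realise \<theta> \<rho>' (snd p)"
    using p(2) tracks_def by auto
  obtain \<sigma> where \<sigma>: "\<sigma> \<in> {id, rot3, rot3 \<circ> rot3}" "\<sigma> 1 = inv \<pi> k" using rotation_exists by blast
  have "\<pi> (\<sigma> 1) = k" using \<sigma>(2) \<pi>(1) by (simp add: bij_is_surj surj_f_inv_f)
  moreover have "mutp R (map_prod (mperm \<sigma>) (mperm \<sigma>) p) \<in> set P"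
    using component_props(2)[OF assms(3) p(1)] nbrs_perm \<sigma>(1) by blast
  ultimately show ?case
    using tracks_mutate[OF assms(1,2) v \<pi> bij_rotations[OF \<sigma>(1)]] by blast
qed

lemma component_reached:
  assumes "root_chamber R \<theta> N \<rho> u" "root_chamber R \<theta> N \<rho>' u'"
    and "component R m n = Some P" "valid N m" "valid N n" "p \<in> set P"
  shows "\<exists>t t'. (t, t') \<in> paired_class u u' (realise \<theta> \<rho> m) (realise \<theta> \<rho>' n) \<and> tracks \<theta> \<rho> \<rho>' p t t'"
proof -
  let ?Q = "\<lambda>p. valid N (fst p) \<and> valid N (snd p) \<and>
    (\<exists>t t'. (t, t') \<in> paired_class u u' (realise \<theta> \<rho> m) (realise \<theta> \<rho>' n) \<and> tracks \<theta> \<rho> \<rho>' p t t')"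
  have "?Q p"
  proof (rule component_induct[OF assms(3,6)])
    have "valid N (fst (sortp (m, n))) \<and> valid N (snd (sortp (m, n)))"
      using sortp_mperm[of "(m, n)"] assms(4,5) by (auto simp: valid_mperm)
    then show "?Q (sortp (m, n))" using tracks_start paired_class.start by blast
  next
    fix p q assume p: "?Q p" and q: "q \<in> set (nbrs R p)"
    then obtain t t' where t: "(t, t') \<in> paired_class u u' (realise \<theta> \<rho> m) (realise \<theta> \<rho>' n)"
      "tracks \<theta> \<rho> \<rho>' p t t'" by blast
    obtain \<pi> where \<pi>: "bij \<pi>" "reindex \<pi> t = realise \<theta> \<rho> (fst p)" "reindex \<pi> t' = realise \<theta> \<rho>' (snd p)"
      using t(2) tracks_def by auto
    obtain \<sigma> where \<sigma>: "\<sigma> \<in> {id, rot3, rot3 \<circ> rot3}" "q = mutp R (map_prod (mperm \<sigma>) (mperm \<sigma>) p)"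
      using q nbrs_perm by blast
    have "tracks \<theta> \<rho> \<rho>' q (mutate u (\<pi> (\<sigma> 1)) t) (mutate u' (\<pi> (\<sigma> 1)) t')"
      using tracks_mutate[OF assms(1,2) _ _ \<pi> bij_rotations[OF \<sigma>(1)]] p \<sigma>(2) by blast
    then show "?Q q"
      using root_chamber.nbrs_valid[OF assms(1)] p q paired_class.step[OF t(1)] by blast
  qed
  then show ?thesis by blast
qed

text \<open>
  No seed occurs in two different pairs, neither as a first nor as a second component. The first
  components are sorted by construction; the second ones have to be sorted for the comparison.
\<close>

definition faithful :: "seed_pair list \<Rightarrow> bool" where
  "faithful P \<longleftrightarrow> every (map (\<lambda>p. ordered (fst p)) P) \<and> distinct_seeds (map fst P) \<and>
     every (map (\<lambda>p. ordered (sort1 (snd p))) P) \<and> distinct_seeds (map (\<lambda>p. sort1 (snd p)) P)"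

context root_chamber
begin

lemma same_class_realise:
  assumes "valid N m" "valid N n" "ordered m" "ordered n" "same_class (realise \<theta> \<rho> m) (realise \<theta> \<rho> n)"
  shows "m = n"
proof -
  obtain \<pi> where "bij \<pi>" "realise \<theta> \<rho> n = realise \<theta> \<rho> (mperm \<pi> m)"
    using assms(5) by (auto simp: same_class_def realise_mperm)
  then have "n = mperm \<pi> m" using realise_inj assms valid_mperm by blast
  then show ?thesis using ordered_mperm_unique assms by metis
qed

lemma same_class_sort1: "same_class (realise \<theta> \<rho> m) (realise \<theta> \<rho> (sort1 m))"
  using sort1_mperm[of m] by (auto simp: same_class_def realise_mperm)

lemma sort1_valid: "valid N m \<Longrightarrow> valid N (sort1 m)"
  using sort1_mperm[of m] valid_mperm by metis

end

text \<open>
  Seeds related by relabelling have the same sorted representative, hence belong to the same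
  listed pair, and so do their partners.
\<close>

lemma component_isomorphic:
  assumes c: "root_chamber R \<theta> N \<rho> u" "root_chamber R \<theta> N \<rho>' u'"
    and P: "component R m n = Some P" "valid N m" "valid N n" "faithful P"
  shows "graph_isomorphic (exchange_graph u (realise \<theta> \<rho> m)) (exchange_graph u' (realise \<theta> \<rho>' n))"
proof (rule paired_class_isomorphic)
  interpret c: root_chamber R \<theta> N \<rho> u by fact
  interpret c': root_chamber R \<theta> N \<rho>' u' by fact
  fix t t' r r'
  assume "(t, t') \<in> paired_class u u' (realise \<theta> \<rho> m) (realise \<theta> \<rho>' n)"
    "(r, r') \<in> paired_class u u' (realise \<theta> \<rho> m) (realise \<theta> \<rho>' n)"
  then obtain p q where p: "p \<in> set P" "tracks \<theta> \<rho> \<rho>' p t t'" and q: "q \<in> set P" "tracks \<theta> \<rho> \<rho>' q r r'"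
    using component_tracks[OF c P(1-3)] by meson
  have v: "valid N (fst p)" "valid N (snd p)" "valid N (fst q)" "valid N (snd q)"
    using c.component_valid[OF P(1-3)] p q by auto
  have st: "same_class t (realise \<theta> \<rho> (fst p))" "same_class t' (realise \<theta> \<rho>' (snd p))"
    "same_class r (realise \<theta> \<rho> (fst q))" "same_class r' (realise \<theta> \<rho>' (snd q))"
    using p(2) q(2) unfolding tracks_def same_class_def by metis+
  have o: "ordered (fst p)" "ordered (fst q)" "ordered (sort1 (snd p))" "ordered (sort1 (snd q))"
    using P(4) p q by (auto simp: faithful_def list_all_iff)
  have dist: "fst p = fst q \<Longrightarrow> p = q" "sort1 (snd p) = sort1 (snd q) \<Longrightarrow> p = q"
    using P(4) p(1) q(1) by (auto simp: faithful_def distinct_map inj_on_def)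
  note s = same_class_sym and tr = same_class_trans
  show "same_class t r \<longleftrightarrow> same_class t' r'"
  proof
    assume "same_class t r"
    then have "same_class (realise \<theta> \<rho> (fst p)) (realise \<theta> \<rho> (fst q))" using st s tr by meson
    then have "p = q" using dist(1) c.same_class_realise v o by blast
    then show "same_class t' r'" using st s tr by meson
  next
    assume "same_class t' r'"
    then have "same_class (realise \<theta> \<rho>' (sort1 (snd p))) (realise \<theta> \<rho>' (sort1 (snd q)))"
      using st s tr c'.same_class_sort1 by meson
    then have "p = q" using dist(2) c'.same_class_realise c.sort1_valid v o by blast
    then show "same_class t r" using st s tr by meson
  qed
qed

context root_chamber
begin

lemma class_tracks:
  assumes "component R m n = Some P" "valid N m" "valid N n" "t \<in> mutation_class u (realise \<theta> \<rho> n)"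
  shows "\<exists>p\<in>set P. \<exists>\<pi>. bij \<pi> \<and> reindex \<pi> t = realise \<theta> \<rho> (snd p)"
proof -
  have c: "root_chamber R \<theta> N \<rho> u" by unfold_locales
  obtain t0 where "(t0, t) \<in> paired_class u u (realise \<theta> \<rho> m) (realise \<theta> \<rho> n)"
    using assms(4) unfolding paired_class_snd[of u _ u "realise \<theta> \<rho> m"] by auto
  then show ?thesis using component_tracks[OF c c assms(1-3)] tracks_def by meson
qed

lemma class_reached:
  assumes "component R m n = Some P" "valid N m" "valid N n" "p \<in> set P"
  shows "\<exists>t\<in>mutation_class u (realise \<theta> \<rho> n). \<exists>\<pi>. bij \<pi> \<and> reindex \<pi> t = realise \<theta> \<rho> (snd p)"
proof -
  have c: "root_chamber R \<theta> N \<rho> u" by unfold_locales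
  obtain t t' where "(t, t') \<in> paired_class u u (realise \<theta> \<rho> m) (realise \<theta> \<rho> n)" "tracks \<theta> \<rho> \<rho> p t t'"
    using component_reached[OF c c assms] by blast
  then show ?thesis
    unfolding paired_class_snd[of u "realise \<theta> \<rho> n" u "realise \<theta> \<rho> m"] tracks_def by force
qed

lemma realise_reference:
  assumes "valid N m" "bij \<pi>" "reindex \<pi> t = realise \<theta> \<rho> m"
  shows "\<exists>r. snd r < N \<and> fst t k = rvec \<rho> r"
proof -
  have "fst t k = fst (reindex \<pi> t) (inv \<pi> k)"
    using assms(2) by (simp add: reindex_def bij_is_surj surj_f_inv_f)
  then have "fst t k = rvec \<rho> (root_at m (inv \<pi> k))" using assms(3) by (simp add: realise_def)
  then show ?thesis using assms(1) unfolding valid_def by blast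
qed

lemma not_on_circle: "snd r < N \<Longrightarrow> u \<notin> great_circle (rvec \<rho> r)"
  using rvec_sign[of r] by (auto simp: great_circle_def split: if_splits)

text \<open>
  Mutation never leaves the table, hence \<open>u\<close> stays off all mirrors that occur.
\<close>

lemma valid_class:
  assumes "valid N m" "t \<in> mutation_class u (realise \<theta> \<rho> m)"
  shows "\<exists>n \<pi>. valid N n \<and> bij \<pi> \<and> reindex \<pi> t = realise \<theta> \<rho> n"
  using assms(2)
proof induction
  case start
  then show ?case using assms(1) reindex_id bij_id by blast
next
  case (step t k)
  then obtain n \<pi> where n: "valid N n" "bij \<pi>" "reindex \<pi> t = realise \<theta> \<rho> n" by blast
  obtain \<sigma> where \<sigma>: "\<sigma> \<in> {id, rot3, rot3 \<circ> rot3}" "\<sigma> 1 = inv \<pi> k" using rotation_exists by blast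
  have "\<pi> (\<sigma> 1) = k" using \<sigma>(2) n(2) by (simp add: bij_is_surj surj_f_inv_f)
  then have "realise \<theta> \<rho> (mutate_first R (mperm \<sigma> n)) = reindex (\<pi> \<circ> \<sigma>) (mutate u k t)"
    using n mutate_realise_perm[OF n(1) bij_rotations[OF \<sigma>(1)]] mutate_reindex[OF bij_is_inj[OF n(2)], of u "\<sigma> 1" t]
    by (simp add: reindex_comp)
  then show ?case
    using n(1) mutate_first_valid valid_mperm bij_comp[OF bij_rotations[OF \<sigma>(1)] n(2)] by metis
qed

lemma reference_realise:
  assumes "valid N m" shows "reference_point u (realise \<theta> \<rho> m)"
proof -
  have "u \<notin> great_circle (fst t k)" if t: "t \<in> mutation_class u (realise \<theta> \<rho> m)" for t k
  proof -
    obtain n \<pi> where "valid N n" "bij \<pi>" "reindex \<pi> t = realise \<theta> \<rho> n" using valid_class[OF assms t] by blast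
    then obtain r where "snd r < N" "fst t k = rvec \<rho> r" using realise_reference by blast
    then show ?thesis using not_on_circle by simp
  qed
  then show ?thesis using unit by (auto simp: reference_point_def occurring_vectors_def)
qed

lemma normalised_realise: assumes "valid N m" shows "normalised (realise \<theta> \<rho> m)"
proof -
  have "zval \<theta> (entry_at m i j) + zval \<theta> (entry_at m j i) = 0" for i j
    using entry_at_skew[of m j i] by simp
  then show ?thesis
    using assms rvec_norm by (auto simp: normalised_def realise_def valid_def)
qed

lemma subseed_realise:
  assumes "bij \<pi>" "reindex \<pi> t = realise \<theta> \<rho> m" "i \<noteq> j"
  shows "reindex (\<lambda>a::2. if a = 1 then i else j) t =
    pair_seed \<theta> \<rho> (entry_at m (inv \<pi> i) (inv \<pi> j)) (root_at m (inv \<pi> i), root_at m (inv \<pi> j))"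
    and "snd t $ i $ j = zval \<theta> (entry_at m (inv \<pi> i) (inv \<pi> j))"
proof -
  have s: "\<pi> (inv \<pi> x) = x" for x using assms(1) by (simp add: bij_is_surj surj_f_inv_f)
  then have ne: "inv \<pi> i \<noteq> inv \<pi> j" using assms(3) by metis
  have "reindex (\<lambda>a::2. if a = 1 then i else j) t =
      reindex (\<lambda>a::2. if a = 1 then inv \<pi> i else inv \<pi> j) (realise \<theta> \<rho> m)"
    unfolding assms(2)[symmetric] reindex_2_comp s ..
  then show "reindex (\<lambda>a::2. if a = 1 then i else j) t =
    pair_seed \<theta> \<rho> (entry_at m (inv \<pi> i) (inv \<pi> j)) (root_at m (inv \<pi> i), root_at m (inv \<pi> j))"
    using reindex_realise_pair[OF ne] by simp
  have "snd (reindex \<pi> t) $ inv \<pi> i $ inv \<pi> j = snd t $ i $ j" by (simp add: reindex_def s)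
  then show "snd t $ i $ j = zval \<theta> (entry_at m (inv \<pi> i) (inv \<pi> j))"
    unfolding assms(2) by (simp add: realise_def)
qed

text \<open>
  A class is compatible if the finitely many seeds listed for it pass the test for pairs.
\<close>

lemma component_compatible:
  assumes "component R m n = Some P" "valid N m" "valid N n" "list_all (\<lambda>p. locally_ok R (snd p)) P"
  shows "compatible_position u (realise \<theta> \<rho> n)"
  unfolding compatible_position_def
proof (intro conjI ballI allI impI)
  show "reference_point u (realise \<theta> \<rho> n)" using reference_realise[OF assms(3)] .
next
  fix t i j assume t: "t \<in> mutation_class u (realise \<theta> \<rho> n)" and ij: "i \<noteq> j \<and> snd t $ i $ j \<ge> 0"
  obtain p \<pi> where p: "p \<in> set P" "bij \<pi>" "reindex \<pi> t = realise \<theta> \<rho> (snd p)"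
    using class_tracks[OF assms(1-3) t] by blast
  have v: "valid N (snd p)" using component_valid[OF assms(1-3) p(1)] by blast
  have "inv \<pi> i \<noteq> inv \<pi> j" using ij p(2) by (metis bij_inv_eq_iff)
  then have "ok2 R (entry_at (snd p) (inv \<pi> i) (inv \<pi> j)) (root_at (snd p) (inv \<pi> i)) (root_at (snd p) (inv \<pi> j))"
    using assms(4) p(1) locally_ok_iff by (auto simp: list_all_iff)
  then show "compatible_rank2 u (reindex (\<lambda>a. if a = 1 then i else j) t)"
    using subseed_realise[OF p(2,3), of i j] ij v ok2_compatible unfolding valid_def by metis
qed

lemma component_occurring:
  assumes "component R m n = Some P" "valid N m" "valid N n" "p \<in> set P" "root_at (snd p) i = r"
  shows "rvec \<rho> r \<in> occurring_vectors u (realise \<theta> \<rho> n)"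
proof -
  obtain t \<pi> where t: "t \<in> mutation_class u (realise \<theta> \<rho> n)" "bij \<pi>" "reindex \<pi> t = realise \<theta> \<rho> (snd p)"
    using class_reached[OF assms(1-4)] by blast
  have "fst t (\<pi> i) = rvec \<rho> r" using arg_cong[OF t(3), of "\<lambda>s. fst s i"] assms(5)
    by (simp add: reindex_def realise_def)
  then show ?thesis using occurring_mem[OF t(1)] by metis
qed

end

section \<open>Refuting compatibility\<close>

text \<open>
  A failed test refutes compatibility only if the weight is in the table.
\<close>

definition bad2 :: "root_data \<Rightarrow> zq \<Rightarrow> root \<Rightarrow> root \<Rightarrow> bool" where
  "bad2 R w a b = pick (ok2 R w a b) False (0 < period R w)"

fun locally_bad :: "root_data \<Rightarrow> mseed \<Rightarrow> bool" where
  "locally_bad R (a, b, c, x, y, z) = any [bad2 R x a b, bad2 R (zneg x) b a, bad2 R y a c,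
     bad2 R (zneg y) c a, bad2 R z b c, bad2 R (zneg z) c b]"

text \<open>
  Follow a walk, given by the number of rotations before each mutation at the first index, until
  a pair fails. The flag says whether the current seed has been dealt with.
\<close>

fun refuted :: "root_data \<Rightarrow> bool \<Rightarrow> nat list \<Rightarrow> mseed \<Rightarrow> bool" where
  "refuted R True ks m = True"
| "refuted R False [] m = False"
| "refuted R False (k # ks) m =
     refuted R (locally_bad R (mutate_first R ((rot ^^ k) m))) ks (mutate_first R ((rot ^^ k) m))"

lemma locally_bad_iff:
  "locally_bad R m \<longleftrightarrow> (\<exists>i j. i \<noteq> j \<and> bad2 R (entry_at m i j) (root_at m i) (root_at m j))"
proof -
  have ex: "(\<exists>i::3. Q i) \<longleftrightarrow> Q 1 \<or> Q 2 \<or> Q 3" for Q by (metis exhaust_3)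
  show ?thesis by (cases m) (auto simp: ex root_at_tuple entry_at_tuple)
qed

lemma compatible_mutate:
  assumes "compatible_position u s" shows "compatible_position u (mutate u k s)"
proof -
  have "mutation_class u (mutate u k s) \<subseteq> mutation_class u s"
    using mutation_class_trans[OF mutation_class.step[OF mutation_class.start]] by blast
  then show ?thesis
    using assms by (fastforce simp: compatible_position_def reference_point_def occurring_vectors_def)
qed

context root_chamber
begin

lemma compatible_ok2:
  assumes "valid N m" "compatible_position u (realise \<theta> \<rho> m)" "i \<noteq> j" "0 < period R (entry_at m i j)"
  shows "ok2 R (entry_at m i j) (root_at m i) (root_at m j)"
proof (cases "0 \<le> zval \<theta> (entry_at m i j)")
  case True
  have "compatible_rank2 u (reindex (\<lambda>a. if a = 1 then i else j) (realise \<theta> \<rho> m))"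
    using assms(2,3) True mutation_class.start unfolding compatible_position_def
    by (metis (no_types, lifting) realise_def snd_conv vec_lambda_beta)
  then show ?thesis
    using reindex_realise_pair[OF assms(3)] compatible_pair_iff True assms by (simp add: valid_def)
next
  case False
  then show ?thesis by (simp add: ok2_def pick_if)
qed

lemma rot_pow_mperm: "\<exists>\<pi>. bij \<pi> \<and> (rot ^^ k) m = mperm \<pi> m"
proof (induction k)
  case 0 then show ?case using bij_id by (metis funpow_0 mperm_id(1))
next
  case (Suc k)
  then obtain \<pi> where "bij \<pi>" "(rot ^^ k) m = mperm \<pi> m" by blast
  then have "(rot ^^ Suc k) m = mperm (\<pi> \<circ> rot3) m" "bij (\<pi> \<circ> rot3)"
    using bij_comp[OF bij_rot3] by (auto simp: rot_mperm mperm_mperm)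
  then show ?case by blast
qed

lemma locally_bad_not_compatible:
  assumes "valid N m" "locally_bad R m"
  shows "\<not> compatible_position u (realise \<theta> \<rho> m)"
  using compatible_ok2[OF assms(1)] assms(2) unfolding locally_bad_iff bad2_def pick_if by (metis (full_types))

text \<open>
  Compatibility of a position is inherited by all seeds of the class, so a bad pair anywhere on
  the walk refutes it at the start.
\<close>

lemma refuted_not_compatible:
  assumes "valid N m" "refuted R b ks m"
  shows "b \<or> \<not> compatible_position u (realise \<theta> \<rho> m)"
  using assms
proof (induction ks arbitrary: b m)
  case Nil
  then show ?case by (cases b) auto
next
  case (Cons k ks)
  show ?case
  proof (cases b)
    case False
    obtain \<pi> where \<pi>: "bij \<pi>" "(rot ^^ k) m = mperm \<pi> m" using rot_pow_mperm by blast
    have v: "valid N (mutate_first R (mperm \<pi> m))" using Cons.prems(1) valid_mperm mutate_first_valid by blast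
    have "\<not> compatible_position u (realise \<theta> \<rho> (mutate_first R (mperm \<pi> m)))"
      using Cons.IH[OF v] Cons.prems(2) False locally_bad_not_compatible[OF v] by (auto simp: \<pi>(2))
    then have "\<not> compatible_position u (mutate u (\<pi> 1) (realise \<theta> \<rho> m))"
      using mutate_realise_perm[OF Cons.prems(1) \<pi>(1)] reindex_invariance(1)[OF \<pi>(1)] by simp
    then show ?thesis using compatible_mutate by blast
  qed simp
qed

end

section \<open>Root systems in coordinates\<close>

type_synonym coords = "zq \<times> zq \<times> zq"

text \<open>
  The inner product of two vectors given by coordinates in three simple roots of square norm
  two, where \<open>- a\<close> and \<open>- b\<close> are the products of the neighbouring ones and the outer two are
  orthogonal.
\<close>

fun gram_form :: "int \<times> int \<Rightarrow> zq \<times> zq \<Rightarrow> coords \<Rightarrow> coords \<Rightarrow> zq" where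
  "gram_form D (a, b) (x, y, z) (x', y', z') =
     zadd (zmul D x (zadd (zadd x' x') (zneg (zmul D a y'))))
     (zadd (zmul D y (zadd (zadd y' y') (zneg (zadd (zmul D a x') (zmul D b z')))))
           (zmul D z (zadd (zadd z' z') (zneg (zmul D b y')))))"

fun refl_form :: "int \<times> int \<Rightarrow> zq \<Rightarrow> coords \<Rightarrow> coords \<Rightarrow> coords" where
  "refl_form D g (x, y, z) (x', y', z') =
     (zadd x (zneg (zmul D g x')), zadd y (zneg (zmul D g y')), zadd z (zneg (zmul D g z')))"

fun cneg :: "coords \<Rightarrow> coords" where
  "cneg (x, y, z) = (zneg x, zneg y, zneg z)"

text \<open>
  The result for a vector that is not found is an index outside of the table, which
  \<open>positive_roots\<close> excludes.
\<close>

fun signed_index :: "coords list \<Rightarrow> coords \<Rightarrow> nat \<Rightarrow> root" where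
  "signed_index [] c n = (True, n)"
| "signed_index (d # ds) c n =
     (if c = d then (True, n) else if c = cneg d then (False, n) else signed_index ds c (Suc n))"

definition root_table :: "int \<times> int \<Rightarrow> zq \<times> zq \<Rightarrow> coords list \<Rightarrow> (zq \<times> nat) list \<Rightarrow> root_data" where
  "root_table D ab L W = \<lparr>ring = D, grams = map (\<lambda>c. map (gram_form D ab c) L) L,
     refls = map (\<lambda>c. map (\<lambda>d. signed_index L (refl_form D (gram_form D ab c d) c d) 0) L) L,
     periods = W\<rparr>"

fun nonneg_coords :: "coords \<Rightarrow> bool" where
  "nonneg_coords ((a, a'), (b, b'), (c, c')) \<longleftrightarrow> 0 \<le> a \<and> 0 \<le> a' \<and> 0 \<le> b \<and> 0 \<le> b' \<and> 0 \<le> c \<and> 0 \<le> c'"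

text \<open>
  The list starts with the simple roots and is closed under reflections up to sign.
\<close>

definition positive_roots :: "int \<times> int \<Rightarrow> zq \<times> zq \<Rightarrow> coords list \<Rightarrow> bool" where
  "positive_roots D ab L \<longleftrightarrow>
     take 3 L = [((1, 0), (0, 0), (0, 0)), ((0, 0), (1, 0), (0, 0)), ((0, 0), (0, 0), (1, 0))] \<and>
     distinct L \<and> list_all nonneg_coords L \<and> list_all (\<lambda>c. gram_form D ab c c = (2, 0)) L \<and>
     list_all (list_all (\<lambda>r. snd r < length L)) (refls (root_table D ab L []))"

type_synonym frame = "(real^3) \<times> (real^3) \<times> (real^3)"

fun cvec :: "real \<Rightarrow> frame \<Rightarrow> coords \<Rightarrow> real^3" where
  "cvec \<theta> (a, b, c) (x, y, z) = zval \<theta> x *\<^sub>R a + zval \<theta> y *\<^sub>R b + zval \<theta> z *\<^sub>R c"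

fun simple_system :: "real \<Rightarrow> zq \<times> zq \<Rightarrow> frame \<Rightarrow> bool" where
  "simple_system \<theta> (\<alpha>, \<beta>) (a, b, c) \<longleftrightarrow> a \<bullet> a = 2 \<and> b \<bullet> b = 2 \<and> c \<bullet> c = 2 \<and>
     a \<bullet> b = - zval \<theta> \<alpha> \<and> b \<bullet> c = - zval \<theta> \<beta> \<and> a \<bullet> c = 0"

abbreviation root_vector :: "real \<Rightarrow> coords list \<Rightarrow> frame \<Rightarrow> nat \<Rightarrow> real^3" where
  "root_vector \<theta> L S \<equiv> \<lambda>i. cvec \<theta> S (L ! i)"

definition root_set :: "real \<Rightarrow> coords list \<Rightarrow> frame \<Rightarrow> (real^3) set" where
  "root_set \<theta> L S = rvec (root_vector \<theta> L S) ` {r. snd r < length L}"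

lemma cvec_inner:
  assumes "quadratic_irrational D \<theta>" "simple_system \<theta> ab S"
  shows "cvec \<theta> S x \<bullet> cvec \<theta> S y = zval \<theta> (gram_form D ab x y)"
proof -
  obtain a b c where S: "S = (a, b, c)" by (cases S)
  obtain \<alpha> \<beta> where ab: "ab = (\<alpha>, \<beta>)" by (cases ab)
  obtain x1 x2 x3 y1 y2 y3 where xy: "x = (x1, x2, x3)" "y = (y1, y2, y3)" by (metis surj_pair)
  have "b \<bullet> a = a \<bullet> b" "c \<bullet> b = b \<bullet> c" "c \<bullet> a = a \<bullet> c" by (simp_all add: inner_commute)
  with assms(2) show ?thesis
    by (simp add: S ab xy inner_add_left inner_add_right zval_zmul[OF assms(1)] algebra_simps)
qed

lemma cvec_refl_form:
  assumes "quadratic_irrational D \<theta>"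
  shows "cvec \<theta> S (refl_form D g x y) = cvec \<theta> S x - zval \<theta> g *\<^sub>R cvec \<theta> S y"
proof -
  obtain x1 x2 x3 y1 y2 y3 where "x = (x1, x2, x3)" "y = (y1, y2, y3)" by (metis surj_pair)
  then show ?thesis by (cases S) (simp add: zval_zmul[OF assms] algebra_simps)
qed

lemma cvec_cneg: "cvec \<theta> S (cneg x) = - cvec \<theta> S x"
proof -
  obtain x1 x2 x3 where "x = (x1, x2, x3)" by (metis surj_pair)
  then show ?thesis by (cases S) simp
qed

lemma signed_index_correct:
  assumes "signed_index ds c n = (e, k)" "k < n + length ds"
  shows "n \<le> k \<and> c = (if e then ds ! (k - n) else cneg (ds ! (k - n)))"
  using assms
proof (induction ds arbitrary: n)
  case (Cons d ds)
  consider "c = d" | "c \<noteq> d" "c = cneg d" | "c \<noteq> d" "c \<noteq> cneg d" by blast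
  then show ?case
  proof cases
    case 3
    then have "signed_index ds c (Suc n) = (e, k)" "k < Suc n + length ds" using Cons.prems by auto
    from Cons.IH[OF this] show ?thesis by (auto simp: nth_Cons')
  qed (use Cons.prems in auto)
qed simp

lemma root_table_nth:
  assumes "i < length L" "j < length L"
  shows "grams (root_table D ab L W) ! i ! j = gram_form D ab (L ! i) (L ! j)"
    and "refls (root_table D ab L W) ! i ! j =
      signed_index L (refl_form D (gram_form D ab (L ! i) (L ! j)) (L ! i) (L ! j)) 0"
  using assms by (simp_all add: root_table_def)

lemma root_table_simps [simp]: "ring (root_table D ab L W) = D" "periods (root_table D ab L W) = W"
  by (simp_all add: root_table_def)

context
  fixes D :: "int \<times> int" and \<theta> :: real and ab :: "zq \<times> zq" and L :: "coords list"
  assumes quad: "quadratic_irrational D \<theta>" and L: "positive_roots D ab L"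
begin

lemma table_reflection:
  assumes "simple_system \<theta> ab S" "i < length L" "j < length L"
  shows "root_vector \<theta> L S i - (root_vector \<theta> L S i \<bullet> root_vector \<theta> L S j) *\<^sub>R root_vector \<theta> L S j = rvec (root_vector \<theta> L S) (refls (root_table D ab L W) ! i ! j)"
    and "snd (refls (root_table D ab L W) ! i ! j) < length L"
proof -
  have eq: "refls (root_table D ab L W) = refls (root_table D ab L [])" by (simp add: root_table_def)
  show lt: "snd (refls (root_table D ab L W) ! i ! j) < length L"
    using L assms(2,3) unfolding eq by (simp add: positive_roots_def list_all_length root_table_def)
  obtain e k where ek: "refls (root_table D ab L W) ! i ! j = (e, k)" by fastforce
  have "signed_index L (refl_form D (gram_form D ab (L ! i) (L ! j)) (L ! i) (L ! j)) 0 = (e, k)" "k < 0 + length L"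
    using ek lt root_table_nth(2)[OF assms(2,3)] by auto
  from signed_index_correct[OF this]
  have r: "refl_form D (gram_form D ab (L ! i) (L ! j)) (L ! i) (L ! j) = (if e then L ! k else cneg (L ! k))" by simp
  have "cvec \<theta> S (if e then L ! k else cneg (L ! k)) = root_vector \<theta> L S i - (root_vector \<theta> L S i \<bullet> root_vector \<theta> L S j) *\<^sub>R root_vector \<theta> L S j"
    unfolding r[symmetric] cvec_refl_form[OF quad] cvec_inner[OF quad assms(1)] by (rule refl)
  then show "root_vector \<theta> L S i - (root_vector \<theta> L S i \<bullet> root_vector \<theta> L S j) *\<^sub>R root_vector \<theta> L S j = rvec (root_vector \<theta> L S) (refls (root_table D ab L W) ! i ! j)"
    by (simp add: ek cvec_cneg split: if_splits)
qed

lemma simple_roots: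
  shows "3 \<le> length L" "L ! 0 = ((1, 0), (0, 0), (0, 0))" "L ! 1 = ((0, 0), (1, 0), (0, 0))" "L ! 2 = ((0, 0), (0, 0), (1, 0))"
proof -
  obtain L' where "L = take 3 L @ L'" by (metis append_take_drop_id)
  then have "L = [((1, 0), (0, 0), (0, 0)), ((0, 0), (1, 0), (0, 0)), ((0, 0), (0, 0), (1, 0))] @ L'"
    using L unfolding positive_roots_def by metis
  then show "3 \<le> length L" "L ! 0 = ((1, 0), (0, 0), (0, 0))" "L ! 1 = ((0, 0), (1, 0), (0, 0))" "L ! 2 = ((0, 0), (0, 0), (1, 0))"
    by (auto simp: numeral_eq_Suc)
qed

lemma root_norm: "simple_system \<theta> ab S \<Longrightarrow> i < length L \<Longrightarrow> root_vector \<theta> L S i \<bullet> root_vector \<theta> L S i = 2"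
  using L cvec_inner[OF quad] by (simp add: positive_roots_def list_all_length)

lemma root_set_uminus: "w \<in> root_set \<theta> L S \<Longrightarrow> - w \<in> root_set \<theta> L S"
proof -
  assume "w \<in> root_set \<theta> L S"
  then obtain s i where "i < length L" "w = rvec (root_vector \<theta> L S) (s, i)" by (auto simp: root_set_def)
  then have "- w = rvec (root_vector \<theta> L S) (\<not> s, i)" by simp
  then show ?thesis using \<open>i < length L\<close> unfolding root_set_def by (metis (mono_tags, lifting) image_eqI mem_Collect_eq snd_conv)
qed

lemma root_set_reflect:
  assumes S: "simple_system \<theta> ab S" and v: "v \<in> root_set \<theta> L S" and w: "w \<in> root_set \<theta> L S"
  shows "v - (v \<bullet> w) *\<^sub>R w \<in> root_set \<theta> L S"
proof -
  obtain s i t j where v': "i < length L" "v = rvec (root_vector \<theta> L S) (s, i)" and w': "j < length L" "w = rvec (root_vector \<theta> L S) (t, j)"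
    using v w by (auto simp: root_set_def)
  define r where "r = refls (root_table D ab L []) ! i ! j"
  have "rvec (root_vector \<theta> L S) r \<in> root_set \<theta> L S"
    using table_reflection(2)[OF S v'(1) w'(1)] unfolding root_set_def r_def by blast
  moreover have "v - (v \<bullet> w) *\<^sub>R w = (if s then rvec (root_vector \<theta> L S) r else - rvec (root_vector \<theta> L S) r)"
    using table_reflection(1)[OF S v'(1) w'(1)] unfolding r_def v' w' by simp
  ultimately show ?thesis using root_set_uminus by simp
qed

lemma finite_root_set: "finite (root_set \<theta> L S)"
proof -
  have "root_set \<theta> L S = rvec (root_vector \<theta> L S) ` (UNIV \<times> {..<length L})" by (auto simp: root_set_def)
  then show ?thesis by simp
qed

lemma root_set_nonzero: "simple_system \<theta> ab S \<Longrightarrow> w \<in> root_set \<theta> L S \<Longrightarrow> w \<bullet> w = 2"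
  using root_norm[of S] by (auto simp: root_set_def)

lemma simple_in_root_set:
  "a \<in> root_set \<theta> L (a, b, c)" "b \<in> root_set \<theta> L (a, b, c)" "c \<in> root_set \<theta> L (a, b, c)"
proof -
  have "rvec (root_vector \<theta> L (a, b, c)) (True, i) \<in> root_set \<theta> L (a, b, c)" if "i < 3" for i
    using simple_roots(1) that unfolding root_set_def by (intro imageI) simp
  from this[of 0] this[of 1] this[of 2]
  show "a \<in> root_set \<theta> L (a, b, c)" "b \<in> root_set \<theta> L (a, b, c)" "c \<in> root_set \<theta> L (a, b, c)"
    by (simp_all add: simple_roots(2-4) del: One_nat_def)
qed

text \<open>
  Mutation negates vectors and reflects them in one another, and the root set is closed under
  both.
\<close>

lemma occurring_subset_root_set:
  assumes S: "simple_system \<theta> ab S" and s: "range (fst s) \<subseteq> root_set \<theta> L S"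
  shows "occurring_vectors u s \<subseteq> root_set \<theta> L S"
proof -
  have "fst t k \<in> root_set \<theta> L S" if "t \<in> mutation_class u s" for t k
    using that
  proof (induction arbitrary: k)
    case start then show ?case using s by auto
  next
    case (step t k')
    then show ?case
      using root_set_uminus root_set_reflect[OF S] by (auto simp: mutate_def mutate_vectors_def Let_def)
  qed
  then show ?thesis by (auto simp: occurring_vectors_def)
qed

definition reflect :: "real^3 \<Rightarrow> real^3 \<Rightarrow> real^3" where
  "reflect w v = v - (v \<bullet> w) *\<^sub>R w"

lemma reflect_inner: "w \<bullet> w = 2 \<Longrightarrow> reflect w x \<bullet> reflect w y = x \<bullet> y"
  by (simp add: reflect_def inner_diff_left inner_diff_right inner_commute algebra_simps)

lemma reflect_reflect: "w \<bullet> w = 2 \<Longrightarrow> reflect w (reflect w x) = x"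
  by (simp add: reflect_def inner_diff_left algebra_simps)

lemma reflect_cvec:
  "cvec \<theta> (reflect w a, reflect w b, reflect w c) x = reflect w (cvec \<theta> (a, b, c) x)"
  by (cases x) (simp add: reflect_def inner_add_left algebra_simps)

text \<open>
  A reflection in a root is an isometry permuting the roots, so it carries simple systems to
  simple systems of the same root set.
\<close>

lemma reflect_system:
  assumes S: "simple_system \<theta> ab (a, b, c)" and w: "w \<in> root_set \<theta> L (a, b, c)"
  shows "simple_system \<theta> ab (reflect w a, reflect w b, reflect w c)"
    and "root_set \<theta> L (reflect w a, reflect w b, reflect w c) = root_set \<theta> L (a, b, c)"
proof -
  have w2: "w \<bullet> w = 2" using root_set_nonzero[OF S w] .
  show "simple_system \<theta> ab (reflect w a, reflect w b, reflect w c)"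
    using S by (cases ab) (simp add: reflect_inner[OF w2])
  let ?S = "(a, b, c)" and ?T = "(reflect w a, reflect w b, reflect w c)"
  have "rvec (root_vector \<theta> L ?T) r = reflect w (rvec (root_vector \<theta> L ?S) r)" for r
    by (cases r) (simp add: reflect_cvec del: cvec.simps, simp add: reflect_def)
  then have T: "root_set \<theta> L ?T = reflect w ` root_set \<theta> L ?S" unfolding root_set_def image_image by simp
  have sub: "reflect w x \<in> root_set \<theta> L ?S" if "x \<in> root_set \<theta> L ?S" for x
    using root_set_reflect[OF S that w] by (simp add: reflect_def)
  show "root_set \<theta> L ?T = root_set \<theta> L ?S"
    unfolding T using sub reflect_reflect[OF w2] by (metis (no_types, lifting) image_iff subsetI subset_antisym)
qed

lemma nonneg_zval: "0 \<le> \<theta> \<Longrightarrow> 0 \<le> a \<Longrightarrow> 0 \<le> b \<Longrightarrow> 0 \<le> zval \<theta> (a, b)"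
  by (simp add: zval_def)

text \<open>
  Among the finitely many simple systems of the root set take one for which the vector having
  product one with each simple root has the least product with \<open>u\<close>. Reflecting in a simple root
  \<open>w\<close> lowers this value by \<open>w \<bullet> u\<close>, which minimality forces to be negative. All other roots of
  the table are nonnegative combinations of the simple ones.
\<close>

lemma chamber_exists:
  assumes \<theta>: "0 \<le> \<theta>" and pos: "(zval \<theta> (fst ab))\<^sup>2 + (zval \<theta> (snd ab))\<^sup>2 < 4"
    and S0: "simple_system \<theta> ab S0" and u: "norm u = 1" "\<And>w. w \<in> root_set \<theta> L S0 \<Longrightarrow> w \<bullet> u \<noteq> 0"
    and W: "\<And>w n. (w, n) \<in> set W \<Longrightarrow> \<exists>p q :: nat. p \<ge> 1 \<and> q \<ge> 1 \<and> coprime p q \<and> 2 * p \<le> q \<and>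
        zval \<theta> w = 2 * cos (pi * real p / real q) \<and> n = q + 2 * p"
  shows "\<exists>S. simple_system \<theta> ab S \<and> root_set \<theta> L S = root_set \<theta> L S0 \<and>
    root_chamber (root_table D ab L W) \<theta> (length L) (root_vector \<theta> L S) u"
proof -
  obtain \<alpha> \<beta> where ab: "ab = (\<alpha>, \<beta>)" by (cases ab)
  define A B where "A = zval \<theta> \<alpha>" and "B = zval \<theta> \<beta>"
  have AB: "A\<^sup>2 + B\<^sup>2 < 4" using pos by (simp add: ab A_def B_def)
  \<comment> \<open>coordinates of the vector that has product one with each simple root\<close>
  define y where "y = (2 + A + B) / (4 - (A\<^sup>2 + B\<^sup>2))"
  define x where "x = (1 + A * y) / 2"
  define z where "z = (1 + B * y) / 2"
  have y: "y * (4 - (A\<^sup>2 + B\<^sup>2)) = 2 + A + B" using AB by (simp add: y_def)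
  have xyz: "2 * x - A * y = 1" "2 * y - A * x - B * z = 1" "2 * z - B * y = 1"
    using y by (auto simp: x_def z_def power2_eq_square field_simps)
  define F where "F = {S. simple_system \<theta> ab S \<and> root_set \<theta> L S = root_set \<theta> L S0}"
  define h where "h S = (case S of (a, b, c) \<Rightarrow> (x *\<^sub>R a + y *\<^sub>R b + z *\<^sub>R c) \<bullet> u)" for S
  have "F \<subseteq> root_set \<theta> L S0 \<times> root_set \<theta> L S0 \<times> root_set \<theta> L S0"
    using simple_in_root_set by (fastforce simp: F_def)
  then have "finite F" using finite_root_set finite_subset by (metis finite_SigmaI)
  moreover have "F \<noteq> {}" using S0 unfolding F_def by blast
  ultimately obtain S where S: "S \<in> F" "\<And>T. T \<in> F \<Longrightarrow> h S \<le> h T"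
    using ex_is_arg_min_if_finite[of F h] by (auto simp: is_arg_min_linorder)
  obtain a b c where abc: "S = (a, b, c)" by (cases S)
  have sys: "simple_system \<theta> ab (a, b, c)" and rs: "root_set \<theta> L (a, b, c) = root_set \<theta> L S0"
    using S(1) by (auto simp: F_def abc)
  have neg: "w \<bullet> u < 0" if w: "w \<in> root_set \<theta> L (a, b, c)" "(x *\<^sub>R a + y *\<^sub>R b + z *\<^sub>R c) \<bullet> w = 1" for w
  proof -
    have "(reflect w a, reflect w b, reflect w c) \<in> F"
      using reflect_system[OF sys w(1)] rs by (simp add: F_def)
    then have "h S \<le> h (reflect w a, reflect w b, reflect w c)" using S(2) by blast
    also have "\<dots> = reflect w (x *\<^sub>R a + y *\<^sub>R b + z *\<^sub>R c) \<bullet> u"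
      by (simp add: h_def reflect_def inner_add_left inner_diff_left algebra_simps)
    also have "\<dots> = h S - w \<bullet> u"
      unfolding reflect_def w(2) by (simp add: h_def abc inner_diff_left)
    finally show ?thesis using u(2)[of w] w(1) rs by force
  qed
  have com: "b \<bullet> a = a \<bullet> b" "c \<bullet> b = b \<bullet> c" "c \<bullet> a = a \<bullet> c" by (simp_all add: inner_commute)
  have g: "a \<bullet> a = 2" "b \<bullet> b = 2" "c \<bullet> c = 2" "a \<bullet> b = - A" "b \<bullet> c = - B" "a \<bullet> c = 0"
    using sys by (simp_all add: ab A_def B_def)
  have nabc: "a \<bullet> u < 0" "b \<bullet> u < 0" "c \<bullet> u < 0"
    using xyz by (auto intro!: neg simple_in_root_set simp: inner_add_left com g algebra_simps)
  have lin: "X = 0 \<and> Y = 0 \<and> Z = 0" if "X *\<^sub>R a + Y *\<^sub>R b + Z *\<^sub>R c = 0" for X Y Z :: real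
  proof -
    have "(X *\<^sub>R a + Y *\<^sub>R b + Z *\<^sub>R c) \<bullet> v = 0" for v using that by simp
    from this[of a] this[of b] this[of c]
    have e: "2 * X = A * Y" "2 * Y = A * X + B * Z" "2 * Z = B * Y"
      by (auto simp: inner_add_left com g algebra_simps)
    have "4 * Y = A * (2 * X) + B * (2 * Z)" using e(2) by (simp add: algebra_simps)
    also have "\<dots> = (A\<^sup>2 + B\<^sup>2) * Y" unfolding e(1,3) by (simp add: power2_eq_square algebra_simps)
    finally have "Y = 0" using AB by simp
    then show ?thesis using e by simp
  qed
  have "root_chamber (root_table D ab L W) \<theta> (length L) (root_vector \<theta> L S) u"
  proof
    fix i j assume ij: "i < length L" "j < length L"
    show "root_vector \<theta> L S i - (root_vector \<theta> L S i \<bullet> root_vector \<theta> L S j) *\<^sub>R root_vector \<theta> L S j = rvec (root_vector \<theta> L S) (refls (root_table D ab L W) ! i ! j)"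
      "snd (refls (root_table D ab L W) ! i ! j) < length L"
      using table_reflection ij sys abc by auto
    show "root_vector \<theta> L S i \<bullet> root_vector \<theta> L S j = zval \<theta> (grams (root_table D ab L W) ! i ! j)"
      using cvec_inner[OF quad sys] ij by (simp add: abc root_table_nth)
    assume eq: "root_vector \<theta> L S i = root_vector \<theta> L S j"
    obtain p q r p' q' r' where c: "L ! i = (p, q, r)" "L ! j = (p', q', r')" by (metis surj_pair)
    have "(zval \<theta> p - zval \<theta> p') *\<^sub>R a + (zval \<theta> q - zval \<theta> q') *\<^sub>R b + (zval \<theta> r - zval \<theta> r') *\<^sub>R c = 0"
      using eq by (simp add: abc c algebra_simps)
    then have "L ! i = L ! j" using lin zval_eq_iff[OF quad] c by (metis eq_iff_diff_eq_0)
    then show "i = j" using L ij by (simp add: positive_roots_def nth_eq_iff_index_eq)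
  next
    fix i assume i: "i < length L"
    show "root_vector \<theta> L S i \<bullet> root_vector \<theta> L S i = 2" using root_norm sys i abc by simp
    obtain p q r where c: "L ! i = (p, q, r)" by (cases "L ! i")
    obtain p1 p2 q1 q2 r1 r2 where pqr: "p = (p1, p2)" "q = (q1, q2)" "r = (r1, r2)" by (metis surj_pair)
    have "nonneg_coords (p, q, r)" using L i c unfolding positive_roots_def list_all_length by metis
    then have nn: "0 \<le> zval \<theta> p" "0 \<le> zval \<theta> q" "0 \<le> zval \<theta> r"
      using nonneg_zval[OF \<theta>] by (auto simp: pqr)
    have le: "zval \<theta> p * (a \<bullet> u) \<le> 0" "zval \<theta> q * (b \<bullet> u) \<le> 0" "zval \<theta> r * (c \<bullet> u) \<le> 0"
      using nn nabc by (auto intro: mult_nonneg_nonpos)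
    have "root_vector \<theta> L S i \<noteq> 0" using root_norm sys i abc by force
    then have "\<not> (zval \<theta> p = 0 \<and> zval \<theta> q = 0 \<and> zval \<theta> r = 0)" by (auto simp: abc c)
    then have "zval \<theta> p * (a \<bullet> u) < 0 \<or> zval \<theta> q * (b \<bullet> u) < 0 \<or> zval \<theta> r * (c \<bullet> u) < 0"
      using nn nabc by (auto simp: mult_less_0_iff)
    then show "root_vector \<theta> L S i \<bullet> u < 0" using le by (auto simp: abc c inner_add_left)
  next
    show "quadratic_irrational (ring (root_table D ab L W)) \<theta>" using quad by simp
    show "norm u = 1" by fact
    fix w n assume "(w, n) \<in> set (periods (root_table D ab L W))"
    then show "\<exists>p q :: nat. p \<ge> 1 \<and> q \<ge> 1 \<and> coprime p q \<and> 2 * p \<le> q \<and>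
        zval \<theta> w = 2 * cos (pi * real p / real q) \<and> n = q + 2 * p" using W by simp
  qed
  then show ?thesis using sys rs abc by blast
qed

end

section \<open>Moving the reference point off all mirrors\<close>

text \<open>
  Near \<open>u\<close> no nonzero product changes its sign, and an open set is not covered by finitely many
  planes.
\<close>

lemma generic_reference_point:
  fixes W :: "(real^3) set"
  assumes "finite W" "0 \<notin> W" "norm u = 1"
  shows "\<exists>u'. norm u' = 1 \<and> (\<forall>w\<in>W. w \<bullet> u' \<noteq> 0) \<and> (\<forall>w\<in>W. w \<bullet> u \<noteq> 0 \<longrightarrow> (w \<bullet> u' < 0 \<longleftrightarrow> w \<bullet> u < 0))"
proof -
  \<comment> \<open>the first halfspace keeps \<open>0\<close> out, so that points can be scaled back to the sphere\<close>
  define O' where "O' = {x. 0 < u \<bullet> x} \<inter> (\<Inter>w\<in>{w\<in>W. w \<bullet> u < 0}. {x. w \<bullet> x < 0}) \<inter> (\<Inter>w\<in>{w\<in>W. 0 < w \<bullet> u}. {x. 0 < w \<bullet> x})"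
  have "open O'" unfolding O'_def using assms(1)
    by (intro open_Int open_INT) (auto simp: open_halfspace_lt open_halfspace_gt)
  moreover have "u \<bullet> u = 1" using assms(3) by (simp add: dot_square_norm)
  then have "u \<in> O'" by (auto simp: O'_def)
  ultimately have "\<not> negligible O'" using open_not_negligible by blast
  moreover have "negligible (\<Union>w\<in>W. {x. w \<bullet> x = 0})"
    using assms(1,2) by (intro negligible_Union) (auto intro!: negligible_hyperplane)
  ultimately obtain x where x: "x \<in> O'" "\<And>w. w \<in> W \<Longrightarrow> w \<bullet> x \<noteq> 0"
    using negligible_subset by (metis (mono_tags, lifting) UN_I mem_Collect_eq subsetI)
  have "x \<noteq> 0" using x(1) by (auto simp: O'_def)
  define u' where "u' = x /\<^sub>R norm x"
  have "norm u' = 1" using \<open>x \<noteq> 0\<close> by (simp add: u'_def)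
  moreover have "w \<bullet> u' = (w \<bullet> x) / norm x" for w by (simp add: u'_def field_simps)
  moreover have "w \<bullet> x < 0 \<longleftrightarrow> w \<bullet> u < 0" if "w \<in> W" "w \<bullet> u \<noteq> 0" for w
    using x(1) that by (cases "w \<bullet> u < 0") (force simp: O'_def)+
  ultimately show ?thesis using x(2) \<open>x \<noteq> 0\<close> by (intro exI[of _ u']) (auto simp: divide_less_0_iff)
qed

lemma same_side_generic:
  assumes "norm u = 1" "norm u' = 1" "X \<subseteq> W"
    and "\<And>w. w \<in> W \<Longrightarrow> w \<bullet> u' \<noteq> 0" "\<And>w. w \<in> W \<Longrightarrow> w \<bullet> u \<noteq> 0 \<Longrightarrow> w \<bullet> u' < 0 \<longleftrightarrow> w \<bullet> u < 0"
    and "\<And>w. w \<in> X \<Longrightarrow> w \<bullet> u \<noteq> 0"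
  shows "same_side u u' X"
  using assms by (auto simp: same_side_def)

section \<open>Acyclic matrices of size three\<close>

definition skew :: "real^'n^'n \<Rightarrow> bool" where
  "skew B \<longleftrightarrow> (\<forall>i j. B $ i $ j + B $ j $ i = 0)"

text \<open>
  On three vertices a closed walk without loops and two-cycles contains a triangle.
\<close>

lemma acyclic_matrix_3:
  fixes B :: "real^3^3"
  assumes "skew B"
  shows "acyclic_matrix B \<longleftrightarrow> (\<forall>i j k. \<not> (B $ i $ j > 0 \<and> B $ j $ k > 0 \<and> B $ k $ i > 0))"
proof -
  define r where "r = {(i, j). B $ i $ j > 0}"
  have anti: "(i, j) \<in> r \<Longrightarrow> (j, i) \<notin> r" for i j
    using assms by (auto simp: r_def skew_def) (metis add_pos_pos less_irrefl)
  then have irr: "(i, i) \<notin> r" for i by blast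
  have "acyclic r \<longleftrightarrow> (\<forall>i j k. \<not> ((i, j) \<in> r \<and> (j, k) \<in> r \<and> (k, i) \<in> r))"
  proof
    assume "acyclic r"
    then show "\<forall>i j k. \<not> ((i, j) \<in> r \<and> (j, k) \<in> r \<and> (k, i) \<in> r)"
      by (meson acyclic_def r_into_trancl trancl.trancl_into_trancl)
  next
    assume no3: "\<forall>i j k. \<not> ((i, j) \<in> r \<and> (j, k) \<in> r \<and> (k, i) \<in> r)"
    have path: "(i, j) \<in> r \<or> (\<exists>k. (i, k) \<in> r \<and> (k, j) \<in> r)" if "(i, j) \<in> r\<^sup>+" for i j
      using that
    proof induction
      case (step j l)
      then show ?case
      proof (elim disjE exE conjE)
        fix k assume "(i, k) \<in> r" "(k, j) \<in> r" "(j, l) \<in> r"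
        then have "l \<noteq> i" "l \<noteq> k" "l \<noteq> j" "i \<noteq> k" "k \<noteq> j" "i \<noteq> j" using no3 anti irr by blast+
        then show ?thesis using exhaust_3[of i] exhaust_3[of j] exhaust_3[of k] exhaust_3[of l] by auto
      qed blast
    qed blast
    show "acyclic r" unfolding acyclic_def using path anti irr by blast
  qed
  then show ?thesis by (simp add: acyclic_matrix_def r_def)
qed

lemma acyclic_matrix_entries:
  fixes B :: "real^3^3"
  assumes "skew B"
  shows "acyclic_matrix B \<longleftrightarrow> \<not> (B $ 1 $ 2 > 0 \<and> B $ 2 $ 3 > 0 \<and> B $ 1 $ 3 < 0) \<and>
    \<not> (B $ 1 $ 2 < 0 \<and> B $ 2 $ 3 < 0 \<and> B $ 1 $ 3 > 0)"
proof -
  have "B $ 1 $ 1 = 0" "B $ 2 $ 2 = 0" "B $ 3 $ 3 = 0" using assms unfolding skew_def by (metis double_zero)+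
  moreover have "B $ 2 $ 1 = - B $ 1 $ 2" "B $ 3 $ 1 = - B $ 1 $ 3" "B $ 3 $ 2 = - B $ 2 $ 3"
    using assms by (simp_all add: skew_def eq_neg_iff_add_eq_0)
  ultimately show ?thesis unfolding acyclic_matrix_3[OF assms] forall_3 by auto
qed

lemma skew_reindex: "skew (snd s) \<Longrightarrow> skew (snd (reindex \<pi> s))"
  by (simp add: skew_def reindex_def)

lemma acyclic_reindex:
  fixes s :: "3 seed" and \<pi> :: "3 \<Rightarrow> 3"
  assumes "skew (snd s)" "bij \<pi>"
  shows "acyclic_matrix (snd (reindex \<pi> s)) \<longleftrightarrow> acyclic_matrix (snd s)"
proof -
  have all: "(\<forall>i j k. Q (\<pi> i) (\<pi> j) (\<pi> k)) \<longleftrightarrow> (\<forall>i j k. Q i j k)" for Q :: "3 \<Rightarrow> 3 \<Rightarrow> 3 \<Rightarrow> bool"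
  proof (intro iffI allI)
    fix i j k assume *: "\<forall>i j k. Q (\<pi> i) (\<pi> j) (\<pi> k)"
    have "\<pi> (inv \<pi> x) = x" for x using assms(2) by (simp add: bij_is_surj surj_f_inv_f)
    then show "Q i j k" using *[rule_format, of "inv \<pi> i" "inv \<pi> j" "inv \<pi> k"] by simp
  qed blast
  show ?thesis
    unfolding acyclic_matrix_3[OF assms(1)] acyclic_matrix_3[OF skew_reindex[OF assms(1), of \<pi>]]
    using all[of "\<lambda>i j k. \<not> (0 < snd s $ i $ j \<and> 0 < snd s $ j $ k \<and> 0 < snd s $ k $ i)"]
    by (simp add: reindex_def)
qed

section \<open>Gram matrices along a mutation class\<close>

definition gram_product :: "3 seed \<Rightarrow> real" where
  "gram_product s = (fst s 1 \<bullet> fst s 2) * (fst s 1 \<bullet> fst s 3) * (fst s 2 \<bullet> fst s 3)"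

text \<open>
  Up to an affine map this is the determinant of the Gram matrix: for vectors of square norm two
  the determinant equals \<open>8 - 2 * gram_constant s\<close>.
\<close>

definition gram_constant :: "3 seed \<Rightarrow> real" where
  "gram_constant s = (fst s 1 \<bullet> fst s 2)\<^sup>2 + (fst s 1 \<bullet> fst s 3)\<^sup>2 + (fst s 2 \<bullet> fst s 3)\<^sup>2 - gram_product s"

text \<open>
  The parity condition in the definition of a realisation, restated as a sign of the product of
  the three inner products: the number of positive ones is even exactly if the product is
  negative. In this form it needs no exception for vanishing products.
\<close>

definition balanced :: "3 seed \<Rightarrow> bool" where
  "balanced s \<longleftrightarrow> normalised s \<and> (\<forall>i j. i \<noteq> j \<longrightarrow> \<bar>fst s i \<bullet> fst s j\<bar> = \<bar>snd s $ i $ j\<bar>) \<and>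
     (if acyclic_matrix (snd s) then gram_product s \<le> 0 else 0 \<le> gram_product s)"

lemma normalised_skew: "normalised s \<Longrightarrow> skew (snd s)"
  by (simp add: normalised_def skew_def)

lemma balanced_entries:
  fixes s :: "3 seed"
  assumes "normalised s"
  shows "(\<forall>i j. i \<noteq> j \<longrightarrow> \<bar>fst s i \<bullet> fst s j\<bar> = \<bar>snd s $ i $ j\<bar>) \<longleftrightarrow>
     \<bar>fst s 1 \<bullet> fst s 2\<bar> = \<bar>snd s $ 1 $ 2\<bar> \<and> \<bar>fst s 1 \<bullet> fst s 3\<bar> = \<bar>snd s $ 1 $ 3\<bar> \<and> \<bar>fst s 2 \<bullet> fst s 3\<bar> = \<bar>snd s $ 2 $ 3\<bar>"
proof -
  have "snd s $ 2 $ 1 = - snd s $ 1 $ 2" "snd s $ 3 $ 1 = - snd s $ 1 $ 3" "snd s $ 3 $ 2 = - snd s $ 2 $ 3"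
    using assms by (simp_all add: normalised_def eq_neg_iff_add_eq_0)
  then show ?thesis by (auto simp: forall_3 inner_commute)
qed

text \<open>
  The only nontrivial step of a mutation at the first index, after normalising signs: \<open>p\<close> is the
  absolute value of the product of the entries joining the first index with the other two, \<open>z\<close>
  the third entry, and \<open>P\<close>, \<open>gz\<close> are the corresponding inner products. The sign rule makes \<open>P *
  gz\<close> and \<open>p * z\<close> equal, and then \<open>(gz - P)\<^sup>2 = (z - p)\<^sup>2\<close> by expansion.
\<close>

lemma gram_step:
  fixes p P z gz :: real
  assumes p: "\<bar>P\<bar> = p" "\<bar>gz\<bar> = \<bar>z\<bar>" and s: "if 0 < z then 0 \<le> P * gz else P * gz \<le> 0"
  shows "\<bar>gz - P\<bar> = \<bar>z - p\<bar>" and "P * (gz - P) = p * (z - p)"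
proof -
  have sq: "P\<^sup>2 = p\<^sup>2" "gz\<^sup>2 = z\<^sup>2" using p by (metis power2_abs)+
  have "\<bar>P * gz\<bar> = p * \<bar>z\<bar>" using p by (simp add: abs_mult)
  then have Pg: "P * gz = p * z" using s by (auto split: if_splits)
  have "(gz - P)\<^sup>2 = (z - p)\<^sup>2" using sq Pg by (simp add: power2_eq_square algebra_simps)
  then show "\<bar>gz - P\<bar> = \<bar>z - p\<bar>" by (metis power2_eq_iff_nonneg abs_ge_zero power2_abs)
  show "P * (gz - P) = p * (z - p)" using sq Pg by (simp add: power2_eq_square algebra_simps)
qed

text \<open>
  If the first index is not the middle of a path of arrows, neither the third entry nor the
  third inner product changes, up to signs that cancel. If it is, exactly one of the other two
  vectors is reflected and \<open>gram_step\<close> applies. The constant is preserved since, up to the sign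
  of the reversed vector, \<open>gz\<close> and \<open>gx * gy - gz\<close> are the two roots of one quadratic equation.
\<close>

lemma balanced_mutate_first:
  assumes s: "balanced s" and u: "positive_vector u (fst s 1) \<or> negative_vector u (fst s 1)"
  shows "balanced (mutate u 1 s) \<and> gram_constant (mutate u 1 s) = gram_constant s"
proof -
  define x y z where "x = snd s $ 1 $ 2" and "y = snd s $ 1 $ 3" and "z = snd s $ 2 $ 3"
  define gx gy gz where "gx = fst s 1 \<bullet> fst s 2" and "gy = fst s 1 \<bullet> fst s 3" and "gz = fst s 2 \<bullet> fst s 3"
  have n: "normalised s" using s by (simp add: balanced_def)
  let ?t = "mutate u 1 s"
  have nt: "normalised ?t" using normalised_mutate[OF n] .
  have B: "snd s $ 2 $ 1 = - x" "snd s $ 3 $ 1 = - y" "snd s $ 3 $ 2 = - z"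
    using n by (simp_all add: normalised_def eq_neg_iff_add_eq_0 x_def y_def z_def)
  have ab: "\<bar>gx\<bar> = \<bar>x\<bar>" "\<bar>gy\<bar> = \<bar>y\<bar>" "\<bar>gz\<bar> = \<bar>z\<bar>"
    using s by (auto simp: balanced_def gx_def gy_def gz_def x_def y_def z_def)
  have cyc: "if \<not> (0 < x \<and> 0 < z \<and> y < 0) \<and> \<not> (x < 0 \<and> z < 0 \<and> 0 < y) then gx * gy * gz \<le> 0 else 0 \<le> gx * gy * gz"
  proof -
    have "if acyclic_matrix (snd s) then gx * gy * gz \<le> 0 else 0 \<le> gx * gy * gz"
      using s unfolding balanced_def gram_product_def gx_def gy_def gz_def by blast
    then show ?thesis by (simp only: acyclic_matrix_entries[OF normalised_skew[OF n]] x_def y_def z_def)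
  qed
  define z' where "z' = z + (\<bar>x\<bar> * y - x * \<bar>y\<bar>) / 2"
  have t: "snd ?t $ 1 $ 2 = - x" "snd ?t $ 1 $ 3 = - y" "snd ?t $ 2 $ 3 = z'"
    using B by (simp_all add: mutate_def mutate_matrix_def x_def y_def z_def z'_def)
  have ac: "acyclic_matrix (snd ?t) \<longleftrightarrow> \<not> (x < 0 \<and> 0 < z' \<and> 0 < y) \<and> \<not> (0 < x \<and> z' < 0 \<and> y < 0)"
    unfolding acyclic_matrix_entries[OF normalised_skew[OF nt]] t by auto
  define ps where "ps \<longleftrightarrow> positive_vector u (fst s 1)"
  have neg: "negative_vector u (fst s 1) \<longleftrightarrow> \<not> ps"
    using u by (auto simp: ps_def positive_vector_def negative_vector_def hemisphere_def)
  have N: "fst s i \<bullet> fst s i = 2" for i using n by (simp add: normalised_def)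
  have com: "fst s 2 \<bullet> fst s 1 = gx" "fst s 3 \<bullet> fst s 1 = gy" "fst s 3 \<bullet> fst s 2 = gz"
    by (simp_all add: gx_def gy_def gz_def inner_commute)
  \<comment> \<open>whether the second and the third vector are reflected\<close>
  define r2 r3 where "r2 \<longleftrightarrow> ps \<and> 0 < x \<or> \<not> ps \<and> x < 0" and "r3 \<longleftrightarrow> ps \<and> 0 < y \<or> \<not> ps \<and> y < 0"
  have v: "fst ?t 1 = - fst s 1" "fst ?t 2 = (if r2 then fst s 2 - gx *\<^sub>R fst s 1 else fst s 2)"
    "fst ?t 3 = (if r3 then fst s 3 - gy *\<^sub>R fst s 1 else fst s 3)"
    using B by (auto simp: mutate_def mutate_vectors_def Let_def neg com r2_def r3_def simp flip: ps_def)
  have g: "fst ?t 1 \<bullet> fst ?t 2 = (if r2 then gx else - gx)" "fst ?t 1 \<bullet> fst ?t 3 = (if r3 then gy else - gy)"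
    "fst ?t 2 \<bullet> fst ?t 3 = (if r2 = r3 then gz else gz - gx * gy)"
    unfolding v by (auto simp: inner_diff_right inner_diff_left N com algebra_simps simp flip: gx_def gy_def gz_def)
  have goal: "\<bar>fst ?t 2 \<bullet> fst ?t 3\<bar> = \<bar>z'\<bar> \<and>
      (if \<not> (x < 0 \<and> 0 < z' \<and> 0 < y) \<and> \<not> (0 < x \<and> z' < 0 \<and> y < 0) then gram_product ?t \<le> 0 else 0 \<le> gram_product ?t) \<and>
      gram_product ?t = (if r2 = r3 then gx * gy * gz else - gx * gy * (gz - gx * gy))"
  proof (cases "x * y < 0")
    case True
    then have "(x < 0 \<and> 0 < y) \<or> (0 < x \<and> y < 0)" by (auto simp: mult_less_0_iff)
    then have r: "r2 \<noteq> r3" by (auto simp: r2_def r3_def)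
    have P: "\<bar>gx * gy\<bar> = - (x * y)" using ab True by (simp add: abs_mult) (metis abs_mult abs_of_neg)
    have G: "gram_product ?t = - (gx * gy * (gz - gx * gy))"
      unfolding gram_product_def g using r by auto
    have opp: "0 < - (x * y)" using True by simp
    from \<open>(x < 0 \<and> 0 < y) \<or> (0 < x \<and> y < 0)\<close> show ?thesis
    proof
      assume xy: "0 < x \<and> y < 0"
      then have z': "z' = z - (- (x * y))" by (simp add: z'_def)
      have "if 0 < z then 0 \<le> (gx * gy) * gz else (gx * gy) * gz \<le> 0" using cyc xy by (auto split: if_splits)
      from gram_step[OF P ab(3) this]
      show ?thesis unfolding G g z' using r xy opp
        by (auto simp: mult_le_0_iff zero_le_mult_iff)
    next
      assume xy: "x < 0 \<and> 0 < y"
      then have z': "z' = - (- z - (- (x * y)))" by (simp add: z'_def)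
      have "if 0 < - z then 0 \<le> (gx * gy) * gz else (gx * gy) * gz \<le> 0" using cyc xy by (auto split: if_splits)
      from gram_step[OF P _ this] ab(3)
      have st: "\<bar>gz - gx * gy\<bar> = \<bar>- z - (- (x * y))\<bar>" "gx * gy * (gz - gx * gy) = - (x * y) * (- z - (- (x * y)))" by auto
      show ?thesis unfolding G g z' st using r xy opp st
        by (auto simp: mult_le_0_iff zero_le_mult_iff)
    qed
  next
    case False
    then have z': "z' = z" unfolding z'_def by (cases "x < 0"; cases "y < 0") (auto simp: mult_less_0_iff not_less)
    have r: "r2 = r3 \<or> gx * gy = 0" using False ab by (auto simp: r2_def r3_def mult_less_0_iff not_less)
    have nc: "\<not> (0 < x \<and> 0 < z \<and> y < 0) \<and> \<not> (x < 0 \<and> z < 0 \<and> 0 < y)"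
      "\<not> (x < 0 \<and> 0 < z' \<and> 0 < y) \<and> \<not> (0 < x \<and> z' < 0 \<and> y < 0)"
      using False by (auto simp: mult_less_0_iff)
    have le: "gx * gy * gz \<le> 0" using cyc unfolding if_P[OF nc(1)] .
    have G: "gram_product ?t = gx * gy * gz"
      using r unfolding gram_product_def g by auto
    show ?thesis
    proof (intro conjI)
      show "\<bar>fst ?t 2 \<bullet> fst ?t 3\<bar> = \<bar>z'\<bar>" using r ab(3) unfolding g z' by auto
      show "if \<not> (x < 0 \<and> 0 < z' \<and> 0 < y) \<and> \<not> (0 < x \<and> z' < 0 \<and> y < 0)
          then gram_product ?t \<le> 0 else 0 \<le> gram_product ?t"
        unfolding if_P[OF nc(2)] G by (rule le)
      show "gram_product ?t = (if r2 = r3 then gx * gy * gz else - gx * gy * (gz - gx * gy))"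
        using r G by auto
    qed
  qed
  have "\<bar>fst ?t 1 \<bullet> fst ?t 2\<bar> = \<bar>- x\<bar>" "\<bar>fst ?t 1 \<bullet> fst ?t 3\<bar> = \<bar>- y\<bar>"
    using ab(1,2) unfolding g(1,2) by auto
  then have "balanced ?t"
    using nt conjunct1[OF goal] conjunct1[OF conjunct2[OF goal]]
    unfolding balanced_def balanced_entries[OF nt] t ac by blast
  moreover have "gram_constant ?t = gram_constant s"
  proof -
    have "gram_constant s = gx\<^sup>2 + gy\<^sup>2 + gz\<^sup>2 - gx * gy * gz"
      by (simp add: gram_constant_def gram_product_def gx_def gy_def gz_def)
    moreover have "gram_constant ?t = gx\<^sup>2 + gy\<^sup>2 + (if r2 = r3 then gz else gz - gx * gy)\<^sup>2 - gram_product ?t"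
      unfolding gram_constant_def g by auto
    ultimately show ?thesis
      using conjunct2[OF conjunct2[OF goal]] by (cases "r2 = r3") (simp_all add: power2_eq_square algebra_simps)
  qed
  ultimately show ?thesis by blast
qed

lemma balanced_rot:
  assumes "normalised s"
  shows "balanced (reindex rot3 s) \<longleftrightarrow> balanced s" "gram_constant (reindex rot3 s) = gram_constant s"
proof -
  have v: "fst (reindex rot3 s) 1 = fst s 2" "fst (reindex rot3 s) 2 = fst s 3" "fst (reindex rot3 s) 3 = fst s 1"
    by (simp_all add: reindex_def rot3_def)
  have G: "gram_product (reindex rot3 s) = gram_product s"
    unfolding gram_product_def v by (simp add: inner_commute)
  show "gram_constant (reindex rot3 s) = gram_constant s"
    unfolding gram_constant_def G v by (simp add: inner_commute)
  have nr: "normalised (reindex rot3 s)" using assms by (simp add: normalised_def reindex_def)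
  have e: "snd (reindex rot3 s) $ 1 $ 2 = snd s $ 2 $ 3" "snd (reindex rot3 s) $ 1 $ 3 = snd s $ 2 $ 1"
    "snd (reindex rot3 s) $ 2 $ 3 = snd s $ 3 $ 1" by (simp_all add: reindex_def rot3_def)
  have B: "snd s $ 2 $ 1 = - snd s $ 1 $ 2" "snd s $ 3 $ 1 = - snd s $ 1 $ 3" "snd s $ 3 $ 2 = - snd s $ 2 $ 3"
    using assms by (simp_all add: normalised_def eq_neg_iff_add_eq_0)
  show "balanced (reindex rot3 s) \<longleftrightarrow> balanced s"
    unfolding balanced_def G acyclic_reindex[OF normalised_skew[OF assms] bij_rot3] balanced_entries[OF assms] balanced_entries[OF nr] v e
    using assms nr B by (auto simp: inner_commute)
qed

lemma balanced_mutate: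
  assumes s: "balanced s" and u: "positive_vector u (fst s k) \<or> negative_vector u (fst s k)"
  shows "balanced (mutate u k s) \<and> gram_constant (mutate u k s) = gram_constant s"
proof -
  have rot: "balanced (reindex rot3 r) \<longleftrightarrow> balanced r" "gram_constant (reindex rot3 r) = gram_constant r"
    "normalised (reindex rot3 r)" if "normalised r" for r
    using that balanced_rot by (auto simp: normalised_def reindex_def)
  have n: "normalised s" "normalised (mutate u k s)" using s normalised_mutate unfolding balanced_def by blast+
  have *: "balanced (reindex \<sigma> r) \<longleftrightarrow> balanced r" "gram_constant (reindex \<sigma> r) = gram_constant r"
    if "\<sigma> \<in> {id, rot3, rot3 \<circ> rot3}" "normalised r" for \<sigma> r
    using that(1) rot[OF that(2)] rot[OF rot(3)[OF that(2)]] by (auto simp: reindex_id reindex_comp[symmetric])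
  obtain \<sigma> where \<sigma>: "\<sigma> \<in> {id, rot3, rot3 \<circ> rot3}" "\<sigma> 1 = k" using rotation_exists by blast
  have "mutate u 1 (reindex \<sigma> s) = reindex \<sigma> (mutate u k s)"
    using mutate_reindex[OF bij_is_inj[OF bij_rotations[OF \<sigma>(1)]]] \<sigma>(2) by simp
  moreover have "fst (reindex \<sigma> s) 1 = fst s k" using \<sigma>(2) by (simp add: reindex_def)
  moreover have "balanced (reindex \<sigma> s)" using *(1)[OF \<sigma>(1) n(1)] s by simp
  ultimately show ?thesis
    using balanced_mutate_first[of "reindex \<sigma> s" u] *[OF \<sigma>(1) n(1)] *[OF \<sigma>(1) n(2)] u by simp
qed

lemma balanced_class:
  assumes "balanced s" "reference_point u s" "t \<in> mutation_class u s"
  shows "balanced t \<and> gram_constant t = gram_constant s"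
  using assms(3)
proof induction
  case (step t k)
  then show ?case using balanced_mutate[of t u k] reference_sign[OF assms(2) step.hyps] by simp
qed (use assms(1) in simp)

section \<open>Realisations of a path\<close>

text \<open>
  For positive weights, the path \<open>1 \<rightarrow> 2 \<rightarrow> 3\<close>.
\<close>

definition path_matrix :: "real \<Rightarrow> real \<Rightarrow> real^3^3" where
  "path_matrix x y = vector [vector [0, x, 0], vector [- x, 0, y], vector [0, - y, 0]]"

lemma path_matrix_entries:
  "path_matrix x y $ 1 $ 1 = 0" "path_matrix x y $ 1 $ 2 = x" "path_matrix x y $ 1 $ 3 = 0"
  "path_matrix x y $ 2 $ 1 = - x" "path_matrix x y $ 2 $ 2 = 0" "path_matrix x y $ 2 $ 3 = y"
  "path_matrix x y $ 3 $ 1 = 0" "path_matrix x y $ 3 $ 2 = - y" "path_matrix x y $ 3 $ 3 = 0"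
  by (simp_all add: path_matrix_def)

text \<open>
  One entry of the matrix is zero, so the parity condition is void, and the condition on \<open>x\<close> and
  \<open>y\<close> says that the Gram determinant is positive, whence the vectors form a basis.
\<close>

lemma geometric_realisation_path:
  assumes "x\<^sup>2 + y\<^sup>2 < 4"
  shows "geometric_realisation v (path_matrix x y) \<longleftrightarrow>
     v 1 \<bullet> v 1 = 2 \<and> v 2 \<bullet> v 2 = 2 \<and> v 3 \<bullet> v 3 = 2 \<and>
     \<bar>v 1 \<bullet> v 2\<bar> = \<bar>x\<bar> \<and> \<bar>v 2 \<bullet> v 3\<bar> = \<bar>y\<bar> \<and> v 1 \<bullet> v 3 = 0" (is "_ \<longleftrightarrow> ?G")
proof
  assume "geometric_realisation v (path_matrix x y)"
  then have "\<forall>i. v i \<bullet> v i = 2" "\<forall>i j. i \<noteq> j \<longrightarrow> \<bar>v i \<bullet> v j\<bar> = \<bar>path_matrix x y $ i $ j\<bar>"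
    by (simp_all add: geometric_realisation_def)
  then show ?G by (simp add: forall_3 path_matrix_entries)
next
  assume G: ?G
  then have com: "v 2 \<bullet> v 1 = v 1 \<bullet> v 2" "v 3 \<bullet> v 2 = v 2 \<bullet> v 3" "v 3 \<bullet> v 1 = 0" by (simp_all add: inner_commute)
  define p q where "p = v 1 \<bullet> v 2" and "q = v 2 \<bullet> v 3"
  have pq: "p\<^sup>2 + q\<^sup>2 < 4"
  proof -
    have "p\<^sup>2 = x\<^sup>2" "q\<^sup>2 = y\<^sup>2" using G by (auto simp: power2_eq_iff abs_eq_iff p_def q_def)
    then show ?thesis using assms by simp
  qed
  have lin: "X = 0 \<and> Y = 0 \<and> Z = 0" if "X *\<^sub>R v 1 + Y *\<^sub>R v 2 + Z *\<^sub>R v 3 = 0" for X Y Z :: real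
  proof -
    have "(X *\<^sub>R v 1 + Y *\<^sub>R v 2 + Z *\<^sub>R v 3) \<bullet> w = 0" for w using that by simp
    from this[of "v 1"] this[of "v 2"] this[of "v 3"]
    have e: "2 * X = - p * Y" "2 * Y = - p * X - q * Z" "2 * Z = - q * Y"
      using G com by (auto simp: inner_add_left p_def q_def algebra_simps)
    have "4 * Y = - p * (2 * X) - q * (2 * Z)" using e(2) by (simp add: algebra_simps)
    also have "\<dots> = (p\<^sup>2 + q\<^sup>2) * Y" unfolding e(1,3) by (simp add: power2_eq_square algebra_simps)
    finally have "Y = 0" using pq by simp
    then show ?thesis using e by simp
  qed
  have ne: "v 1 \<noteq> v 2" "v 1 \<noteq> v 3" "v 2 \<noteq> v 3"
    using lin[of 1 "-1" 0] lin[of 1 0 "-1"] lin[of 0 1 "-1"] by auto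
  have inj: "inj v"
  proof (rule injI)
    fix i j assume "v i = v j"
    then show "i = j" using ne exhaust_3[of i] exhaust_3[of j] by metis
  qed
  have range: "range v = {v 1, v 2, v 3}" unfolding UNIV_3 by simp
  have ind: "independent (range v)"
  proof (rule independent_if_scalars_zero)
    show "finite (range v)" by simp
    fix f w assume "(\<Sum>w\<in>range v. f w *\<^sub>R w) = 0" "w \<in> range v"
    then show "f w = 0"
      using lin[of "f (v 1)" "f (v 2)" "f (v 3)"] ne unfolding range by (auto simp: add.assoc)
  qed
  have "card (range v) = 3" using inj by (simp add: card_image)
  then have "UNIV \<subseteq> span (range v)"
    using ind by (intro card_ge_dim_independent) (auto simp: dim_UNIV)
  then show "geometric_realisation v (path_matrix x y)"
    unfolding geometric_realisation_def using inj ind G com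
    by (auto simp: forall_3 path_matrix_entries)
qed

lemma balanced_path:
  assumes "geometric_realisation v (path_matrix x y)" "x\<^sup>2 + y\<^sup>2 < 4"
  shows "balanced (v, path_matrix x y)" "gram_constant (v, path_matrix x y) = x\<^sup>2 + y\<^sup>2"
proof -
  have G: "v 1 \<bullet> v 1 = 2 \<and> v 2 \<bullet> v 2 = 2 \<and> v 3 \<bullet> v 3 = 2 \<and>
     \<bar>v 1 \<bullet> v 2\<bar> = \<bar>x\<bar> \<and> \<bar>v 2 \<bullet> v 3\<bar> = \<bar>y\<bar> \<and> v 1 \<bullet> v 3 = 0"
    using assms geometric_realisation_path by blast
  have n: "normalised (v, path_matrix x y)"
    using G by (simp add: normalised_def forall_3 path_matrix_entries)
  show "balanced (v, path_matrix x y)"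
    unfolding balanced_def balanced_entries[OF n] using G n
    by (simp add: gram_product_def path_matrix_entries)
  have "(v 1 \<bullet> v 2)\<^sup>2 = x\<^sup>2" "(v 2 \<bullet> v 3)\<^sup>2 = y\<^sup>2" using G by (auto simp: power2_eq_iff abs_eq_iff)
  then show "gram_constant (v, path_matrix x y) = x\<^sup>2 + y\<^sup>2"
    using G by (simp add: gram_constant_def gram_product_def)
qed

section \<open>What has to be checked by computation\<close>

definition cons_if :: "bool \<Rightarrow> 'a \<Rightarrow> 'a list \<Rightarrow> 'a list" where
  "cons_if b x xs = pick b (x # xs) xs"

text \<open>
  Evaluation rules avoiding the built-in conditional.
\<close>

lemma filter_cons_if [code]:
  "filter P [] = []" "filter P (x # xs) = cons_if (P x) x (filter P xs)"
  by (simp_all add: cons_if_def pick_if)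

definition all_roots :: "nat \<Rightarrow> root list" where
  "all_roots N = map (Pair True) [0..<N] @ map (Pair False) [0..<N]"

definition equal_up_to_sign :: "zq \<Rightarrow> zq \<Rightarrow> bool" where
  "equal_up_to_sign x y \<longleftrightarrow> x = y \<or> x = zneg y"

definition weight_is :: "root_data \<Rightarrow> zq \<Rightarrow> root \<times> root \<Rightarrow> bool" where
  "weight_is R w p = equal_up_to_sign (root_gram R (fst p) (snd p)) w"

definition pair_ok :: "root_data \<Rightarrow> zq \<Rightarrow> root \<times> root \<Rightarrow> bool" where
  "pair_ok R w p \<longleftrightarrow> ok2 R w (fst p) (snd p)"

definition linked :: "root_data \<Rightarrow> zq \<Rightarrow> nat \<Rightarrow> (root \<times> root) list" where
  "linked R w N = filter (pair_ok R w) (filter (weight_is R w) (List.product (all_roots N) (all_roots N)))"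

definition joins :: "root_data \<Rightarrow> root \<times> root \<Rightarrow> root \<times> root \<Rightarrow> bool" where
  "joins R p q \<longleftrightarrow> snd p = fst q \<and> root_gram R (fst p) (snd q) = (0, 0)"

definition path_seed :: "zq \<Rightarrow> zq \<Rightarrow> root \<times> root \<Rightarrow> root \<times> root \<Rightarrow> mseed" where
  "path_seed w w' p q = (fst p, snd p, snd q, w, (0, 0), w')"

definition paths_from :: "root_data \<Rightarrow> zq \<Rightarrow> zq \<Rightarrow> (root \<times> root) list \<Rightarrow> root \<times> root \<Rightarrow> mseed list" where
  "paths_from R w w' qs p = map (path_seed w w' p) (filter (joins R p) qs)"

text \<open>
  The frames with a path as matrix whose two nonzero weights have the right period. All other
  frames are incompatible at once.
\<close>

definition path_seeds :: "root_data \<Rightarrow> zq \<Rightarrow> zq \<Rightarrow> nat \<Rightarrow> mseed list" where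
  "path_seeds R w w' N = concat (map (paths_from R w w' (linked R w' N)) (linked R w N))"

fun cyclic_seed :: "int \<times> int \<Rightarrow> mseed \<Rightarrow> bool" where
  "cyclic_seed D (a, b, c, x, y, z) \<longleftrightarrow>
     zpos D x \<and> zpos D z \<and> zpos D (zneg y) \<or> zpos D (zneg x) \<and> zpos D (zneg z) \<and> zpos D y"

definition acute_pair :: "root_data \<Rightarrow> bool \<Rightarrow> root \<times> root \<Rightarrow> bool" where
  "acute_pair R strict p \<longleftrightarrow>
     pick strict (zpos (ring R) (zneg (root_gram R (fst p) (snd p)))) (\<not> zpos (ring R) (root_gram R (fst p) (snd p)))"

text \<open>
  All roots are positive, so that the domain contains the reference point, and they pairwise
  form obtuse or right angles, so that the domain is acute.
\<close>

fun acute_start :: "root_data \<Rightarrow> mseed \<Rightarrow> bool" where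
  "acute_start R (a, b, c, x, y, z) = every [fst a, fst b, fst c,
     acute_pair R False (a, b), acute_pair R False (a, c), acute_pair R False (b, c),
     \<not> cyclic_seed (ring R) (a, b, c, x, y, z)]"

definition completes :: "root_data \<Rightarrow> bool \<Rightarrow> root \<times> root \<Rightarrow> root \<Rightarrow> bool" where
  "completes R strict p c = every [acute_pair R strict (fst p, c), acute_pair R strict (snd p, c)]"

definition triples_from :: "root_data \<Rightarrow> bool \<Rightarrow> root list \<Rightarrow> root \<times> root \<Rightarrow> (root \<times> root \<times> root) list" where
  "triples_from R strict rs p = map (\<lambda>c. (fst p, snd p, c)) (filter (completes R strict p) rs)"

text \<open>
  Built by extending acute pairs, since a plain enumeration of all triples is too slow.
\<close>

definition acute_triples :: "root_data \<Rightarrow> bool \<Rightarrow> root list \<Rightarrow> (root \<times> root \<times> root) list" where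
  "acute_triples R strict rs = concat (map (triples_from R strict rs) (filter (acute_pair R strict) (List.product rs rs)))"

definition zgram_constant :: "int \<times> int \<Rightarrow> zq \<Rightarrow> zq \<Rightarrow> zq \<Rightarrow> zq" where
  "zgram_constant D x y z = zadd (zmul D x x) (zadd (zmul D y y) (zadd (zmul D z z) (zneg (zmul D (zmul D x y) z))))"

fun has_constant :: "root_data \<Rightarrow> zq \<Rightarrow> root \<times> root \<times> root \<Rightarrow> bool" where
  "has_constant R k (a, b, c) \<longleftrightarrow> zgram_constant (ring R) (root_gram R a b) (root_gram R a c) (root_gram R b c) = k"

text \<open>
  The first invariant leaves only the signs of the matrix entries open.
\<close>

fun orientations :: "root_data \<Rightarrow> root \<times> root \<times> root \<Rightarrow> mseed list" where
  "orientations R (a, b, c) = map (\<lambda>(x, y, z). (a, b, c, x, y, z))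
     (List.product [root_gram R a b, zneg (root_gram R a b)]
       (List.product [root_gram R a c, zneg (root_gram R a c)] [root_gram R b c, zneg (root_gram R b c)]))"

definition acyclic_seed :: "root_data \<Rightarrow> mseed \<Rightarrow> bool" where
  "acyclic_seed R m \<longleftrightarrow> \<not> cyclic_seed (ring R) m"

text \<open>
  A superset of the acute acyclic seeds, with positive roots, that can occur in the class of a
  frame whose Gram constant is \<open>k\<close>.
\<close>

definition acute_seeds :: "root_data \<Rightarrow> bool \<Rightarrow> zq \<Rightarrow> nat \<Rightarrow> mseed list" where
  "acute_seeds R strict k N = filter (acyclic_seed R) (concat (map (orientations R)
     (filter (has_constant R k) (acute_triples R strict (map (Pair True) [0..<N])))))"

definition known :: "mseed list \<Rightarrow> mseed \<Rightarrow> bool" where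
  "known Q m \<longleftrightarrow> found same_seed False Q (sort1 m)"

definition known_or_refuted :: "root_data \<Rightarrow> nat list \<Rightarrow> mseed list \<Rightarrow> mseed \<Rightarrow> bool" where
  "known_or_refuted R ks Q m \<longleftrightarrow> refuted R (pick (known Q m) True (locally_bad R m)) ks m"

fun has_root :: "root \<Rightarrow> seed_pair \<Rightarrow> bool" where
  "has_root r (m, (a, b, c, x, y, z)) \<longleftrightarrow> r = a \<or> r = b \<or> r = c"

definition root_occurs :: "seed_pair list \<Rightarrow> root \<Rightarrow> bool" where
  "root_occurs P r = any (map (has_root r) P)"

text \<open>
  The properties of a listed class that the theorem asks for; that every root occurs is needed
  to know that a point off all occurring vectors lies off all mirrors.
\<close>

definition compatible_class :: "root_data \<Rightarrow> nat \<Rightarrow> seed_pair list \<Rightarrow> bool" where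
  "compatible_class R N P \<longleftrightarrow> faithful P \<and> every (map (locally_ok R) (map snd P)) \<and>
     every (map (root_occurs P) (all_roots N)) \<and> any (map (acute_start R) (map snd P))"

fun explored :: "root_data \<Rightarrow> nat \<Rightarrow> seed_pair list option \<Rightarrow> bool" where
  "explored R N None = False"
| "explored R N (Some P) = compatible_class R N P"

fun members :: "seed_pair list option \<Rightarrow> mseed list" where
  "members None = []"
| "members (Some P) = map (sort1 \<circ> snd) P"

fun is_path :: "root_data \<Rightarrow> zq \<Rightarrow> zq \<Rightarrow> nat \<Rightarrow> root \<times> root \<times> root \<Rightarrow> bool" where
  "is_path R w w' N (a, b, c) \<longleftrightarrow> snd a < N \<and> snd b < N \<and> snd c < N \<and>
     weight_is R w (a, b) \<and> weight_is R w' (b, c) \<and> root_gram R a c = (0, 0)"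

fun start_seed :: "zq \<Rightarrow> zq \<Rightarrow> root \<times> root \<times> root \<Rightarrow> mseed" where
  "start_seed w w' (a, b, c) = (a, b, c, w, (0, 0), w')"

definition covers :: "root_data \<Rightarrow> nat \<Rightarrow> zq \<Rightarrow> zq \<Rightarrow> bool \<Rightarrow> nat list \<Rightarrow> mseed list \<Rightarrow> bool" where
  "covers R N w w' strict ks Q \<longleftrightarrow>
     every (map (known_or_refuted R ks Q) (path_seeds R w w' N)) \<and>
     every (map (known Q) (acute_seeds R strict (zadd (zmul (ring R) w w) (zmul (ring R) w' w')) N))"

definition classes_ok :: "root_data \<Rightarrow> nat \<Rightarrow> zq \<Rightarrow> zq \<Rightarrow> bool \<Rightarrow> nat list \<Rightarrow> seed_pair list option list \<Rightarrow> bool" where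
  "classes_ok R N w w' strict ks Cs \<longleftrightarrow>
     every (map (explored R N) Cs) \<and> covers R N w w' strict ks (concat (map members Cs))"

text \<open>
  The frames \<open>fs\<close> represent the compatible mutation classes. Each is explored in parallel with
  the first one, which yields at once the list of its seeds and the isomorphism of exchange
  graphs.
\<close>

definition classification :: "root_data \<Rightarrow> nat \<Rightarrow> zq \<Rightarrow> zq \<Rightarrow> bool \<Rightarrow> nat list \<Rightarrow> (root \<times> root \<times> root) list \<Rightarrow> bool" where
  "classification R N w w' strict ks fs \<longleftrightarrow> fs \<noteq> [] \<and> list_all (is_path R w w' N) fs \<and>
     0 < period R w \<and> 0 < period R w' \<and>
     classes_ok R N w w' strict ks
       (map (component R (start_seed w w' (hd fs))) (map (start_seed w w') fs))"

section \<open>From the checks to the classification\<close>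

lemma orientations_mem:
  assumes "x = root_gram R a b \<or> x = zneg (root_gram R a b)" "y = root_gram R a c \<or> y = zneg (root_gram R a c)"
    "z = root_gram R b c \<or> z = zneg (root_gram R b c)"
  shows "(a, b, c, x, y, z) \<in> set (orientations R (a, b, c))"
  using assms by (auto simp del: root_gram.simps)

lemma has_root_at: "has_root r p \<Longrightarrow> \<exists>i. root_at (snd p) i = r"
proof -
  obtain m a b c x y z where p: "p = (m, (a, b, c, x, y, z))" by (metis surj_pair)
  then show "has_root r p \<Longrightarrow> \<exists>i. root_at (snd p) i = r"
    by (auto simp del: One_nat_def) (metis root_at_tuple)+
qed

lemma all_roots_iff: "r \<in> set (all_roots N) \<longleftrightarrow> snd r < N"
  by (cases r) (auto simp: all_roots_def)

context root_chamber
begin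

lemma cyclic_realise:
  assumes "valid N m"
  shows "acyclic_matrix (snd (realise \<theta> \<rho> m)) \<longleftrightarrow> \<not> cyclic_seed (ring R) m"
proof -
  obtain a b c x y z where m: "m = (a, b, c, x, y, z)" by (cases m)
  have "skew (snd (realise \<theta> \<rho> m))" using normalised_skew[OF normalised_realise[OF assms]] .
  from acyclic_matrix_entries[OF this] show ?thesis
    by (auto simp: m realise_def entry_at_tuple)
qed

text \<open>
  A seed found in a listed class shares its exchange graph, its compatibility and its vectors
  with the frame from which the class was explored.
\<close>

lemma class_member:
  assumes P: "component R m n = Some P" "valid N m" "valid N n" and p: "p \<in> set P"
    and k: "valid N k" "sort1 k = sort1 (snd p)"
  shows "exchange_graph u (realise \<theta> \<rho> k) = exchange_graph u (realise \<theta> \<rho> n)"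
    and "compatible_position u (realise \<theta> \<rho> k) \<longleftrightarrow> compatible_position u (realise \<theta> \<rho> n)"
    and "occurring_vectors u (realise \<theta> \<rho> k) = occurring_vectors u (realise \<theta> \<rho> n)"
    and "\<exists>t \<pi>. t \<in> mutation_class u (realise \<theta> \<rho> k) \<and> bij \<pi> \<and> reindex \<pi> t = realise \<theta> \<rho> n"
proof -
  obtain t where t: "t \<in> mutation_class u (realise \<theta> \<rho> n)" and "same_class t (realise \<theta> \<rho> (snd p))"
    using class_reached[OF P p] unfolding same_class_def by metis
  from same_class_trans[OF this(2) same_class_sort1]
  have "same_class t (realise \<theta> \<rho> k)"
    using same_class_trans same_class_sym[OF same_class_sort1[of k]] unfolding k(2) by blast
  then obtain \<pi> where \<pi>: "bij \<pi>" "realise \<theta> \<rho> k = reindex \<pi> t" by (auto simp: same_class_def)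
  have eq: "mutation_class u t = mutation_class u (realise \<theta> \<rho> n)"
    using mutation_class_eq[OF reference_realise[OF P(3)] normalised_realise[OF P(3)] t] .
  show "exchange_graph u (realise \<theta> \<rho> k) = exchange_graph u (realise \<theta> \<rho> n)"
    "compatible_position u (realise \<theta> \<rho> k) \<longleftrightarrow> compatible_position u (realise \<theta> \<rho> n)"
    "occurring_vectors u (realise \<theta> \<rho> k) = occurring_vectors u (realise \<theta> \<rho> n)"
    unfolding \<pi>(2) using reindex_invariance[OF \<pi>(1)] compatible_position_cong_class[OF eq] by simp_all
  have "realise \<theta> \<rho> n \<in> mutation_class u t" using eq mutation_class.start by blast
  then have "reindex \<pi> (realise \<theta> \<rho> n) \<in> mutation_class u (realise \<theta> \<rho> k)"
    unfolding \<pi>(2) mutation_class_reindex[OF \<pi>(1)] by blast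
  moreover have "reindex (inv \<pi>) (reindex \<pi> (realise \<theta> \<rho> n)) = realise \<theta> \<rho> n"
  proof -
    have "\<pi> \<circ> inv \<pi> = id" using \<pi>(1) by (simp add: bij_is_surj surj_iff[symmetric])
    then show ?thesis using reindex_id[of "realise \<theta> \<rho> n"] by (simp add: reindex_comp)
  qed
  ultimately show "\<exists>t \<pi>. t \<in> mutation_class u (realise \<theta> \<rho> k) \<and> bij \<pi> \<and> reindex \<pi> t = realise \<theta> \<rho> n"
    using bij_imp_bij_inv[OF \<pi>(1)] by blast
qed

lemma acute_pair_iff:
  assumes "snd a < N" "snd b < N"
  shows "acute_pair R strict (a, b) \<longleftrightarrow> (if strict then rvec \<rho> a \<bullet> rvec \<rho> b < 0 else rvec \<rho> a \<bullet> rvec \<rho> b \<le> 0)"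
  using assms by (auto simp: acute_pair_def pick_if rvec_gram)

lemma seed_domain_realise:
  assumes "valid N m"
  shows "u \<in> seed_domain (realise \<theta> \<rho> m) \<longleftrightarrow> (\<forall>i. fst (root_at m i))"
proof -
  have "u \<in> hemisphere (rvec \<rho> (root_at m i)) \<longleftrightarrow> fst (root_at m i)" for i
    using assms positive_rvec[of "root_at m i"] by (simp add: valid_def positive_vector_def)
  then show ?thesis by (simp add: seed_domain_def realise_def)
qed

lemma acute_start_realise:
  assumes "valid N m" "acute_start R m"
  shows "acyclic_matrix (snd (realise \<theta> \<rho> m)) \<and> acute_angled (realise \<theta> \<rho> m) \<and> u \<in> seed_domain (realise \<theta> \<rho> m)"
proof -
  obtain a b c x y z where m: "m = (a, b, c, x, y, z)" by (cases m)
  have v: "snd a < N" "snd b < N" "snd c < N"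
    using assms(1) by (auto simp: m valid_def forall_3 root_at_tuple)
  have "acute_angled (realise \<theta> \<rho> m)"
    using assms(2) v by (auto simp: m acute_angled_def realise_def forall_3 root_at_tuple acute_pair_iff inner_commute)
  moreover have "u \<in> seed_domain (realise \<theta> \<rho> m)"
    unfolding seed_domain_realise[OF assms(1)] using assms(2) by (simp add: m forall_3 root_at_tuple)
  ultimately show ?thesis using cyclic_realise[OF assms(1)] assms(2) m by simp
qed

end

lemma seed_domain_reindex:
  fixes t :: "('n::finite) seed"
  assumes "bij \<pi>" shows "seed_domain (reindex \<pi> t) = seed_domain t"
proof -
  have "(\<Inter>i. hemisphere (fst t (\<pi> i))) = (\<Inter>x\<in>range \<pi>. hemisphere (fst t x))" by simp
  then show ?thesis using bij_is_surj[OF assms] by (simp add: seed_domain_def reindex_def)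
qed

lemma acute_reindex:
  fixes t :: "('n::finite) seed"
  assumes "bij \<pi>" "acute_angled (reindex \<pi> t)" shows "acute_angled t"
  unfolding acute_angled_def
proof (intro allI impI)
  fix i j :: 'n assume "i \<noteq> j"
  have s: "\<pi> (inv \<pi> x) = x" for x using assms(1) by (simp add: bij_is_surj surj_f_inv_f)
  then have "inv \<pi> i \<noteq> inv \<pi> j" using \<open>i \<noteq> j\<close> by metis
  then show "fst t i \<bullet> fst t j \<le> 0"
    using assms(2) s unfolding acute_angled_def reindex_def by (metis comp_apply fst_conv)
qed

text \<open>
  One of the five cases. The matrix has weights \<open>w\<close> and \<open>w'\<close>, the root system has the weights
  \<open>ab\<close> between its simple roots, and the two need not coincide. The flag \<open>strict\<close> tells whether
  the last assertion is claimed for strictly acute seeds only.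
\<close>

locale path_classification =
  fixes D :: "int \<times> int" and \<theta> :: real and ab :: "zq \<times> zq" and L :: "coords list" and W :: "(zq \<times> nat) list"
    and w w' :: zq and strict :: bool and ks :: "nat list" and fs :: "(root \<times> root \<times> root) list"
  assumes quad: "quadratic_irrational D \<theta>" and \<theta>: "0 \<le> \<theta>"
    and L: "positive_roots D ab L"
    and ab: "(zval \<theta> (fst ab))\<^sup>2 + (zval \<theta> (snd ab))\<^sup>2 < 4"
    and W: "\<And>w n. (w, n) \<in> set W \<Longrightarrow> \<exists>p q :: nat. p \<ge> 1 \<and> q \<ge> 1 \<and> coprime p q \<and> 2 * p \<le> q \<and>
        zval \<theta> w = 2 * cos (pi * real p / real q) \<and> n = q + 2 * p"
    and weights_definite: "(zval \<theta> w)\<^sup>2 + (zval \<theta> w')\<^sup>2 < 4"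
    and check: "classification (root_table D ab L W) (length L) w w' strict ks fs"
    and system_exists: "\<exists>S. simple_system \<theta> ab S"
    and system_of_path: "\<And>v. geometric_realisation v (path_matrix (zval \<theta> w) (zval \<theta> w')) \<Longrightarrow>
        \<exists>S. simple_system \<theta> ab S \<and> range v \<subseteq> root_set \<theta> L S"
begin

abbreviation "R \<equiv> root_table D ab L W"
abbreviation "N \<equiv> length L"
abbreviation "B \<equiv> path_matrix (zval \<theta> w) (zval \<theta> w')"
abbreviation "chamber S u \<equiv> root_chamber R \<theta> N (root_vector \<theta> L S) u"
abbreviation "real_seed S m \<equiv> realise \<theta> (root_vector \<theta> L S) m"

definition base_seed :: mseed where "base_seed = start_seed w w' (hd fs)"

abbreviation class_members :: "mseed list" where
  "class_members \<equiv> concat (map members (map (component R base_seed) (map (start_seed w w') fs)))"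

lemma starts:
  assumes "f \<in> set fs"
  obtains P where "component R base_seed (start_seed w w' f) = Some P" "compatible_class R N P"
    "valid N (start_seed w w' f)" "is_path R w w' N f"
proof -
  obtain a b c where f: "f = (a, b, c)" by (cases f)
  have "explored R N (component R base_seed (start_seed w w' f))" "is_path R w w' N f"
    using check assms by (auto simp: classification_def classes_ok_def list_all_iff base_seed_def)
  moreover from this(2) have "valid N (start_seed w w' f)"
    by (simp add: f valid_def forall_3 root_at_tuple)
  ultimately show ?thesis using that by (cases "component R base_seed (start_seed w w' f)") auto
qed

lemma hd_start: "hd fs \<in> set fs" "valid N base_seed"
proof -
  show *: "hd fs \<in> set fs" using check by (simp add: classification_def)
  show "valid N base_seed" using starts[OF *] unfolding base_seed_def by blast
qed

lemma member_class:
  assumes "sort1 m \<in> set class_members"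
  obtains f P p where "f \<in> set fs" "component R base_seed (start_seed w w' f) = Some P" "p \<in> set P" "sort1 m = sort1 (snd p)"
proof -
  obtain f where f: "f \<in> set fs" "sort1 m \<in> set (members (component R base_seed (start_seed w w' f)))"
    using assms by auto
  then obtain P where P: "component R base_seed (start_seed w w' f) = Some P"
    by (cases "component R base_seed (start_seed w w' f)") auto
  have "sort1 m \<in> (sort1 \<circ> snd) ` set P" using f(2) unfolding P members.simps set_map .
  then obtain p where "p \<in> set P" "sort1 m = sort1 (snd p)" unfolding image_iff comp_apply by blast
  then show ?thesis using that[OF f(1) P] by blast
qed

lemma path_realise:
  assumes "root_chamber R \<theta> N \<rho> u" "is_path R w w' N f"
  shows "snd (realise \<theta> \<rho> (start_seed w w' f)) = B"
    and "geometric_realisation (fst (realise \<theta> \<rho> (start_seed w w' f))) B"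
proof -
  interpret c: root_chamber R \<theta> N \<rho> u by fact
  obtain a b c where f: "f = (a, b, c)" by (cases f)
  show "snd (realise \<theta> \<rho> (start_seed w w' f)) = B"
    by (simp add: f realise_def vec_eq_iff forall_3 entry_at_tuple path_matrix_entries)
  have v: "snd a < N" "snd b < N" "snd c < N" using assms(2) by (auto simp: f)
  have "rvec \<rho> a \<bullet> rvec \<rho> b = zval \<theta> w \<or> rvec \<rho> a \<bullet> rvec \<rho> b = - zval \<theta> w"
    "rvec \<rho> b \<bullet> rvec \<rho> c = zval \<theta> w' \<or> rvec \<rho> b \<bullet> rvec \<rho> c = - zval \<theta> w'" "rvec \<rho> a \<bullet> rvec \<rho> c = 0"
    using assms(2) v by (auto simp: f weight_is_def equal_up_to_sign_def c.rvec_gram)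
  then show "geometric_realisation (fst (realise \<theta> \<rho> (start_seed w w' f))) B"
    unfolding geometric_realisation_path[OF weights_definite] using v
    by (auto simp: f realise_def root_at_tuple c.rvec_norm)
qed

lemma realise_base_seed: "root_chamber R \<theta> N \<rho> u \<Longrightarrow> realise \<theta> \<rho> base_seed = (fst (realise \<theta> \<rho> base_seed), B)"
  using path_realise(1)[of \<rho> u "hd fs"] starts[OF hd_start(1)] unfolding base_seed_def by (metis prod.collapse)

text \<open>
  Every realisation may be written with the roots of a chamber: move the reference point off the
  mirrors, choose the simple system whose chamber contains it, and read off signs and indices.
\<close>

lemma normal_form:
  assumes v: "geometric_realisation v B" and u: "reference_point u (v, B)"
  obtains S u1 a b c where "simple_system \<theta> ab S" "chamber S u1"
    "same_side u u1 (occurring_vectors u (v, B))" "is_path R w w' N (a, b, c)"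
    "real_seed S (start_seed w w' (a, b, c)) = (v, B)"
proof -
  obtain S0 where S0: "simple_system \<theta> ab S0" "range v \<subseteq> root_set \<theta> L S0" using system_of_path[OF v] by blast
  have occ: "occurring_vectors u (v, B) \<subseteq> root_set \<theta> L S0"
    by (rule occurring_subset_root_set[OF quad L S0(1)]) (simp add: S0(2))
  have unit: "norm u = 1" using u by (simp add: reference_point_def)
  have "0 \<notin> root_set \<theta> L S0" using root_set_nonzero[OF quad L S0(1)] by force
  then obtain u1 where u1: "norm u1 = 1" "\<And>x. x \<in> root_set \<theta> L S0 \<Longrightarrow> x \<bullet> u1 \<noteq> 0"
    "\<And>x. x \<in> root_set \<theta> L S0 \<Longrightarrow> x \<bullet> u \<noteq> 0 \<Longrightarrow> x \<bullet> u1 < 0 \<longleftrightarrow> x \<bullet> u < 0"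
    using generic_reference_point[OF finite_root_set[OF quad L] _ unit] by metis
  have "x \<bullet> u \<noteq> 0" if "x \<in> occurring_vectors u (v, B)" for x
    using u that unit by (auto simp: reference_point_def great_circle_def)
  then have side: "same_side u u1 (occurring_vectors u (v, B))"
    using same_side_generic[OF unit u1(1) occ u1(2,3)] by blast
  obtain S where S: "simple_system \<theta> ab S" "root_set \<theta> L S = root_set \<theta> L S0" "chamber S u1"
    using chamber_exists[OF quad L \<theta> ab S0(1) u1(1,2) W] by blast
  interpret c: root_chamber R \<theta> N "root_vector \<theta> L S" u1 by (rule S(3))
  have "\<exists>r. snd r < N \<and> v i = rvec (root_vector \<theta> L S) r" for i
  proof -
    have "v i \<in> root_set \<theta> L S" using S0(2) S(2) by auto
    then show ?thesis unfolding root_set_def by blast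
  qed
  then obtain r where r: "\<And>i. snd (r i) < N" "\<And>i. v i = rvec (root_vector \<theta> L S) (r i)" by metis
  have G: "\<bar>v 1 \<bullet> v 2\<bar> = \<bar>zval \<theta> w\<bar>" "\<bar>v 2 \<bullet> v 3\<bar> = \<bar>zval \<theta> w'\<bar>" "v 1 \<bullet> v 3 = 0"
    using v unfolding geometric_realisation_path[OF weights_definite] by auto
  have eq: "x = y \<or> x = zneg y" if "\<bar>zval \<theta> x\<bar> = \<bar>zval \<theta> y\<bar>" for x y
    using that zval_eq_iff[OF quad, of x y] zval_eq_iff[OF quad, of x "zneg y"] by (auto simp: abs_eq_iff)
  have "is_path R w w' N (r 1, r 2, r 3)"
    using r G eq zval_eq_iff[OF quad, of _ "(0, 0)"] by (simp add: weight_is_def equal_up_to_sign_def c.rvec_gram)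
  moreover have "real_seed S (start_seed w w' (r 1, r 2, r 3)) = (v, B)"
  proof -
    have "fst (real_seed S (start_seed w w' (r 1, r 2, r 3))) i = v i" for i
      using exhaust_3[of i] r(2) by (auto simp: realise_def root_at_tuple)
    then show ?thesis using path_realise(1)[OF S(3) calculation] by (metis ext prod.collapse)
  qed
  ultimately show ?thesis using that S side by blast
qed

text \<open>
  A compatible realisation is one of the frames enumerated by the check and cannot be a refuted
  one, so it lies in the class of one of the starting frames.
\<close>

lemma compatible_normal_form:
  assumes v: "geometric_realisation v B" and u: "compatible_position u (v, B)"
  obtains S u1 f P where "simple_system \<theta> ab S" "chamber S u1"
    "same_side u u1 (occurring_vectors u (v, B))" "f \<in> set fs"
    "component R base_seed (start_seed w w' f) = Some P" "compatible_class R N P" "valid N (start_seed w w' f)"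
    "exchange_graph u (v, B) = exchange_graph u1 (real_seed S (start_seed w w' f))"
    "occurring_vectors u (v, B) = occurring_vectors u1 (real_seed S (start_seed w w' f))"
    "\<exists>t \<pi>. t \<in> mutation_class u (v, B) \<and> bij \<pi> \<and> reindex \<pi> t = real_seed S (start_seed w w' f)"
proof -
  have ref: "reference_point u (v, B)" using u by (simp add: compatible_position_def)
  obtain S u1 a b c where S: "simple_system \<theta> ab S" "chamber S u1"
    "same_side u u1 (occurring_vectors u (v, B))" "is_path R w w' N (a, b, c)"
    "real_seed S (start_seed w w' (a, b, c)) = (v, B)"
    using normal_form[OF v ref] .
  let ?m = "start_seed w w' (a, b, c)"
  interpret c: root_chamber R \<theta> N "root_vector \<theta> L S" u1 by fact
  have vm: "valid N ?m" using S(4) by (simp add: valid_def forall_3 root_at_tuple)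
  have comp: "compatible_position u1 (real_seed S ?m)" using same_side_compatible(1)[OF S(3)] u S(5) by simp
  have per: "0 < period R w" "0 < period R w'" using check by (simp_all add: classification_def)
  have "ok2 R w a b" "ok2 R w' b c"
    using c.compatible_ok2[OF vm comp, of 1 2] c.compatible_ok2[OF vm comp, of 2 3] per
    by (simp_all add: entry_at_tuple root_at_tuple)
  then have "(a, b) \<in> set (linked R w N)" "(b, c) \<in> set (linked R w' N)"
    using S(4) by (auto simp: linked_def pair_ok_def all_roots_iff)
  moreover have "path_seed w w' (a, b) (b, c) = ?m" "joins R (a, b) (b, c)"
    using S(4) by (simp_all add: path_seed_def joins_def)
  ultimately have "?m \<in> set (path_seeds R w w' N)"
    unfolding path_seeds_def paths_from_def by force
  then have "known_or_refuted R ks class_members ?m"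
    using check by (simp add: classification_def classes_ok_def covers_def list_all_iff base_seed_def)
  then have "\<not> known class_members ?m \<Longrightarrow>
      refuted R (locally_bad R ?m) ks ?m"
    by (simp only: known_or_refuted_def pick_if if_False)
  then have "known class_members ?m"
    using c.refuted_not_compatible[OF vm] c.locally_bad_not_compatible[OF vm] comp by blast
  then have "sort1 ?m \<in> set class_members"
    by (simp add: known_def)
  then obtain f P p where f: "f \<in> set fs" "component R base_seed (start_seed w w' f) = Some P" "p \<in> set P" "sort1 ?m = sort1 (snd p)"
    by (rule member_class)
  have vf: "compatible_class R N P" "valid N (start_seed w w' f)" using starts[OF f(1)] f(2) by auto
  note cm = c.class_member[OF f(2) hd_start(2) vf(2) f(3) vm f(4), unfolded S(5)]
  show ?thesis
    using that[OF S(1,2,3) f(1,2) vf] cm same_side_compatible(2,3)[OF S(3)] same_side_class[OF S(3)] by simp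
qed

lemma compatible_start:
  assumes "f \<in> set fs" "root_chamber R \<theta> N \<rho> u"
  shows "compatible_position u (realise \<theta> \<rho> (start_seed w w' f))"
proof -
  interpret c: root_chamber R \<theta> N \<rho> u by fact
  obtain P where P: "component R base_seed (start_seed w w' f) = Some P" "compatible_class R N P" "valid N (start_seed w w' f)"
    using starts[OF assms(1)] .
  have "list_all (\<lambda>p. locally_ok R (snd p)) P" using P(2) by (simp add: compatible_class_def list_all_iff)
  then show ?thesis using c.component_compatible[OF P(1) hd_start(2) P(3)] by blast
qed

text \<open>
  For a point off all mirrors the first starting frame, written in the simple system of its
  chamber, is a compatible realisation.
\<close>

lemma compatible_exists_generic:
  assumes S: "simple_system \<theta> ab S" and u: "norm u = 1" "\<And>x. x \<in> root_set \<theta> L S \<Longrightarrow> x \<bullet> u \<noteq> 0"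
  shows "\<exists>v. geometric_realisation v B \<and> range v \<subseteq> root_set \<theta> L S \<and> compatible_position u (v, B)"
proof -
  obtain S' where S': "root_set \<theta> L S' = root_set \<theta> L S" "chamber S' u"
    using chamber_exists[OF quad L \<theta> ab S u W] by blast
  let ?v = "fst (real_seed S' base_seed)"
  have "is_path R w w' N (hd fs)" using starts[OF hd_start(1)] .
  then have "geometric_realisation ?v B" using path_realise(2)[OF S'(2)] by (simp add: base_seed_def)
  moreover have "range ?v \<subseteq> root_set \<theta> L S'"
    using hd_start(2) by (auto simp: realise_def root_set_def valid_def)
  moreover have "compatible_position u (?v, B)"
    using compatible_start[OF hd_start(1) S'(2)] realise_base_seed[OF S'(2)] unfolding base_seed_def by metis
  ultimately show ?thesis using S'(1) by blast
qed

theorem compatible_realisation_exists: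
  "\<exists>v u. geometric_realisation v B \<and> compatible_position u (v, B)"
proof -
  obtain S where S: "simple_system \<theta> ab S" using system_exists by blast
  have "0 \<notin> root_set \<theta> L S" using root_set_nonzero[OF quad L S] by force
  moreover have "norm (axis 1 1 :: real^3) = 1" by (simp add: norm_axis_1)
  ultimately obtain u where "norm u = 1" "\<forall>x\<in>root_set \<theta> L S. x \<bullet> u \<noteq> 0"
    using generic_reference_point[OF finite_root_set[OF quad L]] by metis
  then show ?thesis using compatible_exists_generic[OF S] by blast
qed

text \<open>
  Both exchange graphs are compared with the one of the first starting frame, once for each
  simple system; the pairing of that frame with itself links the two systems.
\<close>

theorem exchange_graphs_isomorphic:
  assumes "geometric_realisation v B" "compatible_position u (v, B)"
    "geometric_realisation v' B" "compatible_position u' (v', B)"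
  shows "graph_isomorphic (exchange_graph u (v, B)) (exchange_graph u' (v', B))"
proof -
  \<comment> \<open>the first starting frame was explored in parallel with itself\<close>
  have base: "component R base_seed base_seed \<noteq> None \<and> faithful (the (component R base_seed base_seed))"
    using starts[OF hd_start(1)] unfolding base_seed_def[symmetric] by (metis compatible_class_def option.distinct(1) option.sel)
  then obtain P0 where P0: "component R base_seed base_seed = Some P0" "faithful P0" by auto
  obtain S u1 f P where 1: "simple_system \<theta> ab S" "chamber S u1"
    "same_side u u1 (occurring_vectors u (v, B))" "f \<in> set fs"
    "component R base_seed (start_seed w w' f) = Some P" "compatible_class R N P" "valid N (start_seed w w' f)"
    "exchange_graph u (v, B) = exchange_graph u1 (real_seed S (start_seed w w' f))"
    by (rule compatible_normal_form[OF assms(1,2)])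
  obtain S' u1' f' P' where 2: "simple_system \<theta> ab S'" "chamber S' u1'"
    "same_side u' u1' (occurring_vectors u' (v', B))" "f' \<in> set fs"
    "component R base_seed (start_seed w w' f') = Some P'" "compatible_class R N P'" "valid N (start_seed w w' f')"
    "exchange_graph u' (v', B) = exchange_graph u1' (real_seed S' (start_seed w w' f'))"
    by (rule compatible_normal_form[OF assms(3,4)])
  have "graph_isomorphic (exchange_graph u1 (real_seed S base_seed)) (exchange_graph u1 (real_seed S (start_seed w w' f)))"
    using component_isomorphic[OF 1(2,2,5) hd_start(2) 1(7)] 1(6) by (simp add: compatible_class_def)
  moreover have "graph_isomorphic (exchange_graph u1 (real_seed S base_seed)) (exchange_graph u1' (real_seed S' base_seed))"
    using component_isomorphic[OF 1(2) 2(2) P0(1) hd_start(2,2) P0(2)] .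
  moreover have "graph_isomorphic (exchange_graph u1' (real_seed S' base_seed)) (exchange_graph u1' (real_seed S' (start_seed w w' f')))"
    using component_isomorphic[OF 2(2,2,5) hd_start(2) 2(7)] 2(6) by (simp add: compatible_class_def)
  ultimately show ?thesis
    unfolding 1(8) 2(8) using graph_isomorphic_sym graph_isomorphic_trans by meson
qed

text \<open>
  The listed class contains an acute seed of positive roots. It is transported back through the
  relabellings and from the moved reference point to the given one.
\<close>

theorem compatible_point_in_acute_domain:
  assumes "geometric_realisation v B" "compatible_position u (v, B)"
  shows "\<exists>s\<in>mutation_class u (v, B). acyclic_matrix (snd s) \<and> acute_angled s \<and> u \<in> seed_domain s"
proof -
  obtain S u1 f P where 1: "chamber S u1"
    "same_side u u1 (occurring_vectors u (v, B))"
    "component R base_seed (start_seed w w' f) = Some P" "compatible_class R N P" "valid N (start_seed w w' f)"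
    "\<exists>t \<pi>. t \<in> mutation_class u (v, B) \<and> bij \<pi> \<and> reindex \<pi> t = real_seed S (start_seed w w' f)"
    by (rule compatible_normal_form[OF assms])
  interpret c: root_chamber R \<theta> N "root_vector \<theta> L S" u1 by fact
  have mc: "mutation_class u1 (v, B) = mutation_class u (v, B)" using same_side_class[OF 1(2)] .
  obtain t0 \<pi>0 where t0: "t0 \<in> mutation_class u1 (v, B)" "bij \<pi>0" "reindex \<pi>0 t0 = real_seed S (start_seed w w' f)"
    using 1(6) mc by blast
  obtain p where p: "p \<in> set P" "acute_start R (snd p)"
    using 1(4) by (auto simp: compatible_class_def list_ex_iff)
  obtain t \<pi> where t: "t \<in> mutation_class u1 (reindex \<pi>0 t0)" "bij \<pi>" "reindex \<pi> t = real_seed S (snd p)"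
    using c.class_reached[OF 1(3) hd_start(2) 1(5) p(1)] t0(3) by metis
  obtain t' where t': "t' \<in> mutation_class u1 t0" "t = reindex \<pi>0 t'"
    using t(1) unfolding mutation_class_reindex[OF t0(2)] by blast
  have t'c: "t' \<in> mutation_class u (v, B)" using mutation_class_trans[OF t0(1) t'(1)] mc by simp
  have vp: "valid N (snd p)" using c.component_valid[OF 1(3) hd_start(2) 1(5) p(1)] by blast
  define \<sigma> where "\<sigma> = \<pi>0 \<circ> \<pi>"
  have \<sigma>: "bij \<sigma>" "reindex \<sigma> t' = real_seed S (snd p)"
    using bij_comp[OF t(2) t0(2)] t(3) t'(2) by (simp_all add: \<sigma>_def reindex_comp)
  note as = c.acute_start_realise[OF vp p(2), folded \<sigma>(2)]
  have "normalised (v, B)" using balanced_path[OF assms(1) weights_definite] by (simp add: balanced_def)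
  then have "skew (snd t')" using normalised_class t'c normalised_skew by blast
  then have "acyclic_matrix (snd t')" using as acyclic_reindex[OF _ \<sigma>(1)] by blast
  moreover have "acute_angled t'" using as acute_reindex[OF \<sigma>(1)] by blast
  moreover have "u \<in> seed_domain t'"
    using as seed_domain_reindex[OF \<sigma>(1)] same_side_compatible(5)[OF 1(2) t'c] by simp
  ultimately show ?thesis using t'c by blast
qed

text \<open>
  Every root occurs in a compatible class, so a point off all occurring vectors lies off all
  mirrors.
\<close>

theorem compatible_realisation_for_generic_point:
  assumes "geometric_realisation v B" "compatible_position u\<^sub>0 (v, B)" "norm u = 1"
    and "\<forall>x\<in>occurring_vectors u\<^sub>0 (v, B). u \<notin> great_circle x"
  shows "\<exists>v'. geometric_realisation v' B \<and> range v' \<subseteq> occurring_vectors u\<^sub>0 (v, B) \<and> compatible_position u (v', B)"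
proof -
  obtain S u1 f P where 1: "simple_system \<theta> ab S" "chamber S u1"
    "component R base_seed (start_seed w w' f) = Some P" "compatible_class R N P" "valid N (start_seed w w' f)"
    "occurring_vectors u\<^sub>0 (v, B) = occurring_vectors u1 (real_seed S (start_seed w w' f))"
    by (rule compatible_normal_form[OF assms(1,2)])
  interpret c: root_chamber R \<theta> N "root_vector \<theta> L S" u1 by fact
  have occ: "root_set \<theta> L S \<subseteq> occurring_vectors u\<^sub>0 (v, B)"
  proof
    fix x assume "x \<in> root_set \<theta> L S"
    then obtain r where r: "snd r < N" "x = rvec (root_vector \<theta> L S) r" by (auto simp: root_set_def)
    have "root_occurs P r" using 1(4) r(1) all_roots_iff by (auto simp: compatible_class_def list_all_iff)
    then obtain p where p: "p \<in> set P" "has_root r p" by (auto simp: root_occurs_def list_ex_iff)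
    then obtain i where "root_at (snd p) i = r" using has_root_at by blast
    then show "x \<in> occurring_vectors u\<^sub>0 (v, B)"
      using c.component_occurring[OF 1(3) hd_start(2) 1(5) p(1), of i r] r(2) 1(6) by simp
  qed
  have "x \<bullet> u \<noteq> 0" if "x \<in> root_set \<theta> L S" for x
    using assms(3,4) occ that by (auto simp: great_circle_def)
  from compatible_exists_generic[OF 1(1) assms(3) this] show ?thesis using occ by blast
qed

text \<open>
  The invariants put the seed among the enumerated acute candidates, each of which belongs to a
  compatible class.
\<close>

theorem acute_seed_compatible:
  assumes v: "geometric_realisation v B" and u: "reference_point u (v, B)"
    and s: "s \<in> mutation_class u (v, B)" "acyclic_matrix (snd s)" "acute_angled s" "u \<in> seed_domain s"
    and st: "strict \<Longrightarrow> strictly_acute_angled s"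
  shows "compatible_position u (v, B)"
proof -
  obtain S u1 a0 b0 c0 where S: "simple_system \<theta> ab S" "chamber S u1"
    "same_side u u1 (occurring_vectors u (v, B))" "is_path R w w' N (a0, b0, c0)"
    "real_seed S (start_seed w w' (a0, b0, c0)) = (v, B)"
    using normal_form[OF v u] .
  let ?\<rho> = "root_vector \<theta> L S"
  interpret c: root_chamber R \<theta> N ?\<rho> u1 by fact
  have bal: "balanced s" "gram_constant s = (zval \<theta> w)\<^sup>2 + (zval \<theta> w')\<^sup>2"
    using balanced_class[OF balanced_path(1)[OF v weights_definite] u s(1)] balanced_path(2)[OF v weights_definite] by auto
  have n: "normalised s" using bal(1) by (simp add: balanced_def)
  have s1: "s \<in> mutation_class u1 (v, B)" using s(1) same_side_class[OF S(3)] by simp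
  have dom: "u1 \<in> seed_domain s" using same_side_compatible(5)[OF S(3) s(1)] s(4) by simp
  have "valid N (start_seed w w' (a0, b0, c0))" using S(4) by (simp add: valid_def forall_3 root_at_tuple)
  then obtain m \<pi> where m: "valid N m" "bij \<pi>" "reindex \<pi> s = real_seed S m"
    using c.valid_class s1 S(5) by metis
  have "\<exists>r. snd r < N \<and> fst s i = rvec ?\<rho> r" for i using c.realise_reference[OF m] .
  then obtain r where r: "\<And>i. snd (r i) < N" "\<And>i. fst s i = rvec ?\<rho> (r i)" by metis
  define g where "g i j = root_gram R (r i) (r j)" for i j
  have g: "fst s i \<bullet> fst s j = zval \<theta> (g i j)" for i j by (simp add: g_def r c.rvec_gram)
  have signed: "\<exists>x. (x = g i j \<or> x = zneg (g i j)) \<and> snd s $ i $ j = zval \<theta> x" if "i \<noteq> j" for i j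
  proof -
    have "\<bar>snd s $ i $ j\<bar> = \<bar>zval \<theta> (g i j)\<bar>" using bal(1) that g by (simp add: balanced_def)
    then show ?thesis by (metis abs_eq_iff zval_zneg)
  qed
  have ne: "(1::3) \<noteq> 2" "(1::3) \<noteq> 3" "(2::3) \<noteq> 3" by simp_all
  obtain x where x: "x = g 1 2 \<or> x = zneg (g 1 2)" "snd s $ 1 $ 2 = zval \<theta> x" using signed[OF ne(1)] by blast
  obtain y where y: "y = g 1 3 \<or> y = zneg (g 1 3)" "snd s $ 1 $ 3 = zval \<theta> y" using signed[OF ne(2)] by blast
  obtain z where z: "z = g 2 3 \<or> z = zneg (g 2 3)" "snd s $ 2 $ 3 = zval \<theta> z" using signed[OF ne(3)] by blast
  define k where "k = (r 1, r 2, r 3, x, y, z)"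
  have vk: "valid N k" using r(1) by (simp add: k_def valid_def forall_3 root_at_tuple)
  have sk: "real_seed S k = s"
  proof -
    have "fst (real_seed S k) i = fst s i" for i
      using exhaust_3[of i] r(2) by (auto simp: k_def realise_def root_at_tuple)
    moreover have "snd s $ i $ i = 0" for i using n unfolding normalised_def by (metis double_zero)
    moreover have "snd s $ 2 $ 1 = - snd s $ 1 $ 2" "snd s $ 3 $ 1 = - snd s $ 1 $ 3" "snd s $ 3 $ 2 = - snd s $ 2 $ 3"
      using n by (simp_all add: normalised_def eq_neg_iff_add_eq_0)
    ultimately have "snd (real_seed S k) = snd s"
      using x y z by (simp add: k_def realise_def vec_eq_iff forall_3 entry_at_tuple)
    then show ?thesis using \<open>\<And>i. fst (real_seed S k) i = fst s i\<close> by (simp add: prod_eq_iff fun_eq_iff)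
  qed
  have pos: "fst (r i)" for i
    using dom unfolding sk[symmetric] c.seed_domain_realise[OF vk]
    using exhaust_3[of i] by (auto simp: k_def forall_3 root_at_tuple)
  have ac: "acute_pair R strict (r i, r j)" if "i \<noteq> j" for i j
    using s(3) st that unfolding c.acute_pair_iff[OF r(1) r(1)] r(2)[symmetric]
    by (auto simp: acute_angled_def strictly_acute_angled_def)
  have rt: "r i \<in> set (map (Pair True) [0..<N])" for i
    using pos[of i] r(1)[of i] by (cases "r i") auto
  have "(r 1, r 2, r 3) \<in> set (acute_triples R strict (map (Pair True) [0..<N]))"
  proof -
    let ?rs = "map (Pair True) [0..<N]"
    have "(r 1, r 2) \<in> set (filter (acute_pair R strict) (List.product ?rs ?rs))"
      using rt[of 1] rt[of 2] ac[OF ne(1)] by simp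
    moreover have "r 3 \<in> set (filter (completes R strict (r 1, r 2)) ?rs)"
      using rt[of 3] ac[OF ne(2)] ac[OF ne(3)] by (simp add: completes_def)
    then have "(r 1, r 2, r 3) \<in> set (triples_from R strict ?rs (r 1, r 2))"
      unfolding triples_from_def set_map by (simp only: image_iff fst_conv snd_conv) blast
    ultimately show ?thesis unfolding acute_triples_def set_concat set_map by blast
  qed
  moreover have "has_constant R (zadd (zmul (ring R) w w) (zmul (ring R) w' w')) (r 1, r 2, r 3)"
  proof -
    have "zval \<theta> (zgram_constant (ring R) (g 1 2) (g 1 3) (g 2 3)) = gram_constant s"
      using zval_zmul[OF c.quad] by (simp add: zgram_constant_def gram_constant_def gram_product_def g power2_eq_square)
    also have "\<dots> = zval \<theta> (zadd (zmul (ring R) w w) (zmul (ring R) w' w'))"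
      unfolding bal(2) using zval_zmul[OF c.quad] by (simp add: power2_eq_square)
    finally have "zgram_constant (ring R) (g 1 2) (g 1 3) (g 2 3) = zadd (zmul (ring R) w w) (zmul (ring R) w' w')"
      unfolding zval_eq_iff[OF quad] .
    then show ?thesis by (simp add: g_def)
  qed
  moreover have "k \<in> set (orientations R (r 1, r 2, r 3))"
    unfolding k_def using x(1) y(1) z(1) unfolding g_def by (rule orientations_mem)
  moreover have "acyclic_seed R k" using s(2) c.cyclic_realise[OF vk] sk by (simp add: acyclic_seed_def)
  ultimately have "k \<in> set (acute_seeds R strict (zadd (zmul (ring R) w w) (zmul (ring R) w' w')) N)"
    unfolding acute_seeds_def set_filter set_concat set_map by blast
  then have "known class_members k"
    using check by (simp add: classification_def classes_ok_def covers_def list_all_iff base_seed_def)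
  then have "sort1 k \<in> set class_members"
    by (simp add: known_def)
  then obtain f P p where f: "f \<in> set fs" "component R base_seed (start_seed w w' f) = Some P" "p \<in> set P" "sort1 k = sort1 (snd p)"
    by (rule member_class)
  have vf: "valid N (start_seed w w' f)" using starts[OF f(1)] by blast
  have "compatible_position u1 s"
    using c.class_member(2)[OF f(2) hd_start(2) vf f(3) vk f(4)] compatible_start[OF f(1) S(2)] sk by simp
  moreover have "mutation_class u1 s = mutation_class u1 (v, B)"
  proof (rule mutation_class_eq[OF _ _ s1])
    show "reference_point u1 (v, B)" using same_side_compatible(4)[OF S(3)] u by simp
    show "normalised (v, B)" using balanced_path(1)[OF v weights_definite] by (simp add: balanced_def)
  qed
  ultimately show ?thesis
    using compatible_position_cong_class(1) same_side_compatible(1)[OF S(3)] by blast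
qed

end

section \<open>The root systems A3, B3 and H3\<close>

text \<open>
  Coordinates of the positive roots in the simple roots, beginning with the simple roots
  themselves. For \<open>A3\<close> they are integers, and any quadratic ring would do.
\<close>

definition A3_roots :: "coords list" where
  "A3_roots = [((1, 0), (0, 0), (0, 0)), ((0, 0), (1, 0), (0, 0)), ((0, 0), (0, 0), (1, 0)),
     ((1, 0), (1, 0), (0, 0)), ((0, 0), (1, 0), (1, 0)), ((1, 0), (1, 0), (1, 0))]"

text \<open>
  With all roots of the same length the coordinates involve the square root of two.
\<close>

definition B3_roots :: "coords list" where
  "B3_roots = [((1, 0), (0, 0), (0, 0)), ((0, 0), (1, 0), (0, 0)), ((0, 0), (0, 0), (1, 0)),
     ((1, 0), (1, 0), (0, 0)), ((0, 0), (1, 0), (0, 1)), ((0, 0), (0, 1), (1, 0)),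
     ((1, 0), (1, 0), (0, 1)), ((0, 1), (0, 1), (1, 0)), ((1, 0), (2, 0), (0, 1))]"

definition H3_roots :: "coords list" where
  "H3_roots = [((1, 0), (0, 0), (0, 0)), ((0, 0), (1, 0), (0, 0)), ((0, 0), (0, 0), (1, 0)),
     ((1, 0), (1, 0), (0, 0)), ((0, 0), (1, 0), (0, 1)), ((0, 0), (0, 1), (1, 0)),
     ((1, 0), (1, 0), (0, 1)), ((0, 0), (0, 1), (0, 1)), ((0, 1), (0, 1), (1, 0)),
     ((1, 0), (1, 1), (0, 1)), ((0, 1), (0, 1), (0, 1)), ((0, 1), (1, 1), (0, 1)),
     ((1, 0), (1, 1), (1, 1)), ((0, 1), (1, 1), (1, 1)), ((0, 1), (0, 2), (1, 1))]"

text \<open>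
  For the weight \<open>2 * cos (pi * p / q)\<close> the short period is \<open>q + 2 * p\<close>. The weights that occur
  are those for the fractions one half, one third, one quarter, one fifth and two fifths.
\<close>

abbreviation (input) "A3_periods \<equiv> [((0, 0), 4), ((1, 0), 5)] :: (zq \<times> nat) list"
abbreviation (input) "B3_periods \<equiv> [((0, 0), 4), ((1, 0), 5), ((0, 1), 6)] :: (zq \<times> nat) list"
abbreviation (input) "H3_periods \<equiv> [((0, 0), 4), ((1, 0), 5), ((0, 1), 7), ((-1, 1), 9)] :: (zq \<times> nat) list"

definition A3_table where "A3_table = root_table (1, 1) ((1, 0), (1, 0)) A3_roots A3_periods"
definition B3_table where "B3_table = root_table (0, 2) ((1, 0), (0, 1)) B3_roots B3_periods"
definition H3_table where
  "H3_table = root_table (1, 1) ((1, 0), (0, 1)) H3_roots H3_periods"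

abbreviation (input) pos :: "nat \<Rightarrow> root" where "pos i \<equiv> (True, i)"
abbreviation (input) neg :: "nat \<Rightarrow> root" where "neg i \<equiv> (False, i)"

text \<open>
  One frame for each mutation class of compatible frames relative to a fixed chamber. These
  lists, like the walks in the classifications below, were found by search.
\<close>

abbreviation (input) simple_starts :: "(root \<times> root \<times> root) list" where
  "simple_starts \<equiv> [(pos 0, pos 1, pos 2), (neg 0, pos 1, pos 2), (neg 0, neg 1, pos 2), (neg 0, pos 4, neg 2)]"

abbreviation (input) third_starts :: "(root \<times> root \<times> root) list" where
  "third_starts \<equiv> [(pos 2, pos 9, pos 0), (neg 2, pos 9, pos 0), (neg 2, neg 9, pos 0), (neg 2, pos 11, neg 0),
      (neg 4, pos 0, pos 9), (pos 5, pos 6, pos 3)]"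

abbreviation (input) fifth_starts :: "(root \<times> root \<times> root) list" where
  "fifth_starts \<equiv> [(pos 0, pos 5, pos 2), (neg 0, pos 5, pos 2), (pos 0, pos 7, neg 2), (neg 0, pos 7, neg 2),
      (pos 6, pos 1, neg 7), (pos 3, pos 4, neg 5)]"

lemma A3_positive: "positive_roots (1, 1) ((1, 0), (1, 0)) A3_roots" by code_simp
lemma B3_positive: "positive_roots (0, 2) ((1, 0), (0, 1)) B3_roots" by code_simp
lemma H3_positive: "positive_roots (1, 1) ((1, 0), (0, 1)) H3_roots" by code_simp

text \<open>
  The list of numbers before the starting frames is the walk along which all incompatible frames
  are refuted.
\<close>

lemma A3_classification:
  "classification A3_table 6 (1, 0) (1, 0) False [1] simple_starts"
  by code_simp
lemma B3_classification:
  "classification B3_table 9 (1, 0) (0, 1) False [1, 1] simple_starts"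
  by code_simp
lemma H3_classification:
  "classification H3_table 15 (1, 0) (0, 1) False [2, 2, 1, 2, 1, 1] simple_starts"
  by code_simp
text \<open>
  The roots two, nine and zero form a path with weights \<open>1\<close> and \<open>\<theta> - 1\<close>: they are a basis of the
  space, though not a simple system.
\<close>

lemma H3'_classification:
  "classification H3_table 15 (1, 0) (-1, 1) True [1, 1, 2, 1, 1, 1] third_starts"
  by code_simp
lemma H3''_classification:
  "classification H3_table 15 (0, 1) (-1, 1) True [0, 1, 2, 2, 2, 2, 2, 2, 2] fifth_starts"
  by code_simp

section \<open>The golden ratio and the weights\<close>

lemma sqrt_prime_not_rational:
  assumes "prime (p::nat)" shows "sqrt p \<notin> \<rat>"
proof
  assume "sqrt p \<in> \<rat>"
  then obtain m n :: nat where n: "n \<noteq> 0" and mn: "\<bar>sqrt p\<bar> = m / n" and co: "coprime m n"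
    by (rule Rats_abs_nat_div_natE)
  have "real m = sqrt p * n" using n mn by (simp add: field_simps)
  then have "real (m\<^sup>2) = real (p * n\<^sup>2)" by (simp add: power_mult_distrib)
  then have eq: "m\<^sup>2 = p * n\<^sup>2" by (simp only: of_nat_eq_iff)
  then have "p dvd m" using assms by (metis dvd_triv_left prime_dvd_power)
  then obtain k where "m = p * k" ..
  then have "p * (p * k\<^sup>2) = p * n\<^sup>2" using eq by (simp add: power2_eq_square ac_simps)
  then have "n\<^sup>2 = p * k\<^sup>2" using assms by (simp add: prime_gt_0_nat)
  then have "p dvd n" using assms by (metis dvd_triv_left prime_dvd_power)
  with \<open>p dvd m\<close> co show False using assms by (metis coprime_common_divisor not_prime_unit)
qed

definition golden :: real where "golden = (1 + sqrt 5) / 2"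

lemma golden_square: "golden * golden = golden + 1"
  by (simp add: golden_def field_simps)

lemma golden_bounds: "3 / 2 < golden" "golden < 2"
proof -
  have "2 < sqrt 5" "sqrt 5 < 3" by (auto intro: real_less_rsqrt real_less_lsqrt)
  then show "3 / 2 < golden" "golden < 2" by (auto simp: golden_def)
qed

lemma quadratic_golden: "quadratic_irrational (1, 1) golden"
proof -
  have "golden \<notin> \<rat>"
  proof
    assume "golden \<in> \<rat>"
    then have "2 * golden - 1 \<in> \<rat>" by simp
    moreover have "2 * golden - 1 = sqrt (5::nat)" by (simp add: golden_def field_simps)
    ultimately show False using sqrt_prime_not_rational[of 5] by simp
  qed
  then show ?thesis using golden_square golden_bounds by (simp add: quadratic_irrational_def power2_eq_square)
qed

lemma quadratic_sqrt2: "quadratic_irrational (0, 2) (sqrt 2)"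
  using sqrt_prime_not_rational[of 2] by (simp add: quadratic_irrational_def)

text \<open>
  The angle \<open>pi / 5\<close> satisfies \<open>cos (2 * x) = - cos (3 * x)\<close>, a cubic equation for \<open>cos x\<close> from
  which the root \<open>- 1\<close> splits off.
\<close>

lemma cos_fifths: "2 * cos (pi / 5) = golden" "2 * cos (2 * pi / 5) = golden - 1"
proof -
  define c where "c = cos (pi / 5)"
  have c0: "0 < c" unfolding c_def by (rule cos_gt_zero) auto
  have c2: "cos (2 * pi / 5) = 2 * c\<^sup>2 - 1"
    using cos_double_cos[of "pi / 5"] by (simp add: c_def)
  have "cos (2 * pi / 5) = - cos (3 * (pi / 5))"
    using cos_minus_pi[of "3 * (pi / 5)"] cos_minus[of "2 * pi / 5"] by (simp add: algebra_simps)
  then have "(c + 1) * (4 * c\<^sup>2 - 2 * c - 1) = 0"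
    unfolding c2 cos_treble_cos by (simp add: c_def power2_eq_square power3_eq_cube algebra_simps)
  then have c4: "4 * c\<^sup>2 = 2 * c + 1" using c0 by simp
  have "(2 * c - golden) * (2 * c + golden - 1) = 0"
    using c4 golden_square by (simp add: power2_eq_square algebra_simps)
  then show g: "2 * cos (pi / 5) = golden" using c0 golden_bounds by (simp add: c_def)
  show "2 * cos (2 * pi / 5) = golden - 1" using c4 g c2 by (simp add: c_def)
qed

lemma cos_weights:
  "2 * cos (pi * (1 / 3)) = 1" "2 * cos (pi * (1 / 4)) = sqrt 2" "2 * cos (pi * (1 / 5)) = golden"
  "2 * cos (pi * (2 / 5)) = golden - 1"
  using cos_60 cos_45 cos_fifths by (simp_all add: mult.commute)

lemma period_facts:
  "\<exists>p q :: nat. p \<ge> 1 \<and> q \<ge> 1 \<and> coprime p q \<and> 2 * p \<le> q \<and> 0 = 2 * cos (pi * real p / real q) \<and> 4 = q + 2 * p"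
  "\<exists>p q :: nat. p \<ge> 1 \<and> q \<ge> 1 \<and> coprime p q \<and> 2 * p \<le> q \<and> 1 = 2 * cos (pi * real p / real q) \<and> 5 = q + 2 * p"
  "\<exists>p q :: nat. p \<ge> 1 \<and> q \<ge> 1 \<and> coprime p q \<and> 2 * p \<le> q \<and> sqrt 2 = 2 * cos (pi * real p / real q) \<and> 6 = q + 2 * p"
  "\<exists>p q :: nat. p \<ge> 1 \<and> q \<ge> 1 \<and> coprime p q \<and> 2 * p \<le> q \<and> golden = 2 * cos (pi * real p / real q) \<and> 7 = q + 2 * p"
  "\<exists>p q :: nat. p \<ge> 1 \<and> q \<ge> 1 \<and> coprime p q \<and> 2 * p \<le> q \<and> golden - 1 = 2 * cos (pi * real p / real q) \<and> 9 = q + 2 * p"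
proof -
  show "\<exists>p q :: nat. p \<ge> 1 \<and> q \<ge> 1 \<and> coprime p q \<and> 2 * p \<le> q \<and> 0 = 2 * cos (pi * real p / real q) \<and> 4 = q + 2 * p"
    by (rule exI[of _ 1], rule exI[of _ 2]) simp
  show "\<exists>p q :: nat. p \<ge> 1 \<and> q \<ge> 1 \<and> coprime p q \<and> 2 * p \<le> q \<and> 1 = 2 * cos (pi * real p / real q) \<and> 5 = q + 2 * p"
    by (rule exI[of _ 1], rule exI[of _ 3]) (simp add: cos_60)
  show "\<exists>p q :: nat. p \<ge> 1 \<and> q \<ge> 1 \<and> coprime p q \<and> 2 * p \<le> q \<and> sqrt 2 = 2 * cos (pi * real p / real q) \<and> 6 = q + 2 * p"
    by (rule exI[of _ 1], rule exI[of _ 4]) (simp add: cos_45)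
  show "\<exists>p q :: nat. p \<ge> 1 \<and> q \<ge> 1 \<and> coprime p q \<and> 2 * p \<le> q \<and> golden = 2 * cos (pi * real p / real q) \<and> 7 = q + 2 * p"
    by (rule exI[of _ 1], rule exI[of _ 5]) (simp add: cos_fifths)
  have "coprime (2::nat) 5" by simp
  moreover have "golden - 1 = 2 * cos (pi * real 2 / real 5)" using cos_fifths(2) by (simp add: mult.commute)
  ultimately show "\<exists>p q :: nat. p \<ge> 1 \<and> q \<ge> 1 \<and> coprime p q \<and> 2 * p \<le> q \<and> golden - 1 = 2 * cos (pi * real p / real q) \<and> 9 = q + 2 * p"
    by (intro exI[of _ 2] exI[of _ 5]) simp
qed

section \<open>Simple systems\<close>

text \<open>
  The outer two roots are put on the first two axes; the condition says that the middle one has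
  room for a third coordinate.
\<close>

lemma simple_system_exists:
  assumes "(zval \<theta> (fst ab))\<^sup>2 + (zval \<theta> (snd ab))\<^sup>2 < 4"
  shows "\<exists>S. simple_system \<theta> ab S"
proof -
  obtain \<alpha> \<beta> where ab: "ab = (\<alpha>, \<beta>)" by (cases ab)
  define A B s where "A = zval \<theta> \<alpha>" and "B = zval \<theta> \<beta>" and "s = sqrt (2 - (A\<^sup>2 + B\<^sup>2) / 2)"
  have s: "s * s = 2 - (A\<^sup>2 + B\<^sup>2) / 2" using assms by (simp add: s_def A_def B_def ab)
  define a b c :: "real^3" where "a = vector [sqrt 2, 0, 0]" and "b = vector [- A / sqrt 2, - B / sqrt 2, s]"
    and "c = vector [0, sqrt 2, 0]"
  have "a \<bullet> a = 2" "b \<bullet> b = 2" "c \<bullet> c = 2" "a \<bullet> b = - A" "b \<bullet> c = - B" "a \<bullet> c = 0"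
    using s by (simp_all add: a_def b_def c_def inner_vec_def sum_3 power2_eq_square field_simps)
  then have "simple_system \<theta> ab (a, b, c)" by (simp add: A_def B_def ab)
  then show ?thesis by blast
qed

text \<open>
  Changing the signs of the outer vectors makes both inner products nonpositive.
\<close>

lemma path_signs:
  assumes "geometric_realisation v (path_matrix x y)" "x\<^sup>2 + y\<^sup>2 < 4"
  obtains a c where "a \<bullet> a = 2" "v 2 \<bullet> v 2 = 2" "c \<bullet> c = 2" "a \<bullet> v 2 = - x" "c \<bullet> v 2 = - y" "a \<bullet> c = 0"
    "v 1 = a \<or> v 1 = - a" "v 3 = c \<or> v 3 = - c"
proof -
  have G: "v 1 \<bullet> v 1 = 2" "v 2 \<bullet> v 2 = 2" "v 3 \<bullet> v 3 = 2" "\<bar>v 1 \<bullet> v 2\<bar> = \<bar>x\<bar>" "\<bar>v 2 \<bullet> v 3\<bar> = \<bar>y\<bar>" "v 1 \<bullet> v 3 = 0"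
    using assms(1) unfolding geometric_realisation_path[OF assms(2)] by auto
  define a where "a = (if v 1 \<bullet> v 2 = - x then v 1 else - v 1)"
  define c where "c = (if v 2 \<bullet> v 3 = - y then v 3 else - v 3)"
  show ?thesis
    by (rule that[of a c]) (use G in \<open>auto simp: a_def c_def inner_commute abs_eq_iff\<close>)
qed

lemma root_set_pm:
  assumes "quadratic_irrational D \<theta>" "positive_roots D ab L" "simple_system \<theta> ab S"
    and "v 1 = a \<or> v 1 = - a" "v 3 = c \<or> v 3 = - c" "a \<in> root_set \<theta> L S" "v (2::3) \<in> root_set \<theta> L S" "c \<in> root_set \<theta> L S"
  shows "range v \<subseteq> root_set \<theta> L S"
proof -
  have "v i \<in> root_set \<theta> L S" for i
    using exhaust_3[of i] assms(4-8) root_set_uminus[OF assms(1,2), of _ S] by metis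
  then show ?thesis by blast
qed

lemma cvec_in_root_set: "i < length L \<Longrightarrow> cvec \<theta> S (L ! i) \<in> root_set \<theta> L S"
  unfolding root_set_def by (rule image_eqI[of _ _ "(True, i)"]) simp_all

text \<open>
  If the weights of the matrix are those of the root system, a realisation is a simple system up
  to signs.
\<close>

lemma system_of_simple_path:
  assumes "quadratic_irrational D \<theta>" "positive_roots D (\<alpha>, \<beta>) L" "(zval \<theta> \<alpha>)\<^sup>2 + (zval \<theta> \<beta>)\<^sup>2 < 4"
    and "geometric_realisation v (path_matrix (zval \<theta> \<alpha>) (zval \<theta> \<beta>))"
  shows "\<exists>S. simple_system \<theta> (\<alpha>, \<beta>) S \<and> range v \<subseteq> root_set \<theta> L S"
proof -
  obtain a c where ac: "a \<bullet> a = 2" "v 2 \<bullet> v 2 = 2" "c \<bullet> c = 2" "a \<bullet> v 2 = - zval \<theta> \<alpha>" "c \<bullet> v 2 = - zval \<theta> \<beta>" "a \<bullet> c = 0"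
    "v 1 = a \<or> v 1 = - a" "v 3 = c \<or> v 3 = - c"
    by (rule path_signs[OF assms(4,3)])
  have S: "simple_system \<theta> (\<alpha>, \<beta>) (a, v 2, c)" using ac by (simp add: inner_commute)
  have "range v \<subseteq> root_set \<theta> L (a, v 2, c)"
    by (rule root_set_pm[OF assms(1,2) S ac(7,8)]) (rule simple_in_root_set[OF assms(1,2)])+
  then show ?thesis using S by blast
qed

lemma zval_golden: "zval golden (-1, 1) = golden - 1"
  by (simp add: zval_def)

text \<open>
  The vectors of a realisation are up to sign the simple roots \<open>c\<close> and \<open>a\<close>, with between them
  the root with index nine, which is \<open>a + (1 + \<theta>) * b + \<theta> * c\<close>. Solving for \<open>b\<close> gives the simple
  system, as \<open>2 - \<theta>\<close> is the inverse of \<open>1 + \<theta>\<close>.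
\<close>

lemma system_of_third_two_fifths:
  assumes "geometric_realisation v (path_matrix 1 (golden - 1))"
  shows "\<exists>S. simple_system golden ((1, 0), (0, 1)) S \<and> range v \<subseteq> root_set golden H3_roots S"
proof -
  have lt: "1\<^sup>2 + (golden - 1)\<^sup>2 < 4" using golden_square golden_bounds by (simp add: power2_eq_square algebra_simps)
  obtain c a where ac: "c \<bullet> c = 2" "v 2 \<bullet> v 2 = 2" "a \<bullet> a = 2" "c \<bullet> v 2 = - 1" "a \<bullet> v 2 = - (golden - 1)" "c \<bullet> a = 0"
    "v 1 = c \<or> v 1 = - c" "v 3 = a \<or> v 3 = - a"
    by (rule path_signs[OF assms lt])
  have com: "v 2 \<bullet> c = - 1" "v 2 \<bullet> a = - (golden - 1)" "a \<bullet> c = 0" using ac by (simp_all add: inner_commute)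
  define b where "b = (2 - golden) *\<^sub>R (v 2 - a - golden *\<^sub>R c)"
  have sq: "golden * (golden * x) = golden * x + x" for x using golden_square by (metis distrib_right mult.assoc mult_1)
  have S: "simple_system golden ((1, 0), (0, 1)) (a, b, c)"
  proof -
    have "b \<bullet> b = (2 - golden) * ((2 - golden) * (2 + 2 + 2 * (golden * golden) + 2 * (golden - 1) + 2 * golden))"
      using ac(1-6) com by (simp add: b_def inner_diff_left inner_diff_right) (simp add: algebra_simps)
    moreover have "a \<bullet> b = (2 - golden) * (- (golden - 1) - 2)" "b \<bullet> c = (2 - golden) * (- 1 - golden * 2)"
      using ac(1-6) com by (simp_all add: b_def inner_diff_left inner_diff_right)
    ultimately show ?thesis using ac(1-6) com golden_square by (simp add: sq algebra_simps)
  qed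
  have v2: "v 2 = cvec golden (a, b, c) (H3_roots ! 9)"
  proof -
    have "(1 + golden) * (2 - golden) = 1" using golden_square by (simp add: algebra_simps)
    then have "(1 + golden) *\<^sub>R b = v 2 - a - golden *\<^sub>R c" by (simp add: b_def)
    then show ?thesis by (simp add: H3_roots_def zval_def)
  qed
  note L = quadratic_golden H3_positive
  have "range v \<subseteq> root_set golden H3_roots (a, b, c)"
    using root_set_pm[OF L S ac(7,8)] simple_in_root_set[OF L] cvec_in_root_set[of 9 H3_roots golden "(a, b, c)"] v2
    by (simp add: H3_roots_def)
  then show ?thesis using S by blast
qed

text \<open>
  Here the middle vector is the root with index five, \<open>\<theta> * b + c\<close>, and \<open>\<theta> - 1\<close> is the inverse of
  \<open>\<theta>\<close>.
\<close>

lemma system_of_fifth_two_fifths: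
  assumes "geometric_realisation v (path_matrix golden (golden - 1))"
  shows "\<exists>S. simple_system golden ((1, 0), (0, 1)) S \<and> range v \<subseteq> root_set golden H3_roots S"
proof -
  have lt: "golden\<^sup>2 + (golden - 1)\<^sup>2 < 4" using golden_square golden_bounds by (simp add: power2_eq_square algebra_simps)
  obtain a c where ac: "a \<bullet> a = 2" "v 2 \<bullet> v 2 = 2" "c \<bullet> c = 2" "a \<bullet> v 2 = - golden" "c \<bullet> v 2 = - (golden - 1)" "a \<bullet> c = 0"
    "v 1 = a \<or> v 1 = - a" "v 3 = c \<or> v 3 = - c"
    by (rule path_signs[OF assms lt])
  have com: "v 2 \<bullet> a = - golden" "v 2 \<bullet> c = - (golden - 1)" "c \<bullet> a = 0" using ac by (simp_all add: inner_commute)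
  define b where "b = (golden - 1) *\<^sub>R (v 2 - c)"
  have sq: "golden * (golden * x) = golden * x + x" for x using golden_square by (metis distrib_right mult.assoc mult_1)
  have S: "simple_system golden ((1, 0), (0, 1)) (a, b, c)"
  proof -
    have "b \<bullet> b = (golden - 1) * ((golden - 1) * (2 + 2 + 2 * (golden - 1)))"
      using ac(1-6) com by (simp add: b_def inner_diff_left inner_diff_right) (simp add: algebra_simps)
    moreover have "a \<bullet> b = (golden - 1) * (- golden)" "b \<bullet> c = (golden - 1) * (- (golden - 1) - 2)"
      using ac(1-6) com by (simp_all add: b_def inner_diff_left inner_diff_right)
    ultimately show ?thesis using ac(1-6) com golden_square by (simp add: sq algebra_simps)
  qed
  have v2: "v 2 = cvec golden (a, b, c) (H3_roots ! 5)"
  proof -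
    have "golden * (golden - 1) = 1" using golden_square by (simp add: algebra_simps)
    then have "golden *\<^sub>R b = v 2 - c" by (simp add: b_def)
    then show ?thesis by (simp add: H3_roots_def)
  qed
  note L = quadratic_golden H3_positive
  have "range v \<subseteq> root_set golden H3_roots (a, b, c)"
    using root_set_pm[OF L S ac(7,8)] simple_in_root_set[OF L] cvec_in_root_set[of 5 H3_roots golden "(a, b, c)"] v2
    by (simp add: H3_roots_def)
  then show ?thesis using S by blast
qed

section \<open>The five cases\<close>

lemma length_roots: "length A3_roots = 6" "length B3_roots = 9" "length H3_roots = 15"
  by (simp_all add: A3_roots_def B3_roots_def H3_roots_def)

lemma golden_less: "golden\<^sup>2 < 3" "(golden - 1)\<^sup>2 < 1" "golden\<^sup>2 + (golden - 1)\<^sup>2 < 4"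
  using golden_square golden_bounds by (simp_all add: power2_eq_square algebra_simps)

lemma golden_periods:
  assumes "(w, n) \<in> set H3_periods"
  shows "\<exists>p q :: nat. p \<ge> 1 \<and> q \<ge> 1 \<and> coprime p q \<and> 2 * p \<le> q \<and>
    zval golden w = 2 * cos (pi * real p / real q) \<and> n = q + 2 * p"
proof -
  consider "w = (0, 0)" "n = 4" | "w = (1, 0)" "n = 5" | "w = (0, 1)" "n = 7" | "w = (-1, 1)" "n = 9"
    using assms by auto
  then show ?thesis
    by cases (simp_all only: zval_simps of_int_0 of_int_1 zval_golden period_facts)
qed

lemma sqrt2_periods:
  assumes "(w, n) \<in> set B3_periods"
  shows "\<exists>p q :: nat. p \<ge> 1 \<and> q \<ge> 1 \<and> coprime p q \<and> 2 * p \<le> q \<and>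
    zval (sqrt 2) w = 2 * cos (pi * real p / real q) \<and> n = q + 2 * p"
proof -
  consider "w = (0, 0)" "n = 4" | "w = (1, 0)" "n = 5" | "w = (0, 1)" "n = 6"
    using assms by auto
  then show ?thesis
    by cases (simp_all only: zval_simps of_int_0 of_int_1 period_facts)
qed

lemma A3_locale:
  "path_classification (1, 1) golden ((1, 0), (1, 0)) A3_roots A3_periods (1, 0) (1, 0) False [1] simple_starts"
proof
  show "quadratic_irrational (1, 1) golden" by (rule quadratic_golden)
  show "0 \<le> golden" using golden_bounds by simp
  show "positive_roots (1, 1) ((1, 0), (1, 0)) A3_roots" by (rule A3_positive)
  show "(zval golden (fst ((1, 0), (1, 0))))\<^sup>2 + (zval golden (snd ((1, 0), (1, 0))))\<^sup>2 < 4" by simp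
  then show "\<exists>S. simple_system golden ((1, 0), (1, 0)) S" by (rule simple_system_exists)
  show "(zval golden (1, 0))\<^sup>2 + (zval golden (1, 0))\<^sup>2 < 4" by simp
  show "classification (root_table (1, 1) ((1, 0), (1, 0)) A3_roots A3_periods) (length A3_roots) (1, 0) (1, 0) False [1] simple_starts"
    using A3_classification unfolding A3_table_def length_roots .
  show "\<exists>p q :: nat. p \<ge> 1 \<and> q \<ge> 1 \<and> coprime p q \<and> 2 * p \<le> q \<and>
      zval golden x = 2 * cos (pi * real p / real q) \<and> n = q + 2 * p" if "(x, n) \<in> set A3_periods" for x n
    by (rule golden_periods) (use that in auto)
  show "\<exists>S. simple_system golden ((1, 0), (1, 0)) S \<and> range v \<subseteq> root_set golden A3_roots S"
    if "geometric_realisation v (path_matrix (zval golden (1, 0)) (zval golden (1, 0)))" for v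
    using system_of_simple_path[OF quadratic_golden A3_positive _ that] by simp
qed

lemma B3_locale:
  "path_classification (0, 2) (sqrt 2) ((1, 0), (0, 1)) B3_roots B3_periods (1, 0) (0, 1) False [1, 1] simple_starts"
proof
  show "quadratic_irrational (0, 2) (sqrt 2)" by (rule quadratic_sqrt2)
  show "0 \<le> (sqrt 2)" by simp
  show "positive_roots (0, 2) ((1, 0), (0, 1)) B3_roots" by (rule B3_positive)
  show "(zval (sqrt 2) (fst ((1, 0), (0, 1))))\<^sup>2 + (zval (sqrt 2) (snd ((1, 0), (0, 1))))\<^sup>2 < 4" by simp
  then show "\<exists>S. simple_system (sqrt 2) ((1, 0), (0, 1)) S" by (rule simple_system_exists)
  show "(zval (sqrt 2) (1, 0))\<^sup>2 + (zval (sqrt 2) (0, 1))\<^sup>2 < 4" by simp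
  show "classification (root_table (0, 2) ((1, 0), (0, 1)) B3_roots B3_periods) (length B3_roots) (1, 0) (0, 1) False [1, 1] simple_starts"
    using B3_classification unfolding B3_table_def length_roots .
  show "\<exists>p q :: nat. p \<ge> 1 \<and> q \<ge> 1 \<and> coprime p q \<and> 2 * p \<le> q \<and>
      zval (sqrt 2) x = 2 * cos (pi * real p / real q) \<and> n = q + 2 * p" if "(x, n) \<in> set B3_periods" for x n
    by (rule sqrt2_periods) (use that in auto)
  show "\<exists>S. simple_system (sqrt 2) ((1, 0), (0, 1)) S \<and> range v \<subseteq> root_set (sqrt 2) B3_roots S"
    if "geometric_realisation v (path_matrix (zval (sqrt 2) (1, 0)) (zval (sqrt 2) (0, 1)))" for v
    using system_of_simple_path[OF quadratic_sqrt2 B3_positive _ that] by simp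
qed

lemma H3_locale:
  "path_classification (1, 1) golden ((1, 0), (0, 1)) H3_roots H3_periods (1, 0) (0, 1) False [2, 2, 1, 2, 1, 1] simple_starts"
proof
  show "quadratic_irrational (1, 1) golden" by (rule quadratic_golden)
  show "0 \<le> golden" using golden_bounds by simp
  show "positive_roots (1, 1) ((1, 0), (0, 1)) H3_roots" by (rule H3_positive)
  show "(zval golden (fst ((1, 0), (0, 1))))\<^sup>2 + (zval golden (snd ((1, 0), (0, 1))))\<^sup>2 < 4" using golden_less by simp
  then show "\<exists>S. simple_system golden ((1, 0), (0, 1)) S" by (rule simple_system_exists)
  show "(zval golden (1, 0))\<^sup>2 + (zval golden (0, 1))\<^sup>2 < 4" using golden_less by simp
  show "classification (root_table (1, 1) ((1, 0), (0, 1)) H3_roots H3_periods) (length H3_roots) (1, 0) (0, 1) False [2, 2, 1, 2, 1, 1] simple_starts"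
    using H3_classification unfolding H3_table_def length_roots .
  show "\<exists>p q :: nat. p \<ge> 1 \<and> q \<ge> 1 \<and> coprime p q \<and> 2 * p \<le> q \<and>
      zval golden x = 2 * cos (pi * real p / real q) \<and> n = q + 2 * p" if "(x, n) \<in> set H3_periods" for x n
    by (rule golden_periods) (use that in auto)
  show "\<exists>S. simple_system golden ((1, 0), (0, 1)) S \<and> range v \<subseteq> root_set golden H3_roots S"
    if "geometric_realisation v (path_matrix (zval golden (1, 0)) (zval golden (0, 1)))" for v
    using system_of_simple_path[OF quadratic_golden H3_positive _ that] golden_less by simp
qed

lemma H3'_locale:
  "path_classification (1, 1) golden ((1, 0), (0, 1)) H3_roots H3_periods (1, 0) (-1, 1) True [1, 1, 2, 1, 1, 1] third_starts"
proof
  show "quadratic_irrational (1, 1) golden" by (rule quadratic_golden)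
  show "0 \<le> golden" using golden_bounds by simp
  show "positive_roots (1, 1) ((1, 0), (0, 1)) H3_roots" by (rule H3_positive)
  show "(zval golden (fst ((1, 0), (0, 1))))\<^sup>2 + (zval golden (snd ((1, 0), (0, 1))))\<^sup>2 < 4" using golden_less by simp
  then show "\<exists>S. simple_system golden ((1, 0), (0, 1)) S" by (rule simple_system_exists)
  show "(zval golden (1, 0))\<^sup>2 + (zval golden (-1, 1))\<^sup>2 < 4" using golden_less by (simp add: zval_golden)
  show "classification (root_table (1, 1) ((1, 0), (0, 1)) H3_roots H3_periods) (length H3_roots) (1, 0) (-1, 1) True [1, 1, 2, 1, 1, 1] third_starts"
    using H3'_classification unfolding H3_table_def length_roots .
  show "\<exists>p q :: nat. p \<ge> 1 \<and> q \<ge> 1 \<and> coprime p q \<and> 2 * p \<le> q \<and>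
      zval golden x = 2 * cos (pi * real p / real q) \<and> n = q + 2 * p" if "(x, n) \<in> set H3_periods" for x n
    by (rule golden_periods) (use that in auto)
  show "\<exists>S. simple_system golden ((1, 0), (0, 1)) S \<and> range v \<subseteq> root_set golden H3_roots S"
    if "geometric_realisation v (path_matrix (zval golden (1, 0)) (zval golden (-1, 1)))" for v
    using system_of_third_two_fifths that by (simp add: zval_golden)
qed

lemma H3''_locale:
  "path_classification (1, 1) golden ((1, 0), (0, 1)) H3_roots H3_periods (0, 1) (-1, 1) True [0, 1, 2, 2, 2, 2, 2, 2, 2] fifth_starts"
proof
  show "quadratic_irrational (1, 1) golden" by (rule quadratic_golden)
  show "0 \<le> golden" using golden_bounds by simp
  show "positive_roots (1, 1) ((1, 0), (0, 1)) H3_roots" by (rule H3_positive)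
  show "(zval golden (fst ((1, 0), (0, 1))))\<^sup>2 + (zval golden (snd ((1, 0), (0, 1))))\<^sup>2 < 4" using golden_less by simp
  then show "\<exists>S. simple_system golden ((1, 0), (0, 1)) S" by (rule simple_system_exists)
  show "(zval golden (0, 1))\<^sup>2 + (zval golden (-1, 1))\<^sup>2 < 4" using golden_less by (simp add: zval_golden)
  show "classification (root_table (1, 1) ((1, 0), (0, 1)) H3_roots H3_periods) (length H3_roots) (0, 1) (-1, 1) True [0, 1, 2, 2, 2, 2, 2, 2, 2] fifth_starts"
    using H3''_classification unfolding H3_table_def length_roots .
  show "\<exists>p q :: nat. p \<ge> 1 \<and> q \<ge> 1 \<and> coprime p q \<and> 2 * p \<le> q \<and>
      zval golden x = 2 * cos (pi * real p / real q) \<and> n = q + 2 * p" if "(x, n) \<in> set H3_periods" for x n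
    by (rule golden_periods) (use that in auto)
  show "\<exists>S. simple_system golden ((1, 0), (0, 1)) S \<and> range v \<subseteq> root_set golden H3_roots S"
    if "geometric_realisation v (path_matrix (zval golden (0, 1)) (zval golden (-1, 1)))" for v
    using system_of_fifth_two_fifths that by (simp add: zval_golden)
qed

text \<open>
  The proposition \<open>T\<close> will be the disjunct by which the first three pairs are exempt from
  strictness.
\<close>

lemma (in path_classification) all_parts:
  assumes T: "strict \<Longrightarrow> \<not> T"
  shows
    "(\<exists>v u. geometric_realisation v B \<and> compatible_position u (v, B)) \<and>
     (\<forall>v u v' u'. geometric_realisation v B \<and> compatible_position u (v, B) \<and>
        geometric_realisation v' B \<and> compatible_position u' (v', B) \<longrightarrow>
        graph_isomorphic (exchange_graph u (v, B)) (exchange_graph u' (v', B))) \<and>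
     (\<forall>v u. geometric_realisation v B \<and> compatible_position u (v, B) \<longrightarrow>
        (\<exists>s \<in> mutation_class u (v, B).
           acyclic_matrix (snd s) \<and> acute_angled s \<and> u \<in> seed_domain s)) \<and>
     (\<forall>v u\<^sub>0 s u. geometric_realisation v B \<and> compatible_position u\<^sub>0 (v, B) \<and>
        s \<in> mutation_class u\<^sub>0 (v, B) \<and> acyclic_matrix (snd s) \<and> u \<in> seed_domain s \<and>
        (\<forall>w \<in> occurring_vectors u\<^sub>0 (v, B). u \<notin> great_circle w) \<longrightarrow>
        (\<exists>v'. geometric_realisation v' B \<and> range v' \<subseteq> occurring_vectors u\<^sub>0 (v, B) \<and>
              compatible_position u (v', B))) \<and>
     (\<forall>v u s. geometric_realisation v B \<and> reference_point u (v, B) \<and>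
        s \<in> mutation_class u (v, B) \<and> acyclic_matrix (snd s) \<and> acute_angled s \<and>
        u \<in> seed_domain s \<and> (T \<or> strictly_acute_angled s) \<longrightarrow>
        compatible_position u (v, B))"
proof (intro conjI allI impI)
  show "\<exists>v u. geometric_realisation v B \<and> compatible_position u (v, B)"
    by (rule compatible_realisation_exists)
next
  fix v u v' u'
  assume "geometric_realisation v B \<and> compatible_position u (v, B) \<and>
        geometric_realisation v' B \<and> compatible_position u' (v', B)"
  then show "graph_isomorphic (exchange_graph u (v, B)) (exchange_graph u' (v', B))"
    using exchange_graphs_isomorphic by blast
next
  fix v u assume "geometric_realisation v B \<and> compatible_position u (v, B)"
  then show "\<exists>s \<in> mutation_class u (v, B). acyclic_matrix (snd s) \<and> acute_angled s \<and> u \<in> seed_domain s"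
    using compatible_point_in_acute_domain by blast
next
  fix v u\<^sub>0 s u
  assume h: "geometric_realisation v B \<and> compatible_position u\<^sub>0 (v, B) \<and>
        s \<in> mutation_class u\<^sub>0 (v, B) \<and> acyclic_matrix (snd s) \<and> u \<in> seed_domain s \<and>
        (\<forall>w \<in> occurring_vectors u\<^sub>0 (v, B). u \<notin> great_circle w)"
  then have "norm u = 1" by (auto simp: seed_domain_def hemisphere_def)
  then show "\<exists>v'. geometric_realisation v' B \<and> range v' \<subseteq> occurring_vectors u\<^sub>0 (v, B) \<and> compatible_position u (v', B)"
    using h compatible_realisation_for_generic_point by blast
next
  fix v u s
  assume "geometric_realisation v B \<and> reference_point u (v, B) \<and>
        s \<in> mutation_class u (v, B) \<and> acyclic_matrix (snd s) \<and> acute_angled s \<and>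
        u \<in> seed_domain s \<and> (T \<or> strictly_acute_angled s)"
  then show "compatible_position u (v, B)" using acute_seed_compatible[of v u s] T by blast
qed

theorem theorem2p27:
  fixes t1 t2 :: real and B :: "real^3^3"
  assumes "(t1, t2) \<in> {(1/3, 1/3), (1/3, 1/4), (1/3, 1/5), (1/3, 2/5), (1/5, 2/5)}"
    and "B = vector [vector [0, 2 * cos (pi * t1), 0],
                     vector [- (2 * cos (pi * t1)), 0, 2 * cos (pi * t2)],
                     vector [0, - (2 * cos (pi * t2)), 0]]"
  shows
    "(\<exists>v u. geometric_realisation v B \<and> compatible_position u (v, B)) \<and>
     (\<forall>v u v' u'. geometric_realisation v B \<and> compatible_position u (v, B) \<and>
        geometric_realisation v' B \<and> compatible_position u' (v', B) \<longrightarrow>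
        graph_isomorphic (exchange_graph u (v, B)) (exchange_graph u' (v', B))) \<and>
     (\<forall>v u. geometric_realisation v B \<and> compatible_position u (v, B) \<longrightarrow>
        (\<exists>s \<in> mutation_class u (v, B).
           acyclic_matrix (snd s) \<and> acute_angled s \<and> u \<in> seed_domain s)) \<and>
     (\<forall>v u\<^sub>0 s u. geometric_realisation v B \<and> compatible_position u\<^sub>0 (v, B) \<and>
        s \<in> mutation_class u\<^sub>0 (v, B) \<and> acyclic_matrix (snd s) \<and> u \<in> seed_domain s \<and>
        (\<forall>w \<in> occurring_vectors u\<^sub>0 (v, B). u \<notin> great_circle w) \<longrightarrow>
        (\<exists>v'. geometric_realisation v' B \<and> range v' \<subseteq> occurring_vectors u\<^sub>0 (v, B) \<and>
              compatible_position u (v', B))) \<and>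
     (\<forall>v u s. geometric_realisation v B \<and> reference_point u (v, B) \<and>
        s \<in> mutation_class u (v, B) \<and> acyclic_matrix (snd s) \<and> acute_angled s \<and>
        u \<in> seed_domain s \<and>
        ((t1, t2) \<in> {(1/3, 1/3), (1/3, 1/4), (1/3, 1/5)} \<or> strictly_acute_angled s) \<longrightarrow>
        compatible_position u (v, B))"
proof -
  have B: "B = path_matrix (2 * cos (pi * t1)) (2 * cos (pi * t2))"
    unfolding assms(2) path_matrix_def ..
  from assms(1) consider "t1 = 1/3" "t2 = 1/3" | "t1 = 1/3" "t2 = 1/4" | "t1 = 1/3" "t2 = 1/5"
    | "t1 = 1/3" "t2 = 2/5" | "t1 = 1/5" "t2 = 2/5" by auto
  then show ?thesis
  proof cases
    case 1
    have e: "B = path_matrix (zval golden (1, 0)) (zval golden (1, 0))"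
      by (simp only: B 1 cos_weights zval_simps zval_golden of_int_1)
    show ?thesis unfolding e by (rule path_classification.all_parts[OF A3_locale]) simp
  next
    case 2
    have e: "B = path_matrix (zval (sqrt 2) (1, 0)) (zval (sqrt 2) (0, 1))"
      by (simp only: B 2 cos_weights zval_simps zval_golden of_int_1)
    show ?thesis unfolding e by (rule path_classification.all_parts[OF B3_locale]) simp
  next
    case 3
    have e: "B = path_matrix (zval golden (1, 0)) (zval golden (0, 1))"
      by (simp only: B 3 cos_weights zval_simps zval_golden of_int_1)
    show ?thesis unfolding e by (rule path_classification.all_parts[OF H3_locale]) simp
  next
    case 4
    have e: "B = path_matrix (zval golden (1, 0)) (zval golden (-1, 1))"
      by (simp only: B 4 cos_weights zval_simps zval_golden of_int_1)
    have "(t1, t2) \<notin> {(1/3, 1/3), (1/3, 1/4), (1/3, 1/5)}" using 4 by simp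
    then show ?thesis unfolding e by (rule path_classification.all_parts[OF H3'_locale])
  next
    case 5
    have e: "B = path_matrix (zval golden (0, 1)) (zval golden (-1, 1))"
      by (simp only: B 5 cos_weights zval_simps zval_golden of_int_1)
    have "(t1, t2) \<notin> {(1/3, 1/3), (1/3, 1/4), (1/3, 1/5)}" using 5 by simp
    then show ?thesis unfolding e by (rule path_classification.all_parts[OF H3''_locale])
  qed
qed

end
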